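(* Let $\kappa\ge 3$ and let $K\in\mathbf{P}_\kappa^{\mathcal T}$ be a polygon with side-lengths $r_1,\dots,r_\kappa$ and internal angles $\theta_1,\dots,\theta_\kappa$. Let $T_j$ be the area of the triangle with vertices $\mathsf p_j,\mathsf v_{j+1},\mathsf p_{j+1}$ for $j\in\{1,\dots,\kappa\}$, where $\mathsf p_j$ is the tangency point of $\mathsf{Dom}(K)$ with the $j$-th side of $K$. Then the vector $\big(\sqrt[3]{2T_1},\dots,\sqrt[3]{2T_\kappa}\big)$ is the unique solution $(f_1,\dots,f_\kappa)$ with positive coordinates of the system $$f_j\,(f_j+f_{j-1})\,(f_j+f_{j+1})=r_j\, r_{j+1}\,\sin(\theta_j),\qquad \forall j\in\{1,\dots,\kappa\}.$$ Moreover, with this $f$, the numbers $w_j:=\|\mathsf v_{j+1}-\mathsf p_j\|/r_j$ satisfy $$w_j=\frac{f_j}{f_j+f_{j-1}},\qquad \forall j\in\{1,\dots,\kappa\}.$$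
   Context: Indices $j\in\{1,\dots,\kappa\}$ are cyclic: $j-1$ means $\kappa$ when $j=1$, and $j+1$ means $1$ when $j=\kappa$. $\|\cdot\|$ is the Euclidean norm. Polygons. For $\kappa\ge3$, $\mathbf P_\kappa$ is the set of convex polygons $K\subset\mathbb R\times[0,+\infty)$ with non-empty interior, having exactly $\kappa$ vertices (extremal points), with a vertex $\mathsf v_1=(0,0)$ and a side $[\mathsf v_1,\mathsf v_2]$ contained in $[0,+\infty)\times\{0\}$. The vertices $\mathsf v_1,\dots,\mathsf v_\kappa$ are numbered counterclockwise. The $j$-th side is $[\mathsf v_j,\mathsf v_{j+1}]$, its length is $r_j$, and $\theta_j$ is the internal angle between the $j$-th and $(j+1)$-th sides (i.e. at $\mathsf v_{j+1}$). Affine perimeter. For a compact convex set $S\subset\mathbb R^2$ with non-empty interior, take a subdivision $x_1,\dots,x_m,x_{m+1}=x_1$ of $\partial S$ (in cyclic order), let $d_i$ be a line supporting $S$ at $x_i$, let $y_i=d_i\cap d_{i+1}$ (any point between $x_i$ and $x_{i+1}$ if $d_i=d_{i+1}$), and let $T(x_i,y_i,x_{i+1})$ be the area of the triangle $x_i,y_i,x_{i+1}$. Then $\mathrm{AP}(S)=2\lim\sum_{i=1}^m \sqrt[3]{T(x_i,y_i,x_{i+1})}$, the limit being over sequences of subdivisions with $m\to\infty$ and $\max_i|x_i-x_{i+1}|\to0$. Limit shape. For a compact convex set $K$ with non-empty interior, $\mathrm{AP}^*(K)=\max\{\mathrm{AP}(S): S\subset K \text{ convex}\}$, and $\mathsf{Dom}(K)$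 is the unique convex subset of $K$ with $\mathrm{AP}(\mathsf{Dom}(K))=\mathrm{AP}^*(K)$ (existence and uniqueness are a known theorem of Bárány; for a polygon $K$ the boundary of $\mathsf{Dom}(K)$ consists of finitely many parabola arcs and contains no line segment). $\mathsf{Dom}(K)$ is said to be tangent to a side of $K$ if its boundary touches that side; the touching point (unique) is the tangency point. $\mathbf P^{\mathcal T}_\kappa$ is the set of $K\in\mathbf P_\kappa$ such that $\mathsf{Dom}(K)$ is tangent to all $\kappa$ sides of $K$. *)

theory Defs
  imports "HOL-Analysis.Analysis"
begin

subsection \<open>Polygons\<close>

definition nxt :: "nat \<Rightarrow> nat \<Rightarrow> nat" where
  "nxt \<kappa> j = (if j = \<kappa> then 1 else j + 1)"

definition prv :: "nat \<Rightarrow> nat \<Rightarrow> nat" where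
  "prv \<kappa> j = (if j = 1 then \<kappa> else j - 1)"

definition convex_polygons :: "nat \<Rightarrow> (real^2) set set" where
  "convex_polygons \<kappa> = {K. polytope K \<and> interior K \<noteq> {} \<and> K \<subseteq> {p. 0 \<le> p $ 2} \<and>
     card {x. x extreme_point_of K} = \<kappa> \<and> 0 extreme_point_of K \<and>
     (\<exists>u. closed_segment 0 u edge_of K \<and> closed_segment 0 u \<subseteq> {p. 0 \<le> p $ 1 \<and> p $ 2 = 0})}"

definition cross2 :: "real^2 \<Rightarrow> real^2 \<Rightarrow> real" where
  "cross2 u w = u $ 1 * w $ 2 - u $ 2 * w $ 1"

definition side :: "nat \<Rightarrow> (nat \<Rightarrow> real^2) \<Rightarrow> nat \<Rightarrow> (real^2) set" where
  "side \<kappa> v j = closed_segment (v j) (v (nxt \<kappa> j))"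

text \<open>Counterclockwise means that \<open>K\<close> lies to the left of every side \<open>[v j, v (j+1)]\<close> directed
  from \<open>v j\<close> to \<open>v (j+1)\<close>. The numbering is determined by \<open>K\<close>; only the values of \<open>v\<close> on
  \<open>{1..\<kappa>}\<close> matter.\<close>

definition ccw_vertices :: "nat \<Rightarrow> (real^2) set \<Rightarrow> (nat \<Rightarrow> real^2) \<Rightarrow> bool" where
  "ccw_vertices \<kappa> K v \<longleftrightarrow>
     bij_betw v {1..\<kappa>} {x. x extreme_point_of K} \<and>
     v 1 = 0 \<and> side \<kappa> v 1 \<subseteq> {p. 0 \<le> p $ 1 \<and> p $ 2 = 0} \<and>
     (\<forall>j\<in>{1..\<kappa>}. side \<kappa> v j edge_of K \<and>
        (\<forall>x\<in>K. 0 \<le> cross2 (v (nxt \<kappa> j) - v j) (x - v j)))"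

definition side_length :: "nat \<Rightarrow> (nat \<Rightarrow> real^2) \<Rightarrow> nat \<Rightarrow> real" where
  "side_length \<kappa> v j = norm (v (nxt \<kappa> j) - v j)"

definition vec_angle :: "real^2 \<Rightarrow> real^2 \<Rightarrow> real" where
  "vec_angle u w = arccos (u \<bullet> w / (norm u * norm w))"

text \<open>The angle with index \<open>j\<close> sits at the vertex \<open>v (j+1)\<close>. By convexity an internal angle lies in
  \<open>(0, \<pi>)\<close>, so it is the unoriented angle between the two sides leaving that vertex.\<close>

definition internal_angle :: "nat \<Rightarrow> (nat \<Rightarrow> real^2) \<Rightarrow> nat \<Rightarrow> real" where
  "internal_angle \<kappa> v j =
     vec_angle (v j - v (nxt \<kappa> j)) (v (nxt \<kappa> (nxt \<kappa> j)) - v (nxt \<kappa> j))"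

definition triangle_area :: "real^2 \<Rightarrow> real^2 \<Rightarrow> real^2 \<Rightarrow> real" where
  "triangle_area a b c = measure lebesgue (convex hull {a, b, c})"

subsection \<open>Affine perimeter\<close>

definition convex_body :: "(real^2) set \<Rightarrow> bool" where
  "convex_body S \<longleftrightarrow> compact S \<and> convex S \<and> interior S \<noteq> {}"

definition supporting_line :: "(real^2) set \<Rightarrow> real^2 \<Rightarrow> (real^2) set \<Rightarrow> bool" where
  "supporting_line S x d \<longleftrightarrow>
     x \<in> S \<and> (\<exists>n. n \<noteq> 0 \<and> d = {z. n \<bullet> z = n \<bullet> x} \<and> (\<forall>z\<in>S. n \<bullet> z \<le> n \<bullet> x))"

text \<open>The points \<open>x 1, \<dots>, x m, x (m+1) = x 1\<close> follow each other in cyclic order on the boundary of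
  \<open>S\<close>, which is expressed by a parametrization \<open>\<gamma>\<close> of the boundary as a simple closed curve;
  \<open>A i\<close> is the boundary arc from \<open>x i\<close> to \<open>x (i+1)\<close>.\<close>

definition subdivision ::
  "(real^2) set \<Rightarrow> nat \<Rightarrow> (nat \<Rightarrow> real^2) \<Rightarrow> (nat \<Rightarrow> (real^2) set) \<Rightarrow> bool" where
  "subdivision S m x A \<longleftrightarrow>
     (\<exists>\<gamma> t. simple_path \<gamma> \<and> pathfinish \<gamma> = pathstart \<gamma> \<and> path_image \<gamma> = frontier S \<and>
        t 1 = 0 \<and> t (m + 1) = 1 \<and> strict_mono_on {1..m + 1} t \<and>
        (\<forall>i\<in>{1..m + 1}. x i = \<gamma> (t i)) \<and>
        (\<forall>i\<in>{1..m}. A i = \<gamma> ` {t i..t (i + 1)}))"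

definition supporting_data ::
  "(real^2) set \<Rightarrow> nat \<Rightarrow> (nat \<Rightarrow> real^2) \<Rightarrow> (nat \<Rightarrow> (real^2) set) \<Rightarrow> (nat \<Rightarrow> real^2) \<Rightarrow> bool" where
  "supporting_data S m x d y \<longleftrightarrow>
     (\<forall>i\<in>{1..m + 1}. supporting_line S (x i) (d i)) \<and> d (m + 1) = d 1 \<and>
     (\<forall>i\<in>{1..m}. if d i = d (i + 1) then y i \<in> closed_segment (x i) (x (i + 1))
                 else d i \<inter> d (i + 1) = {y i})"

text \<open>The mesh is the largest diameter of an arc between consecutive subdivision points. It dominates
  \<open>max |x i - x (i+1)|\<close>. The latter alone would not do: it also tends to 0 when all subdivision
  points accumulate at a single boundary point, and such sequences do not see the rest of the
  boundary. For subdivisions that do exhaust the boundary the two conditions agree.\<close>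

definition has_affine_perimeter :: "(real^2) set \<Rightarrow> real \<Rightarrow> bool" where
  "has_affine_perimeter S a \<longleftrightarrow>
     (\<forall>m x A d y.
        (\<forall>n. subdivision S (m n) (x n) (A n) \<and> supporting_data S (m n) (x n) (d n) (y n)) \<and>
        filterlim m at_top sequentially \<and>
        (\<lambda>n. MAX i\<in>{1..m n}. diameter (A n i)) \<longlonglongrightarrow> 0 \<longrightarrow>
        (\<lambda>n. 2 * (\<Sum>i = 1..m n. root 3 (triangle_area (x n i) (y n i) (x n (i + 1)))))
          \<longlonglongrightarrow> a)"

definition AP :: "(real^2) set \<Rightarrow> real" where
  "AP S = (THE a. has_affine_perimeter S a)"

subsection \<open>Limit shape\<close>

text \<open>\<open>is_AP_star K a\<close> says that \<open>a\<close> is the maximum of \<open>AP S\<close>, and \<open>is_Dom K D\<close> that \<open>D\<close> is the unique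
  set at which it is attained. The competitors are the convex subsets of \<open>K\<close> on which \<open>AP\<close> is defined,
  that is, the compact ones with non-empty interior.\<close>

definition is_AP_star :: "(real^2) set \<Rightarrow> real \<Rightarrow> bool" where
  "is_AP_star K a \<longleftrightarrow>
     (\<exists>S. convex_body S \<and> S \<subseteq> K \<and> AP S = a) \<and> (\<forall>S. convex_body S \<and> S \<subseteq> K \<longrightarrow> AP S \<le> a)"

definition is_Dom :: "(real^2) set \<Rightarrow> (real^2) set \<Rightarrow> bool" where
  "is_Dom K D \<longleftrightarrow>
     convex_body D \<and> D \<subseteq> K \<and> is_AP_star K (AP D) \<and>
     (\<forall>S. convex_body S \<and> S \<subseteq> K \<and> is_AP_star K (AP S) \<longrightarrow> S = D)"

definition Dom :: "(real^2) set \<Rightarrow> (real^2) set" where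
  "Dom K = (THE D. is_Dom K D)"

definition tangency_point :: "(real^2) set \<Rightarrow> (real^2) set \<Rightarrow> real^2 \<Rightarrow> bool" where
  "tangency_point D e p \<longleftrightarrow> p \<in> frontier D \<and> p \<in> e"

text \<open>The conjunct \<open>is_Dom K (Dom K)\<close> says that \<open>Dom K\<close> is defined, which is Barany's theorem and
  holds for every \<open>K\<close>. It is spelled out because \<open>THE\<close> is total: a property of \<open>Dom K\<close> is meant to
  be a property of the actual limit shape.\<close>

definition tangent_polygons :: "nat \<Rightarrow> (real^2) set set" where
  "tangent_polygons \<kappa> = {K \<in> convex_polygons \<kappa>. is_Dom K (Dom K) \<and>
     (\<forall>e. e edge_of K \<longrightarrow> (\<exists>p. tangency_point (Dom K) e p))}"

subsection \<open>The system of equations\<close>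

definition positive_solution ::
  "nat \<Rightarrow> (nat \<Rightarrow> real) \<Rightarrow> (nat \<Rightarrow> real) \<Rightarrow> (nat \<Rightarrow> real) \<Rightarrow> bool" where
  "positive_solution \<kappa> r \<theta> f \<longleftrightarrow>
     (\<forall>j\<in>{1..\<kappa>}. 0 < f j) \<and>
     (\<forall>j\<in>{1..\<kappa>}. f j * (f j + f (prv \<kappa> j)) * (f j + f (nxt \<kappa> j)) =
                  r j * r (nxt \<kappa> j) * sin (\<theta> j))"

end

theory Submission
  imports Defs
begin

text \<open>Between the tangency points \<open>p j\<close> and \<open>p (j + 1)\<close> the boundary of a convex set
  \<open>D\<close> inside \<open>K\<close> runs in the triangle cut off at \<open>v (j + 1)\<close>, so it contributes at most
  \<open>2 T\<^sub>j\<^sup>1\<^sup>/\<^sup>3\<close> to the affine perimeter, with equality for the parabola arc tangent to the two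
  sides at these points. Hence the relative positions \<open>w j\<close> of the tangency points of \<open>Dom K\<close> maximize
  the sum of the \<open>f j = (r j * r (j + 1) * sin (\<theta> j) * w j * (1 - w (j + 1)))\<^sup>1\<^sup>/\<^sup>3\<close>.
  The maximum is attained in the interior of the cube, where vanishing of the partial derivatives
  means \<open>w j = f j / (f j + f (j - 1))\<close>; inserting this into the definition of \<open>f j\<close> gives the
  system. Two positive solutions dominate each other by the inequality of means, and the equality
  case shows that they coincide.\<close>

subsection \<open>Supporting lines in the plane\<close>

text \<open>Two asymmetries shape the proof. The upper bound concerns an arbitrary body with given
  tangency points, but it may be tested along one convenient sequence of subdivisions, namely equal
  angles seen from an inner point. The value for the parabola body has to be obtained for every
  admissible sequence; its points need not match the tangency points, and it may run around the
  boundary in either sense. In both cases at most \<open>2 * \<kappa>\<close> arcs contain a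
  tangency point, and their triangles have area of order \<open>\<delta>\<^sup>2\<close>, so they
  disappear in the limit. The upper bound does not compare an arc with a parabola geometrically:
  position and slope increase along the arc, and the increments telescope. The tangency points of
  the limit shape may a priori be vertices of the polygon, whereas parabola bodies are compared only
  for positions strictly inside the sides. The infinite slope of the cube root at 0 excludes the
  degenerate positions.\<close>

lemma cross2_add_left: "cross2 (a + b) c = cross2 a c + cross2 b c"
  and cross2_add_right: "cross2 c (a + b) = cross2 c a + cross2 c b"
  and cross2_diff_left: "cross2 (a - b) c = cross2 a c - cross2 b c"
  and cross2_diff_right: "cross2 c (a - b) = cross2 c a - cross2 c b"
  and cross2_minus_left: "cross2 (- a) c = - cross2 a c"
  and cross2_minus_right: "cross2 c (- a) = - cross2 c a"
  and cross2_scaleR_left: "cross2 (r *\<^sub>R a) c = r * cross2 a c"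
  and cross2_scaleR_right: "cross2 c (r *\<^sub>R a) = r * cross2 c a"
  and cross2_self: "cross2 a a = 0"
  and cross2_zero_left: "cross2 0 a = 0"
  and cross2_zero_right: "cross2 a 0 = 0"
  by (simp_all add: cross2_def algebra_simps)

lemmas cross2_simps = cross2_add_left cross2_add_right cross2_diff_left cross2_diff_right
  cross2_minus_left cross2_minus_right cross2_scaleR_left cross2_scaleR_right cross2_self
  cross2_zero_left cross2_zero_right

lemma cross2_commute: "cross2 a b = - cross2 b a"
  by (simp add: cross2_def)

lemma vec2_eq_iff: "(x :: real^2) = y \<longleftrightarrow> x $ 1 = y $ 1 \<and> x $ 2 = y $ 2"
  by (simp add: vec_eq_iff forall_2)

lemma inner_vec2: "(x :: real^2) \<bullet> y = x $ 1 * y $ 1 + x $ 2 * y $ 2"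
  by (simp add: inner_vec_def sum_2)

text \<open>Lagrange's identity in the plane. It yields both the bound on \<open>cross2\<close> and
  the sine of \<open>vec_angle\<close>.\<close>

lemma cross2_square_add_inner_square:
  "(cross2 a b)\<^sup>2 + (a \<bullet> b)\<^sup>2 = (norm a)\<^sup>2 * (norm b)\<^sup>2"
  unfolding power2_norm_eq_inner inner_vec2 cross2_def
  by (simp add: power2_eq_square algebra_simps)

lemma abs_cross2_le: "\<bar>cross2 a b\<bar> \<le> norm a * norm b"
proof -
  have "(cross2 a b)\<^sup>2 \<le> (norm a * norm b)\<^sup>2"
    using cross2_square_add_inner_square[of a b]
        by (simp add: power_mult_distrib) (smt (verit) zero_le_power2)
  then show ?thesis by (simp add: abs_le_square_iff [symmetric])
qed

lemma continuous_on_cross2 [continuous_intros]: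
  assumes "continuous_on S f" "continuous_on S g"
  shows "continuous_on S (\<lambda>x. cross2 (f x) (g x))"
  unfolding cross2_def using assms by (intro continuous_intros)

text \<open>Cramer's rule for the basis \<open>a\<close>, \<open>b\<close>.\<close>

lemma cross2_decompose:
  assumes "cross2 a b \<noteq> 0"
  shows "z = (cross2 z b / cross2 a b) *\<^sub>R a + (cross2 a z / cross2 a b) *\<^sub>R b"
proof -
  have "cross2 a b *\<^sub>R z = cross2 z b *\<^sub>R a + cross2 a z *\<^sub>R b"
    by (simp add: vec2_eq_iff cross2_def algebra_simps)
  then have "(1 / cross2 a b) *\<^sub>R (cross2 a b *\<^sub>R z) =
      (1 / cross2 a b) *\<^sub>R (cross2 z b *\<^sub>R a + cross2 a z *\<^sub>R b)" by simp
  then show ?thesis using assms by (simp add: scaleR_add_right)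
qed

lemma cross2_eq_0_imp_scaleR:
  assumes "cross2 a z = 0" "a \<noteq> 0"
  shows "\<exists>r. z = r *\<^sub>R a"
proof (cases "a $ 1 = 0")
  case True
  then have "a $ 2 \<noteq> 0" using assms(2) by (auto simp: vec2_eq_iff)
  then show ?thesis using assms True
    by (intro exI[of _ "z $ 2 / a $ 2"]) (simp add: vec2_eq_iff cross2_def field_simps)
next
  case False
  then show ?thesis using assms
    by (intro exI[of _ "z $ 1 / a $ 1"]) (simp add: vec2_eq_iff cross2_def field_simps)
qed

lemma triangle_area_eq: "triangle_area a b c = \<bar>cross2 (b - a) (c - a)\<bar> / 2"
proof -
  have "triangle_area a b c = measure lborel (convex hull {a, b, c})"
    unfolding triangle_area_def
    by (simp add: measure_completion compact_imp_closed compact_convex_hull finite_imp_compact)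
  then show ?thesis
    unfolding content_triangle by (simp add: cross2_def algebra_simps abs_minus_commute)
qed

text \<open>\<open>arccos\<close> takes values in \<open>[0, pi]\<close>, so the sine is the
  nonnegative root given by Lagrange's identity. This turns the right-hand side of the system into a
  cross product.\<close>

lemma sin_vec_angle:
  assumes "u \<noteq> 0" "w \<noteq> 0"
  shows "norm u * norm w * sin (vec_angle u w) = \<bar>cross2 u w\<bar>"
proof -
  let ?c = "u \<bullet> w / (norm u * norm w)"
  have pos: "norm u * norm w > 0" using assms by simp
  have "\<bar>?c\<bar> \<le> 1"
    using Cauchy_Schwarz_ineq2[of u w] pos by (simp add: field_simps)
  then have "sin (vec_angle u w) = sqrt (1 - ?c\<^sup>2)"
    unfolding vec_angle_def by (intro sin_arccos_abs) auto
  then have "norm u * norm w * sin (vec_angle u w) = sqrt ((norm u * norm w)\<^sup>2 * (1 - ?c\<^sup>2))"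
    using pos assms by (simp add: real_sqrt_mult)
  also have "(norm u * norm w)\<^sup>2 * (1 - ?c\<^sup>2) = (cross2 u w)\<^sup>2"
  proof -
    have "norm u * norm w * ?c = u \<bullet> w" using assms by simp
    then have "(norm u * norm w)\<^sup>2 * ?c\<^sup>2 = (u \<bullet> w)\<^sup>2" by (metis power_mult_distrib)
    then show ?thesis
      using cross2_square_add_inner_square[of u w]
      by (simp add: right_diff_distrib power_mult_distrib)
  qed
  finally show ?thesis by simp
qed

text \<open>A supporting line is described by its direction, oriented with the set on the left.
  Unlike a normal vector, such directions can be compared by \<open>cross2\<close> with the sides of
  the polygon and with each other.\<close>

definition left_support :: "(real^2) set \<Rightarrow> real^2 \<Rightarrow> real^2 \<Rightarrow> bool" where
  "left_support S x t \<longleftrightarrow> x \<in> S \<and> t \<noteq> 0 \<and> (\<forall>z\<in>S. 0 \<le> cross2 t (z - x))"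

text \<open>Turning the outward normal counterclockwise by a right angle gives the oriented
  direction. It is normalized because later estimates depend on the length of a sum of two
  directions.\<close>

lemma supporting_line_iff:
  "supporting_line S x d \<longleftrightarrow> (\<exists>t. norm t = 1 \<and> left_support S x t \<and> d = {z. cross2 t (z - x) = 0})"
proof
  assume "supporting_line S x d"
  then obtain n where n: "x \<in> S" "n \<noteq> 0" "d = {z. n \<bullet> z = n \<bullet> x}" "\<forall>z\<in>S. n \<bullet> z \<le> n \<bullet> x"
    unfolding supporting_line_def by blast
  define t0 :: "real^2" where "t0 = (\<chi> i. if i = 1 then - n $ 2 else n $ 1)"
  have t0: "t0 $ 1 = - n $ 2" "t0 $ 2 = n $ 1" by (simp_all add: t0_def)
  have t0nz: "t0 \<noteq> 0" using n(2) t0 by (auto simp: vec2_eq_iff)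
  define t where "t = (1 / norm t0) *\<^sub>R t0"
  have c: "cross2 t0 (z - x) = n \<bullet> x - n \<bullet> z" for z
    by (simp add: cross2_def t0 inner_vec2 algebra_simps)
  have ct: "cross2 t (z - x) = (n \<bullet> x - n \<bullet> z) / norm t0" for z
    by (simp add: t_def cross2_scaleR_left c)
  have "norm t = 1" "t \<noteq> 0" using t0nz by (simp_all add: t_def)
  moreover have "left_support S x t"
    unfolding left_support_def using n \<open>t \<noteq> 0\<close> by (simp add: ct)
  moreover have "d = {z. cross2 t (z - x) = 0}"
    using n(3) t0nz by (auto simp: ct)
  ultimately show "\<exists>t. norm t = 1 \<and> left_support S x t \<and> d = {z. cross2 t (z - x) = 0}" by blast
next
  assume "\<exists>t. norm t = 1 \<and> left_support S x t \<and> d = {z. cross2 t (z - x) = 0}"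
  then obtain t where t: "left_support S x t" "d = {z. cross2 t (z - x) = 0}" by blast
  define n :: "real^2" where "n = (\<chi> i. if i = 1 then t $ 2 else - t $ 1)"
  have n: "n $ 1 = t $ 2" "n $ 2 = - t $ 1" by (simp_all add: n_def)
  have c: "cross2 t (z - x) = n \<bullet> x - n \<bullet> z" for z
    by (simp add: cross2_def n inner_vec2 algebra_simps)
  have "n \<noteq> 0" using t(1) n by (auto simp: left_support_def vec2_eq_iff)
  then show "supporting_line S x d"
    unfolding supporting_line_def using t
    by (intro conjI exI[of _ n]) (auto simp: left_support_def c)
qed

lemma frontier_left_support:
  assumes "convex_body S" "x \<in> frontier S"
  shows "\<exists>t. norm t = 1 \<and> left_support S x t"
proof -
  have x: "x \<in> closure S" "x \<notin> interior S" "x \<in> S"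
    using assms compact_imp_closed[of S] by (auto simp: frontier_def convex_body_def)
  have "x \<notin> rel_interior S"
    using x(2) assms(1) rel_interior_nonempty_interior[of S] by (auto simp: convex_body_def)
  then obtain a where a: "a \<noteq> 0" "\<And>y. y \<in> closure S \<Longrightarrow> a \<bullet> x \<le> a \<bullet> y"
    using supporting_hyperplane_relative_frontier[of S x] x(1) assms(1)
    unfolding convex_body_def by metis
  have "supporting_line S x {z. (- a) \<bullet> z = (- a) \<bullet> x}"
    unfolding supporting_line_def using a x closure_subset[of S]
    by (intro conjI exI[of _ "- a"]) auto
  then show ?thesis unfolding supporting_line_iff by blast
qed

text \<open>The support inequality at the point of the ball nearest to the line shows that the line
  keeps distance at least \<rho> from the center.\<close>

lemma left_support_cball:
  assumes "left_support S x t" "cball c \<rho> \<subseteq> S" "0 \<le> \<rho>"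
  shows "\<rho> * norm t \<le> cross2 t (c - x)"
proof -
  have t: "t \<noteq> 0" "\<And>z. z \<in> S \<Longrightarrow> 0 \<le> cross2 t (z - x)" using assms(1) by (auto simp: left_support_def)
  define n :: "real^2" where "n = (\<chi> i. if i = 1 then - t $ 2 else t $ 1)"
  have n: "n $ 1 = - t $ 2" "n $ 2 = t $ 1" by (simp_all add: n_def)
  have nn: "norm n = norm t" by (simp add: norm_eq_sqrt_inner inner_vec2 n)
  have cn: "cross2 t n = (norm t)\<^sup>2" by (simp add: power2_norm_eq_inner inner_vec2 n cross2_def)
  define z where "z = c - (\<rho> / norm t) *\<^sub>R n"
  have "z \<in> cball c \<rho>" using t assms(3) nn by (simp add: z_def dist_norm)
  then have "0 \<le> cross2 t (z - x)" using assms(2) t by blast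
  also have "cross2 t (z - x) = cross2 t (c - x) - \<rho> * norm t"
    using t(1) by (simp add: z_def cross2_simps cn power2_eq_square)
  finally show ?thesis by simp
qed

lemma left_support_frontier:
  assumes "left_support S x t"
  shows "x \<in> frontier S"
proof -
  have "x \<notin> interior S"
  proof
    assume "x \<in> interior S"
    then obtain e where e: "e > 0" "cball x e \<subseteq> S" using mem_interior_cball by blast
    have "e * norm t \<le> 0" using left_support_cball[OF assms e(2)] e by (simp add: cross2_simps)
    then show False using e assms by (simp add: left_support_def mult_le_0_iff)
  qed
  then show ?thesis using assms closure_subset[of S] by (auto simp: frontier_def left_support_def)
qed

section \<open>Two neighbouring supporting lines and their triangle\<close>

definition support_line :: "real^2 \<Rightarrow> real^2 \<Rightarrow> (real^2) set" where
  "support_line x t = {z. cross2 t (z - x) = 0}"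

text \<open>This is the condition that \<open>supporting_data\<close> puts on \<open>y\<close>,
  written with points and directions instead of lines.\<close>

definition lines_meet :: "real^2 \<Rightarrow> real^2 \<Rightarrow> real^2 \<Rightarrow> real^2 \<Rightarrow> real^2 \<Rightarrow> bool" where
  "lines_meet x t x' t' y \<longleftrightarrow> (if support_line x t = support_line x' t' then y \<in> closed_segment x x'
     else support_line x t \<inter> support_line x' t' = {y})"

text \<open>The set is squeezed between balls with radii \<rho> and \<open>M\<close>. The assumption
  \<open>\<delta> \<le> \<rho>\<close> on two contact points at distance at most \<delta> keeps
  their directions from being opposite.\<close>

locale support_pair =
  fixes S :: "(real^2) set" and c :: "real^2" and \<rho> M \<delta> :: real and x1 t1 x2 t2 :: "real^2"
  assumes sup1: "left_support S x1 t1" and n1: "norm t1 = 1"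
    and sup2: "left_support S x2 t2" and n2: "norm t2 = 1"
    and inner: "cball c \<rho> \<subseteq> S" and outer: "S \<subseteq> cball c M"
    and rho: "0 < \<rho>" and close: "norm (x2 - x1) \<le> \<delta>" and small: "\<delta> \<le> \<rho>"
begin

lemma M_pos: "0 < M"
proof -
  have "c \<in> S" using inner rho by auto
  have "\<rho> \<le> cross2 t1 (c - x1)"
    using left_support_cball[OF sup1 inner] rho n1 by simp
  also have "\<dots> \<le> norm t1 * norm (c - x1)" using abs_cross2_le[of t1 "c - x1"] by linarith
  also have "\<dots> \<le> M" using outer sup1 n1 by (auto simp: left_support_def dist_norm)
  finally show ?thesis using rho by linarith
qed

text \<open>Opposite directions would enclose the set in a strip of width at most \<delta>, which
  has no room for the inner ball. Adding the two distance inequalities makes this quantitative: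
  \<open>2 * \<rho> \<le> norm (t1 + t2) * M + \<delta>\<close>.\<close>

lemma norm_add_ge: "\<rho> / M \<le> norm (t1 + t2)"
proof -
  have a: "\<rho> \<le> cross2 t1 (c - x1)" "\<rho> \<le> cross2 t2 (c - x2)"
    using left_support_cball[OF sup1 inner] left_support_cball[OF sup2 inner] rho n1 n2 by auto
  have "norm (c - x1) \<le> M" using outer sup1 by (auto simp: left_support_def dist_norm)
  then have "cross2 (t1 + t2) (c - x1) \<le> norm (t1 + t2) * M"
    using abs_cross2_le[of "t1 + t2" "c - x1"] mult_left_mono[of "norm (c - x1)" M "norm (t1 + t2)"]
    by (smt (verit) norm_ge_zero)
  moreover have "cross2 t2 (x1 - x2) \<le> \<delta>"
    using abs_cross2_le[of t2 "x1 - x2"] n2 close by (simp add: norm_minus_commute)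
  moreover have "cross2 t1 (c - x1) + cross2 t2 (c - x2)
      = cross2 (t1 + t2) (c - x1) + cross2 t2 (x1 - x2)"
    by (simp add: cross2_simps)
  ultimately have "\<rho> \<le> norm (t1 + t2) * M" using a small by linarith
  then show ?thesis using M_pos by (simp add: field_simps)
qed

lemma cross_zero:
  assumes "cross2 t1 t2 = 0"
  shows "t1 = t2" "cross2 t1 (x2 - x1) = 0"
proof -
  obtain r where r: "t2 = r *\<^sub>R t1"
    using cross2_eq_0_imp_scaleR[OF assms] sup1 by (auto simp: left_support_def)
  then have "\<bar>r\<bar> = 1" using n1 n2 by simp
  moreover have "r \<noteq> -1"
  proof
    assume "r = -1"
    then have "norm (t1 + t2) = 0" using r by simp
    moreover have "\<rho> / M > 0" using rho M_pos by simp
    ultimately show False using norm_add_ge by linarith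
  qed
  ultimately have "r = 1" by linarith
  then show eq: "t1 = t2" using r by simp
  have "0 \<le> cross2 t1 (x2 - x1)" "0 \<le> cross2 t2 (x1 - x2)"
    using sup1 sup2 by (auto simp: left_support_def)
  then show "cross2 t1 (x2 - x1) = 0" using eq by (simp add: cross2_simps)
qed

lemma lines_eq:
  assumes "cross2 t1 t2 = 0"
  shows "support_line x1 t1 = support_line x2 t2"
proof -
  have "cross2 t2 (z - x2) = cross2 t1 (z - x1) - cross2 t1 (x2 - x1)" for z
    using cross_zero(1)[OF assms] by (simp add: cross2_simps)
  then show ?thesis using cross_zero(2)[OF assms] by (simp add: support_line_def)
qed

lemma meet_exists: "\<exists>y. lines_meet x1 t1 x2 t2 y"
proof (cases "cross2 t1 t2 = 0")
  case True
  then show ?thesis using lines_eq by (auto simp: lines_meet_def)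
next
  case False
  define \<alpha> where "\<alpha> = cross2 (x2 - x1) t2 / cross2 t1 t2"
  define y where "y = x1 + \<alpha> *\<^sub>R t1"
  have 1: "y \<in> support_line x1 t1" by (simp add: y_def support_line_def cross2_simps)
  have "cross2 t2 (y - x2) = \<alpha> * cross2 t2 t1 - cross2 t2 (x2 - x1)"
    by (simp add: y_def cross2_simps)
  also have "\<dots> = 0" using False cross2_commute[of t2] by (simp add: \<alpha>_def)
  finally have 2: "y \<in> support_line x2 t2" by (simp add: support_line_def)
  have "z = y" if "z \<in> support_line x1 t1" "z \<in> support_line x2 t2" for z
  proof -
    have "cross2 t1 (z - y) = 0" "cross2 t2 (z - y) = 0"
      using that 1 2 by (auto simp: support_line_def cross2_simps)
    then have "z - y = 0"
      using cross2_decompose[OF False, of "z - y"] cross2_commute[of "z - y" t2] by simp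
    then show ?thesis by simp
  qed
  then have "support_line x1 t1 \<inter> support_line x2 t2 = {y}" using 1 2 by blast
  moreover have "support_line x1 t1 \<noteq> support_line x2 t2"
  proof
    assume "support_line x1 t1 = support_line x2 t2"
    moreover have "y + t1 \<in> support_line x1 t1" by (simp add: y_def support_line_def cross2_simps)
    ultimately have "y + t1 \<in> support_line x2 t2" "y \<in> support_line x2 t2" using 2 by auto
    then have "cross2 t2 t1 = 0" by (simp add: support_line_def cross2_simps)
    then show False using False cross2_commute[of t2] by simp
  qed
  ultimately show ?thesis by (auto simp: lines_meet_def)
qed

text \<open>Each contact point lies on the left of the other line, so \<alpha> and \<beta> both have
  the sign of \<open>cross2 t1 t2\<close> and \<open>\<bar>\<alpha>\<bar> + \<bar>\<beta>\<bar> =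
  \<bar>\<alpha> + \<beta>\<bar>\<close>. The two unit directions have the same inner product with
  \<open>e = t1 + t2\<close>; hence projecting \<open>x2 - x1\<close> onto \<open>e\<close> sees
  only \<open>\<alpha> + \<beta>\<close>, and \<open>norm_add_ge\<close> bounds it.\<close>

lemma meet_triangle:
  assumes y: "lines_meet x1 t1 x2 t2 y"
    and nz: "triangle_area x1 y x2 \<noteq> 0"
  shows "\<exists>\<alpha> \<beta>. y = x1 + \<alpha> *\<^sub>R t1 \<and> x2 = y + \<beta> *\<^sub>R t2 \<and> 0 < \<alpha> * cross2 t1 t2 \<and> 0 < \<beta> * cross2 t1 t2 \<and>
    triangle_area x1 y x2 = \<bar>\<alpha> * \<beta> * cross2 t1 t2\<bar> / 2 \<and> \<bar>\<alpha>\<bar> + \<bar>\<beta>\<bar> \<le> 2 * \<delta> * M / \<rho>"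
proof -
  have ne: "support_line x1 t1 \<noteq> support_line x2 t2"
  proof
    assume "support_line x1 t1 = support_line x2 t2"
    then have "y \<in> closed_segment x1 x2" using y by (simp add: lines_meet_def)
    then obtain u where "y = (1 - u) *\<^sub>R x1 + u *\<^sub>R x2" by (auto simp: closed_segment_def)
    then have "y - x1 = u *\<^sub>R (x2 - x1)" by (simp add: algebra_simps)
    then show False using nz by (simp add: triangle_area_eq cross2_scaleR_left cross2_self)
  qed
  then have w: "cross2 t1 t2 \<noteq> 0" using lines_eq by blast
  have "support_line x1 t1 \<inter> support_line x2 t2 = {y}" using ne y by (simp add: lines_meet_def)
  then have "y \<in> support_line x1 t1" "y \<in> support_line x2 t2" by blast+
  then have yy: "cross2 t1 (y - x1) = 0" "cross2 t2 (y - x2) = 0" by (auto simp: support_line_def)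
  obtain \<alpha> where a: "y - x1 = \<alpha> *\<^sub>R t1"
    using cross2_eq_0_imp_scaleR[OF yy(1)] sup1 by (auto simp: left_support_def)
  obtain b' where b': "y - x2 = b' *\<^sub>R t2"
    using cross2_eq_0_imp_scaleR[OF yy(2)] sup2 by (auto simp: left_support_def)
  define \<beta> where "\<beta> = - b'"
  have b: "x2 - y = \<beta> *\<^sub>R t2" using b' by (simp add: \<beta>_def algebra_simps)
  have d: "x2 - x1 = \<alpha> *\<^sub>R t1 + \<beta> *\<^sub>R t2" using a b by (simp add: algebra_simps)
  have area: "triangle_area x1 y x2 = \<bar>\<alpha> * \<beta> * cross2 t1 t2\<bar> / 2"
    by (simp add: triangle_area_eq a d cross2_simps mult_ac)
  have "0 \<le> cross2 t1 (x2 - x1)" "0 \<le> cross2 t2 (x1 - x2)"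
    using sup1 sup2 by (auto simp: left_support_def)
  moreover have "cross2 t1 (x2 - x1) = \<beta> * cross2 t1 t2" by (simp add: d cross2_simps)
  moreover have "cross2 t2 (x1 - x2) = \<alpha> * cross2 t1 t2"
  proof -
    have e: "x1 - x2 = - (\<alpha> *\<^sub>R t1 + \<beta> *\<^sub>R t2)" unfolding d [symmetric] by simp
    show ?thesis unfolding e using cross2_commute[of t2 t1] by (simp add: cross2_simps)
  qed
  ultimately have "0 \<le> \<alpha> * cross2 t1 t2" "0 \<le> \<beta> * cross2 t1 t2" by simp_all
  moreover have "\<alpha> \<noteq> 0" "\<beta> \<noteq> 0" using nz area by auto
  ultimately have pos: "0 < \<alpha> * cross2 t1 t2" "0 < \<beta> * cross2 t1 t2" using w
      by (simp_all add: less_le)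
  then have sgn: "\<bar>\<alpha>\<bar> + \<bar>\<beta>\<bar> = \<bar>\<alpha> + \<beta>\<bar>" by (auto simp: zero_less_mult_iff)
  define e where "e = t1 + t2"
  have "t1 \<bullet> t1 = 1" "t2 \<bullet> t2 = 1" using n1 n2 by (simp_all add: dot_square_norm)
  then have e: "t1 \<bullet> e = (norm e)\<^sup>2 / 2" "t2 \<bullet> e = (norm e)\<^sup>2 / 2"
    unfolding e_def power2_norm_eq_inner by (simp_all add: inner_simps inner_commute)
  have ne: "\<rho> / M \<le> norm e" using norm_add_ge by (simp add: e_def)
  then have epos: "0 < norm e" using rho M_pos by (smt (verit) divide_pos_pos)
  have "(x2 - x1) \<bullet> e = (\<alpha> + \<beta>) * ((norm e)\<^sup>2 / 2)"
    unfolding d by (simp add: inner_simps e algebra_simps)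
  then have "\<bar>\<alpha> + \<beta>\<bar> * ((norm e)\<^sup>2 / 2) \<le> norm (x2 - x1) * norm e"
    using Cauchy_Schwarz_ineq2[of "x2 - x1" e] by (simp add: abs_mult)
  also have "\<dots> \<le> \<delta> * norm e" using close by (simp add: mult_right_mono)
  finally have "\<bar>\<alpha> + \<beta>\<bar> * norm e \<le> 2 * \<delta>" using epos by (simp add: power2_eq_square)
  moreover have "\<bar>\<alpha> + \<beta>\<bar> * (\<rho> / M) \<le> \<bar>\<alpha> + \<beta>\<bar> * norm e" by (rule mult_left_mono[OF ne]) simp
  ultimately have "\<bar>\<alpha> + \<beta>\<bar> * (\<rho> / M) \<le> 2 * \<delta>" by linarith
  then have "\<bar>\<alpha> + \<beta>\<bar> \<le> 2 * \<delta> * M / \<rho>" using rho M_pos by (simp add: field_simps)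
  then show ?thesis using a b pos area sgn
    by (intro exI[of _ \<alpha>] exI[of _ \<beta>]) (auto simp: algebra_simps)
qed

text \<open>The bound is quadratic in \<delta> and its cube root tends to 0 with \<delta>. A bounded
  number of triangles therefore does not influence the limit of the sums.\<close>

lemma triangle_area_le:
  assumes y: "lines_meet x1 t1 x2 t2 y"
  shows "triangle_area x1 y x2 \<le> (\<delta> * M / \<rho>)\<^sup>2"
proof (cases "triangle_area x1 y x2 = 0")
  case True then show ?thesis by simp
next
  case False
  then obtain \<alpha> \<beta> where ab: "triangle_area x1 y x2 = \<bar>\<alpha> * \<beta> * cross2 t1 t2\<bar> / 2"
      "\<bar>\<alpha>\<bar> + \<bar>\<beta>\<bar> \<le> 2 * \<delta> * M / \<rho>"
    using meet_triangle[OF y] by metis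
  have "\<bar>cross2 t1 t2\<bar> \<le> 1" using abs_cross2_le[of t1 t2] n1 n2 by simp
  then have "\<bar>\<alpha> * \<beta> * cross2 t1 t2\<bar> \<le> \<bar>\<alpha>\<bar> * \<bar>\<beta>\<bar>"
    by (simp add: abs_mult mult_left_le)
  also have "\<dots> \<le> ((\<bar>\<alpha>\<bar> + \<bar>\<beta>\<bar>) / 2)\<^sup>2"
    using zero_le_power2[of "\<bar>\<alpha>\<bar> - \<bar>\<beta>\<bar>"] by (simp add: power2_eq_square algebra_simps)
  also have "\<dots> \<le> (\<delta> * M / \<rho>)\<^sup>2" using ab(2) by (intro power_mono) (auto simp: mult_ac)
  finally show ?thesis using ab(1) by simp
qed

text \<open>Expanding \<open>x2 - c\<close> along \<open>t1\<close> and \<open>t2\<close> shows that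
  two negative coefficients would make \<open>cross2 (x1 - c) (x2 - c)\<close> negative. The strict
  inequality \<open>\<delta> < \<rho>\<close> makes \<open>cross2 (x1 - c) t2\<close>
  positive.\<close>

lemma meet_triangle_ccw:
  assumes y: "lines_meet x1 t1 x2 t2 y"
    and nz: "triangle_area x1 y x2 \<noteq> 0"
    and ccw: "0 < cross2 (x1 - c) (x2 - c)" and small': "\<delta> < \<rho>"
  shows "\<exists>\<alpha> \<beta>. y = x1 + \<alpha> *\<^sub>R t1 \<and> x2 = y + \<beta> *\<^sub>R t2 \<and> 0 < \<alpha> \<and> 0 < \<beta> \<and> 0 < cross2 t1 t2 \<and>
    triangle_area x1 y x2 = \<alpha> * \<beta> * cross2 t1 t2 / 2"
proof -
  obtain \<alpha> \<beta> where ab: "y = x1 + \<alpha> *\<^sub>R t1" "x2 = y + \<beta> *\<^sub>R t2" "0 < \<alpha> * cross2 t1 t2"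
      "0 < \<beta> * cross2 t1 t2"
    "triangle_area x1 y x2 = \<bar>\<alpha> * \<beta> * cross2 t1 t2\<bar> / 2" using meet_triangle[OF y nz] by blast
  have c1: "0 < cross2 (x1 - c) t1"
    using left_support_cball[OF sup1 inner] rho n1 by (simp add: cross2_def algebra_simps)
  have "\<rho> \<le> cross2 (x2 - c) t2"
    using left_support_cball[OF sup2 inner] rho n2 by (simp add: cross2_def algebra_simps)
  moreover have "cross2 (x2 - x1) t2 \<le> \<delta>"
    using abs_cross2_le[of "x2 - x1" t2] n2 close by simp
  ultimately have c2: "0 < cross2 (x1 - c) t2" using small' by (simp add: cross2_simps)
  have "cross2 (x1 - c) (x2 - c) = \<alpha> * cross2 (x1 - c) t1 + \<beta> * cross2 (x1 - c) t2"
  proof -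
    have "x2 - c = (x1 - c) + \<alpha> *\<^sub>R t1 + \<beta> *\<^sub>R t2" using ab by simp
    then show ?thesis by (simp only: cross2_add_right cross2_scaleR_right cross2_self add_0_left)
  qed
  then have "\<not> (\<alpha> < 0 \<and> \<beta> < 0)" using ccw c1 c2
    by (smt (verit) mult_less_0_iff)
  then have "0 < cross2 t1 t2" using ab(3,4) by (auto simp: zero_less_mult_iff)
  then show ?thesis using ab by (intro exI[of _ \<alpha>] exI[of _ \<beta>]) (auto simp: zero_less_mult_iff)
qed

end

text \<open>The assumptions on \<open>z\<close> place it in the triangle \<open>x1\<close>, \<open>y\<close>, \<open>x2\<close>.\<close>

lemma triangle_between_rays:
  assumes 1: "left_support S x1 t1" and 2: "left_support S x2 t2" and c: "c \<in> interior S"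
    and y: "y = x1 + \<alpha> *\<^sub>R t1" "x2 = y + \<beta> *\<^sub>R t2" and pos: "0 < \<alpha>" "0 < \<beta>" "0 < cross2 t1 t2"
    and ccw: "0 < cross2 (x1 - c) (x2 - c)"
    and z: "0 \<le> cross2 t1 (z - x1)" "0 \<le> cross2 t2 (z - x2)" "cross2 (x2 - x1) (z - x1) \<le> 0"
  shows "0 \<le> cross2 (x1 - c) (z - c)" "0 \<le> cross2 (z - c) (x2 - c)"
proof -
  obtain e where e: "e > 0" "cball c e \<subseteq> S" using c mem_interior_cball by blast
  have "e * norm t1 > 0" "e * norm t2 > 0" using e 1 2 by (auto simp: left_support_def)
  then have c1: "0 < cross2 t1 (c - x1)" and c2: "0 < cross2 t2 (c - x2)"
    using left_support_cball[OF 1 e(2)] left_support_cball[OF 2 e(2)] e by linarith+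
  define \<omega> where "\<omega> = cross2 t1 t2"
  have w: "0 < \<omega>" using pos by (simp add: \<omega>_def)
  define a where "a = - cross2 (z - y) t2 / \<omega>"
  define b where "b = cross2 t1 (z - y) / \<omega>"
  have zy: "z - y = b *\<^sub>R t2 - a *\<^sub>R t1"
    using cross2_decompose[of t1 t2 "z - y"] w by (simp add: a_def b_def \<omega>_def add.commute)
  have "cross2 t1 (z - x1) = cross2 t1 (z - y)" by (simp add: y cross2_simps)
  then have b0: "0 \<le> b" using z(1) w by (simp add: b_def)
  have "cross2 t2 (z - x2) = - cross2 (z - y) t2"
      by (simp add: y cross2_simps cross2_def algebra_simps)
  then have a0: "0 \<le> a" using z(2) w by (simp add: a_def divide_nonpos_pos)
  have zx: "z - x1 = (\<alpha> - a) *\<^sub>R t1 + b *\<^sub>R t2" "x2 - x1 = \<alpha> *\<^sub>R t1 + \<beta> *\<^sub>R t2"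
    using zy y by (simp_all add: algebra_simps)
  have "cross2 (x2 - x1) (z - x1) = (\<alpha> * b - \<beta> * (\<alpha> - a)) * \<omega>"
    unfolding zx using cross2_commute[of t2 t1] by (simp add: cross2_simps \<omega>_def algebra_simps)
  then have "\<alpha> * b - \<beta> * (\<alpha> - a) \<le> 0" using z(3) w by (simp add: mult_le_0_iff)
  then have k: "a / \<alpha> + b / \<beta> \<le> 1" using pos by (simp add: field_simps)
  have y1: "cross2 (x1 - c) (y - c) = \<alpha> * cross2 t1 (c - x1)"
    by (simp add: y cross2_def algebra_simps)
  have y2: "cross2 (y - c) (x2 - c) = \<beta> * cross2 t2 (c - x2)"
    by (simp add: y cross2_def algebra_simps)
  have "a *\<^sub>R t1 = (a / \<alpha>) *\<^sub>R (y - x1)" "b *\<^sub>R t2 = (b / \<beta>) *\<^sub>R (x2 - y)"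
    using pos y by simp_all
  \<comment> \<open>The coefficients are the barycentric coordinates of \<open>z\<close> in the
    triangle \<open>y\<close>, \<open>x1\<close>, \<open>x2\<close>; \<open>k\<close> is the
    nonnegativity of the first one.\<close>
  then have zc: "z - c = (1 - a / \<alpha> - b / \<beta>) *\<^sub>R (y - c) + (a / \<alpha>) *\<^sub>R (x1 - c) + (b / \<beta>) *\<^sub>R (x2
      - c)"
  proof -
    have "z - c = (y - c) + b *\<^sub>R t2 - a *\<^sub>R t1" using zy by (simp add: algebra_simps)
    also have "\<dots> = (y - c) + (b / \<beta>) *\<^sub>R (x2 - y) - (a / \<alpha>) *\<^sub>R (y - x1)"
      using \<open>a *\<^sub>R t1 = _\<close> \<open>b *\<^sub>R t2 = _\<close> by simp
    finally show ?thesis by (simp add: algebra_simps)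
  qed
  have "cross2 (x1 - c) (z - c) = (1 - a / \<alpha> - b / \<beta>) * cross2 (x1 - c) (y - c) + (b / \<beta>)
      * cross2 (x1 - c) (x2 - c)"
    unfolding zc by (simp only: cross2_add_right cross2_scaleR_right cross2_self mult_zero_right
        add_0_right add_0_left)
  then show "0 \<le> cross2 (x1 - c) (z - c)"
    unfolding y1 using k pos c1 b0 ccw by simp
  have "cross2 (z - c) (x2 - c) = (1 - a / \<alpha> - b / \<beta>) * cross2 (y - c) (x2 - c) + (a / \<alpha>)
      * cross2 (x1 - c) (x2 - c)"
    unfolding zc by (simp only: cross2_add_left cross2_scaleR_left cross2_self mult_zero_right
        add_0_right add_0_left)
  then show "0 \<le> cross2 (z - c) (x2 - c)"
    unfolding y2 using k pos c2 a0 ccw by simp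
qed

subsection \<open>Subdivisions of the boundary\<close>

text \<open>The nearer of two frontier points on the ray would lie strictly between the interior
  point \<open>c\<close> and a point of the closure, hence in the interior.\<close>

lemma ray_frontier_unique:
  fixes S :: "'a::euclidean_space set"
  assumes "convex S" "c \<in> interior S" "c + r *\<^sub>R u \<in> frontier S" "c + r' *\<^sub>R u \<in> frontier S"
    "0 < r" "0 < r'"
  shows "r = r'"
proof -
  have *: False if "c + r *\<^sub>R u \<in> frontier S" "c + r' *\<^sub>R u \<in> frontier S" "0 < r" "r < r'" for r r'
  proof -
    have cl: "c + r' *\<^sub>R u \<in> closure S" using that(2) by (simp add: frontier_def)
    have "(c + r' *\<^sub>R u) - (1 - r / r') *\<^sub>R ((c + r' *\<^sub>R u) - c) \<in> interior S"
      using that by (intro mem_interior_closure_convex_shrink[OF assms(1,2) cl]) (simp_all add: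
          field_simps)
    moreover have "(c + r' *\<^sub>R u) - (1 - r / r') *\<^sub>R ((c + r' *\<^sub>R u) - c) = c + r *\<^sub>R u"
    proof -
      have "(1 - r / r') * r' = r' - r" using that by (simp add: field_simps)
      then have "(1 - r / r') *\<^sub>R ((c + r' *\<^sub>R u) - c) = (r' - r) *\<^sub>R u"
        by (simp only: add_diff_cancel_left' scaleR_scaleR)
      then show ?thesis by (simp only:) (simp add: algebra_simps)
    qed
    ultimately have "c + r *\<^sub>R u \<in> interior S" by (simp only:)
    then show False using that(1) by (simp add: frontier_def)
  qed
  show ?thesis using *[of r r'] *[of r' r] assms(3-6) by (cases r r' rule: linorder_cases) auto
qed

section \<open>Parametrization of the boundary by the angle seen from an inner point\<close>

definition unit_dir :: "real \<Rightarrow> real^2" where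
  "unit_dir t = (\<chi> i. if i = 1 then cos (2 * pi * t) else sin (2 * pi * t))"

lemma unit_dir_nth [simp]: "unit_dir t $ 1 = cos (2 * pi * t)" "unit_dir t $ 2 = sin (2 * pi * t)"
  by (simp_all add: unit_dir_def)

lemma norm_unit_dir [simp]: "norm (unit_dir t) = 1"
  by (simp add: norm_eq_sqrt_inner inner_vec2 power2_eq_square [symmetric])

lemma continuous_on_unit_dir: "continuous_on A unit_dir"
proof -
  have "continuous_on A (\<lambda>t. \<chi> i :: 2. if i = 1 then cos (2 * pi * t) else sin (2 * pi * t))"
  proof (rule continuous_on_vec_lambda)
    fix i :: 2
    show "continuous_on A (\<lambda>t. if i = 1 then cos (2 * pi * t) else sin (2 * pi * t))"
      by (cases "i = 1") (auto intro!: continuous_intros)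
  qed
  moreover have "unit_dir = (\<lambda>t. \<chi> i. if i = 1 then cos (2 * pi * t) else sin (2 * pi * t))"
    by (simp add: fun_eq_iff unit_dir_def)
  ultimately show ?thesis by (simp only:)
qed

lemma cross2_unit_dir: "cross2 (unit_dir s) (unit_dir t) = sin (2 * pi * (t - s))"
  by (simp add: cross2_def sin_diff algebra_simps)

lemma inner_unit_dir: "unit_dir s \<bullet> unit_dir t = cos (2 * pi * (t - s))"
  by (simp add: inner_vec2 cos_diff algebra_simps)

lemma unit_dir_image: "unit_dir ` {0..1} = sphere 0 1"
proof
  show "unit_dir ` {0..1} \<subseteq> sphere 0 1" by auto
  show "sphere 0 1 \<subseteq> unit_dir ` {0..1}"
  proof
    fix u :: "real^2" assume "u \<in> sphere 0 1"
    then have "(u $ 1)\<^sup>2 + (u $ 2)\<^sup>2 = 1"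
      by (simp add: norm_eq_sqrt_inner inner_vec2 power2_eq_square)
    then obtain t where t: "0 \<le> t" "t < 2 * pi" "u $ 1 = cos t" "u $ 2 = sin t"
      using sincos_total_2pi by blast
    then have "u = unit_dir (t / (2 * pi))" by (simp add: vec2_eq_iff)
    moreover have "t / (2 * pi) \<in> {0..1}" using t by (simp add: field_simps)
    ultimately show "u \<in> unit_dir ` {0..1}" by blast
  qed
qed

lemma unit_dir_eq:
  assumes "unit_dir s = unit_dir t" "s \<in> {0..1}" "t \<in> {0..1}"
  shows "s = t \<or> s = 0 \<and> t = 1 \<or> s = 1 \<and> t = 0"
proof -
  have "sin (2 * pi * s) = sin (2 * pi * t)" "cos (2 * pi * s) = cos (2 * pi * t)"
    using arg_cong[OF assms(1), of "\<lambda>v. v $ 1"] arg_cong[OF assms(1), of "\<lambda>v. v $ 2"]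
    by (simp_all only: unit_dir_nth)
  then have "\<exists>n::int. 2 * pi * s = 2 * pi * t + 2 * pi * n"
    by (simp only: sin_cos_eq_iff [symmetric] conj_absorb simp_thms)
  then obtain n :: int where "2 * pi * s = 2 * pi * t + 2 * pi * n" by (elim exE)
  then have "(2 * pi) * s = (2 * pi) * (t + n)" by (simp only: distrib_left)
  then have n: "s = t + n" by (simp only: mult_cancel_left) simp
  then have "-1 \<le> n" "n \<le> 1" using assms(2,3) by auto
  then consider "n = -1" | "n = 0" | "n = 1" by linarith
  then show ?thesis
  proof cases
    case 1
    then have "s = t - 1" using n by simp
    then show ?thesis using assms(2,3) by auto
  next
    case 2
    then show ?thesis using n by simp
  next
    case 3
    then have "s = t + 1" using n by simp
    then show ?thesis using assms(2,3) by auto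
  qed
qed

definition radial_param :: "(real^2) set \<Rightarrow> real^2 \<Rightarrow> (real \<Rightarrow> real^2) \<Rightarrow> bool" where
  "radial_param S c g \<longleftrightarrow> simple_path g \<and> pathfinish g = pathstart g \<and> path_image g = frontier S \<and>
     (\<forall>t\<in>{0..1}. \<exists>r>0. g t = c + r *\<^sub>R unit_dir t)"

text \<open>Central projection from \<open>c\<close> maps the frontier continuously and bijectively
  onto the unit circle, and by compactness it is a homeomorphism. Its inverse, composed with
  \<open>unit_dir\<close>, is the parametrization.\<close>

lemma radial_param_exists:
  assumes S: "convex_body S" and c: "c \<in> interior S"
  shows "\<exists>g. radial_param S c g"
proof -
  define h where "h x = (1 / norm (x - c)) *\<^sub>R (x - c)" for x
  have conv: "convex S" and comp: "compact S" using S by (auto simp: convex_body_def)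
  have nc: "x \<noteq> c" if "x \<in> frontier S" for x using that c by (auto simp: frontier_def)
  have hx: "x = c + norm (x - c) *\<^sub>R h x" if "x \<in> frontier S" for x
    using nc[OF that] by (simp add: h_def)
  have cont: "continuous_on (frontier S) h" unfolding h_def
    using nc by (intro continuous_intros) auto
  have inj: "inj_on h (frontier S)"
  proof (rule inj_onI)
    fix x y assume xy: "x \<in> frontier S" "y \<in> frontier S" "h x = h y"
    have "norm (x - c) = norm (y - c)"
      using xy hx[OF xy(1)] hx[OF xy(2)] nc
      by (intro ray_frontier_unique[OF conv c, of _ "h x"]) auto
    then show "x = y" using hx[OF xy(1)] hx[OF xy(2)] xy(3) by simp
  qed
  have img: "h ` frontier S = sphere 0 1"
  proof
    show "h ` frontier S \<subseteq> sphere 0 1" using nc by (auto simp: h_def)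
    show "sphere 0 1 \<subseteq> h ` frontier S"
    proof
      fix u :: "real^2" assume u: "u \<in> sphere 0 1"
      then have "u \<noteq> 0" by auto
      then obtain d where "0 < d" "c + d *\<^sub>R u \<in> frontier S"
        using ray_to_frontier[OF compact_imp_bounded[OF comp] c] by metis
      moreover have "h (c + d *\<^sub>R u) = u" using u \<open>0 < d\<close> by (simp add: h_def)
      ultimately show "u \<in> h ` frontier S" by (metis imageI)
    qed
  qed
  have "compact (frontier S)" using comp by (simp add: compact_frontier)
  then obtain k where k: "homeomorphism (frontier S) (sphere 0 1) h k"
    using homeomorphism_compact[OF _ cont img inj] by blast
  define g where "g = k \<circ> unit_dir"
  have gin: "g t \<in> frontier S" "h (g t) = unit_dir t" if "t \<in> {0..1}" for t
  proof -
    have "unit_dir t \<in> sphere 0 1" by simp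
    then show "g t \<in> frontier S" "h (g t) = unit_dir t"
      using k unfolding g_def homeomorphism_def comp_def by blast+
  qed
  have "continuous_on {0..1} g" unfolding g_def
    using k unit_dir_image
    by (intro continuous_on_compose continuous_on_unit_dir) (auto simp: homeomorphism_def)
  then have "path g" by (simp add: path_def)
  moreover have "loop_free g" unfolding loop_free_def
    using gin(2) unit_dir_eq by metis
  moreover have "path_image g = frontier S"
    using k unit_dir_image unfolding path_image_def g_def image_comp [symmetric]
    by (simp add: homeomorphism_def)
  moreover have "unit_dir 0 = unit_dir 1" by (simp add: vec2_eq_iff)
  then have "pathfinish g = pathstart g" by (simp add: pathfinish_def pathstart_def g_def)
  moreover have "\<exists>r>0. g t = c + r *\<^sub>R unit_dir t" if "t \<in> {0..1}" for t
    using hx[OF gin(1)[OF that]] gin(2)[OF that] nc[OF gin(1)[OF that]]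
    by (intro exI[of _ "norm (g t - c)"]) auto
  ultimately show ?thesis unfolding radial_param_def simple_path_def by blast
qed

text \<open>The intermediate value theorem gives a parameter \<open>q\<close> between
  \<open>s\<close> and \<open>t\<close> whose direction is parallel to \<open>z - c\<close>. As the
  angle is below a quarter turn, the factor of proportionality is positive, and a ray meets the
  frontier only once, so \<open>z = g q\<close>.\<close>

lemma radial_param_between:
  assumes g: "radial_param S c g" and conv: "convex S" and c: "c \<in> interior S"
    and st: "0 \<le> s" "s < t" "t \<le> 1" "t - s < 1 / 4"
    and z: "z \<in> frontier S" "0 \<le> cross2 (g s - c) (z - c)" "0 \<le> cross2 (z - c) (g t - c)"
  shows "z \<in> g ` {s..t}"
proof -
  have rad: "\<exists>r>0. g q = c + r *\<^sub>R unit_dir q" if "0 \<le> q" "q \<le> 1" for q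
    using g that by (simp add: radial_param_def)
  obtain rs rt where r: "rs > 0" "g s = c + rs *\<^sub>R unit_dir s" "rt > 0"
      "g t = c + rt *\<^sub>R unit_dir t"
    using rad[of s] rad[of t] st by force
  let ?u = unit_dir
  have zs: "0 \<le> cross2 (?u s) (z - c)" and zt: "0 \<le> cross2 (z - c) (?u t)"
    using z(2,3) r by (simp_all add: cross2_scaleR_left cross2_scaleR_right zero_le_mult_iff)
  have "2 * pi * (t - s) < 2 * pi * (1 / 4)" using st by (intro mult_strict_left_mono) auto
  then have sp: "0 < cross2 (?u s) (?u t)" unfolding cross2_unit_dir
    using st by (intro sin_gt_zero) auto
  define A B where "A = cross2 (z - c) (?u t) / cross2 (?u s) (?u t)"
    and "B = cross2 (?u s) (z - c) / cross2 (?u s) (?u t)"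
  have AB: "0 \<le> A" "0 \<le> B" "z - c = A *\<^sub>R ?u s + B *\<^sub>R ?u t"
    using zs zt sp cross2_decompose[of "?u s" "?u t" "z - c"] by (auto simp: A_def B_def)
  have zc: "z - c \<noteq> 0" using z(1) c by (auto simp: frontier_def)
  have "\<exists>q\<ge>s. q \<le> t \<and> cross2 (?u q) (z - c) = 0"
  proof (rule IVT2')
    show "cross2 (?u t) (z - c) \<le> 0" using zt cross2_commute[of "?u t"] by simp
    show "continuous_on {s..t} (\<lambda>q. cross2 (?u q) (z - c))"
      by (intro continuous_intros continuous_on_unit_dir)
  qed (use zs st in auto)
  then obtain q where q: "s \<le> q" "q \<le> t" "cross2 (?u q) (z - c) = 0" by blast
  have "?u q \<noteq> 0" using norm_unit_dir[of q] by (metis norm_zero zero_neq_one)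
  then obtain k where k: "z - c = k *\<^sub>R ?u q" using cross2_eq_0_imp_scaleR[OF q(3)] by blast
  have "k = (z - c) \<bullet> ?u q" using k by (simp add: dot_square_norm)
  also have "\<dots> = A * cos (2 * pi * (q - s)) + B * cos (2 * pi * (t - q))"
  proof -
    have "cos (2 * pi * (q - t)) = cos (2 * pi * (t - q))"
      using cos_minus[of "2 * pi * (t - q)"] by (simp only: mult_minus_right [symmetric]
          minus_diff_eq)
    then show ?thesis unfolding AB(3) by (simp only: inner_add_left inner_scaleR_left
        inner_unit_dir)
  qed
  also have "\<dots> > 0"
  proof -
    have "2 * pi * (q - s) < 2 * pi * (1 / 4)" "2 * pi * (t - q) < 2 * pi * (1 / 4)"
      using st q by (intro mult_strict_left_mono; simp)+
    moreover have "0 \<le> 2 * pi * (q - s)" "0 \<le> 2 * pi * (t - q)" using q by simp_all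
    ultimately have "0 < cos (2 * pi * (q - s))" "0 < cos (2 * pi * (t - q))"
      by (intro cos_gt_zero_pi; use pi_gt_zero in linarith)+
    moreover have "A \<noteq> 0 \<or> B \<noteq> 0" using AB(3) zc by auto
    ultimately show ?thesis using AB(1,2)
      by (cases "A = 0") (auto intro!: add_pos_nonneg mult_pos_pos mult_nonneg_nonneg)
  qed
  finally have kpos: "0 < k" .
  obtain rq where rq: "rq > 0" "g q = c + rq *\<^sub>R ?u q"
    using rad[of q] st q by force
  have "g q \<in> frontier S"
  proof -
    have "g q \<in> path_image g" using st q by (auto simp: path_image_def)
    then show ?thesis using g by (simp add: radial_param_def)
  qed
  moreover have zk: "z = c + k *\<^sub>R ?u q" using k by (simp add: algebra_simps)
  ultimately have "k = rq"
    using z(1) rq kpos by (intro ray_frontier_unique[OF conv c, of k "?u q" rq]) auto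
  then have "z = g q" using rq zk by simp
  then show ?thesis using q by auto
qed

section \<open>Arcs of an arbitrary subdivision\<close>

locale subdivision_param =
  fixes S :: "(real^2) set" and m :: nat and x :: "nat \<Rightarrow> real^2" and A :: "nat \<Rightarrow> (real^2) set"
    and g :: "real \<Rightarrow> real^2" and t :: "nat \<Rightarrow> real"
  assumes simple: "simple_path g" and closed_path: "pathfinish g = pathstart g"
    and image: "path_image g = frontier S" and t_first: "t 1 = 0" and t_last: "t (m + 1) = 1"
    and strict_mono_t: "strict_mono_on {1..m + 1} t"
    and x: "i \<in> {1..m + 1} \<Longrightarrow> x i = g (t i)" and A: "i \<in> {1..m} \<Longrightarrow> A i = g ` {t i..t (i + 1)}"
begin

lemma mono: "i \<in> {1..m + 1} \<Longrightarrow> k \<in> {1..m + 1} \<Longrightarrow> t i \<le> t k \<longleftrightarrow> i \<le> k"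
  using strict_mono_on_less_eq[OF strict_mono_t] by simp

lemma t01: "i \<in> {1..m + 1} \<Longrightarrow> 0 \<le> t i \<and> t i \<le> 1"
  using mono[of 1 i] mono[of i "m + 1"] t_first t_last by auto

lemma loop:
  "g r = g r' \<Longrightarrow> r \<in> {0..1} \<Longrightarrow> r' \<in> {0..1} \<Longrightarrow> r = r' \<or> r = 0 \<and> r' = 1 \<or> r = 1 \<and> r' = 0"
  using simple by (simp add: simple_path_def loop_free_def)

end

lemma subdivision_iff_param: "subdivision S m x A \<longleftrightarrow> (\<exists>g t. subdivision_param S m x A g t)"
  unfolding subdivision_def subdivision_param_def by (simp only: Ball_def conj_assoc)

lemma subdivision_endpoints:
  assumes "subdivision S m x A"
  shows "i \<in> {1..m} \<Longrightarrow> x i \<in> A i" "i \<in> {1..m} \<Longrightarrow> x (i + 1) \<in> A i"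
    "i \<in> {1..m} \<Longrightarrow> A i \<subseteq> frontier S" "x (m + 1) = x 1"
proof -
  obtain g t where "subdivision_param S m x A g t"
    using assms by (auto simp: subdivision_iff_param)
  then interpret subdivision_param S m x A g t .
  show "x (m + 1) = x 1" using x t_first t_last closed_path
      by (simp add: pathfinish_def pathstart_def)
  fix i assume i: "i \<in> {1..m}"
  have "t i \<le> t (i + 1)" using mono[of i "i + 1"] i by simp
  then show "x i \<in> A i" "x (i + 1) \<in> A i" using x[of i] x[of "i + 1"] A[OF i] i by auto
  have "{t i..t (i + 1)} \<subseteq> {0..1}" using t01[of i] t01[of "i + 1"] i by auto
  then show "A i \<subseteq> frontier S" using image A[OF i] by (auto simp: path_image_def)
qed

lemma subdivision_inj:
  assumes "subdivision S m x A" and i: "i \<in> {1..m}" and k: "k \<in> {1..m}" and eq: "x i = x k"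
  shows "i = k"
proof -
  obtain g t where "subdivision_param S m x A g t"
    using assms(1) by (auto simp: subdivision_iff_param)
  then interpret subdivision_param S m x A g t .
  have "g (t i) = g (t k)" "t i \<in> {0..1}" "t k \<in> {0..1}"
    using x[of i] x[of k] t01[of i] t01[of k] i k eq by simp_all
  from loop[OF this] consider "t i = t k" | "t (m + 1) \<le> t i \<or> t (m + 1) \<le> t k"
    unfolding t_last by linarith
  then show ?thesis
  proof cases
    case 1
    then have "t i \<le> t k" "t k \<le> t i" by simp_all
    then show ?thesis using mono[of i k] mono[of k i] i k by auto
  next
    case 2
    then show ?thesis using mono[of "m + 1" i] mono[of "m + 1" k] i k by auto
  qed
qed

text \<open>The curve is injective except for its closing point. Two arcs can therefore share only
  the common endpoint of neighbours, or the point where the last arc returns to the start of the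
  first.\<close>

lemma subdivision_meet:
  assumes "subdivision S m x A" and i: "i \<in> {1..m}" and k: "k \<in> {1..m}" and "i < k" "z \<in> A i"
      "z \<in> A k"
  shows "k = i + 1 \<and> z = x k \<or> i = 1 \<and> k = m \<and> z = x 1"
proof -
  obtain g t where "subdivision_param S m x A g t"
    using assms(1) by (auto simp: subdivision_iff_param)
  then interpret subdivision_param S m x A g t .
  obtain r r' where "z = g r" "r \<in> {t i..t (i + 1)}" "z = g r'" "r' \<in> {t k..t (k + 1)}"
    using assms(5,6) unfolding A[OF i] A[OF k] by blast
  then have r: "z = g r" "g r = g r'" "t i \<le> r" "r \<le> t (i + 1)" "t k \<le> r'" "r' \<le> t (k + 1)"
      by simp_all
  have "r \<in> {0..1}" "r' \<in> {0..1}"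
    using r t01[of i] t01[of "i + 1"] t01[of k] t01[of "k + 1"] i k by auto
  from loop[OF r(2) this] consider "r = r'" | "r = 0" "r' = 1" | "r' = 0" by blast
  then show ?thesis
  proof cases
    case 1
    then have "t k \<le> t (i + 1)" using r by linarith
    then have "k = i + 1" using mono[of k "i + 1"] i k \<open>i < k\<close> by simp
    moreover from this have "r = t k" using 1 r by simp
    ultimately show ?thesis using r(1) x[of k] k by simp
  next
    case 2
    then have "i = 1" "k = m" using r t_first t_last mono[of i 1] mono[of "m + 1" "k + 1"] i k
        by auto
    then show ?thesis using r(1) 2 x[of 1] t_first by simp
  next
    case 3
    then show ?thesis using r t_first mono[of k 1] i k \<open>i < k\<close> by auto
  qed
qed

text \<open>Among three arcs \<open>i < k < l\<close> through \<open>q\<close>, the middle one is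
  neither the first nor the last. So \<open>subdivision_meet\<close> gives both
  \<open>q = x k\<close> and \<open>q = x l\<close>, against injectivity.\<close>

lemma subdivision_card_containing:
  assumes sub: "subdivision S m x A"
  shows "card {i \<in> {1..m}. q \<in> A i} \<le> 2"
proof (rule ccontr)
  define I where "I = {i \<in> {1..m}. q \<in> A i}"
  assume "\<not> card {i \<in> {1..m}. q \<in> A i} \<le> 2"
  then have card: "2 < card I" by (simp add: I_def)
  have fin: "finite I" "I \<noteq> {}" using card by (simp add: I_def, auto)
  have "card {Min I, Max I} \<le> 2" by (simp add: card_insert_if)
  then have "\<not> I \<subseteq> {Min I, Max I}" using card card_mono[of "{Min I, Max I}" I] by auto
  then obtain k where k: "k \<in> I" "k \<noteq> Min I" "k \<noteq> Max I" by blast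
  define i l where "i = Min I" and "l = Max I"
  have il: "i \<in> I" "l \<in> I" "i < k" "k < l"
    unfolding i_def l_def using k Min_in[OF fin] Max_in[OF fin] Min_le[OF fin(1) k(1)] Max_ge[OF
        fin(1) k(1)]
    by linarith+
  have "q = x k" "q = x l"
    using subdivision_meet[OF sub, of i k q] subdivision_meet[OF sub, of k l q] il k(1)
        by (auto simp: I_def)
  then show False using subdivision_inj[OF sub, of k l] il k(1) by (auto simp: I_def)
qed

lemma subdivision_card_containing_some:
  assumes "subdivision S m x A" "finite J"
  shows "card {i \<in> {1..m}. \<exists>k\<in>J. q k \<in> A i} \<le> 2 * card J"
proof -
  have "{i \<in> {1..m}. \<exists>k\<in>J. q k \<in> A i} = (\<Union>k\<in>J. {i \<in> {1..m}. q k \<in> A i})" by auto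
  then have "card {i \<in> {1..m}. \<exists>k\<in>J. q k \<in> A i} \<le> (\<Sum>k\<in>J. card {i \<in> {1..m}. q k \<in> A i})"
    by (simp only: card_UN_le assms(2))
  also have "\<dots> \<le> (\<Sum>k\<in>J. 2)" by (intro sum_mono subdivision_card_containing[OF assms(1)])
  finally show ?thesis by simp
qed

text \<open>For \<open>m = 1\<close> the only arc is the whole loop and returns to its starting
  point, hence the condition \<open>2 \<le> m\<close> in the second claim.\<close>

lemma subdivision_points:
  assumes sub: "subdivision S m x A" and i: "i \<in> {1..m}" and k: "k \<in> {1..m}"
  shows "x i \<in> A k \<Longrightarrow> x i = x k \<or> x i = x (k + 1)" "2 \<le> m \<Longrightarrow> x i \<noteq> x (i + 1)"
proof -
  have xi: "x i \<in> A i" and cl: "x (m + 1) = x 1" using subdivision_endpoints[OF sub] i by blast+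
  show "x i = x k \<or> x i = x (k + 1)" if "x i \<in> A k"
    using subdivision_meet[OF sub i k _ xi that] subdivision_meet[OF sub k i _ that xi] cl
    by (cases i k rule: linorder_cases) auto
  show "x i \<noteq> x (i + 1)" if "2 \<le> m"
    using subdivision_inj[OF sub i, of "i + 1"] subdivision_inj[OF sub i, of 1] cl i that
    by (cases "i = m") auto
qed

subsection \<open>Uniqueness of the affine perimeter and homotheties\<close>

text \<open>By the last condition, the arc on which a boundary point lies can be read off from its direction
  as seen from \<open>c\<close>.\<close>

definition fine_cut ::
  "(real^2) set \<Rightarrow> real^2 \<Rightarrow> (real^2 \<Rightarrow> real^2) \<Rightarrow> real \<Rightarrow> nat \<Rightarrow> (nat \<Rightarrow> real^2) \<Rightarrow> (nat \<Rightarrow> (real^2) set)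
      \<Rightarrow> (nat \<Rightarrow> real^2) \<Rightarrow> bool"
  where
  "fine_cut S c \<tau> \<delta> m x A y \<longleftrightarrow> subdivision S m x A \<and> 2 \<le> m \<and>
     (\<forall>i\<in>{1..m}. lines_meet (x i) (\<tau> (x i)) (x (i + 1)) (\<tau> (x (i + 1))) (y i)) \<and>
     (\<forall>i\<in>{1..m}. \<forall>z\<in>A i. \<forall>z'\<in>A i. norm (z - z') \<le> \<delta>) \<and>
     (\<forall>i\<in>{1..m}. 0 < cross2 (x i - c) (x (i + 1) - c)) \<and>
     (\<forall>i\<in>{1..m}. \<forall>z\<in>frontier S.
        0 \<le> cross2 (x i - c) (z - c) \<longrightarrow> 0 \<le> cross2 (z - c) (x (i + 1) - c) \<longrightarrow> z \<in> A i)"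

text \<open>The direction depends on the boundary point only. This gives
  \<open>d (m + 1) = d 1\<close> from \<open>x (m + 1) = x 1\<close>, and later allows the slope to
  be treated as a function of the point.\<close>

definition support_choice :: "(real^2) set \<Rightarrow> (real^2 \<Rightarrow> real^2) \<Rightarrow> bool" where
  "support_choice S \<tau> \<longleftrightarrow> (\<forall>z\<in>frontier S. norm (\<tau> z) = 1 \<and> left_support S z (\<tau> z))"

definition area_sum :: "nat \<Rightarrow> (nat \<Rightarrow> real^2) \<Rightarrow> (nat \<Rightarrow> real^2) \<Rightarrow> real" where
  "area_sum m x y = 2 * (\<Sum>i = 1..m. root 3 (triangle_area (x i) (y i) (x (i + 1))))"

lemma support_choice_exists:
  assumes "convex_body S"
  shows "\<exists>\<tau>. support_choice S \<tau>"
  unfolding support_choice_def using frontier_left_support[OF assms] by (intro bchoice) blast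

text \<open>The boundary is cut into equal angles as seen from \<open>c\<close>. Uniform continuity
  of the radial parametrization bounds the arcs, positivity of the sine below a half turn gives the
  orientation, and \<open>radial_param_between\<close> identifies the arcs by directions.\<close>

lemma fine_cut_exists:
  assumes S: "convex_body S" and inner: "cball c \<rho> \<subseteq> S" and rho: "0 < \<rho>" and outer: "S \<subseteq> cball c M"
    and tau: "support_choice S \<tau>" and del: "0 < \<delta>" "\<delta> \<le> \<rho>"
  shows "\<exists>m\<ge>N. \<exists>x A y. fine_cut S c \<tau> \<delta> m x A y"
proof -
  have "ball c \<rho> \<subseteq> S" using inner ball_subset_cball by blast
  then have c: "c \<in> interior S" using rho by (auto simp: mem_interior)
  have conv: "convex S" using S by (simp add: convex_body_def)
  obtain g where g: "radial_param S c g" using radial_param_exists[OF S c] by blast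
  have sp: "simple_path g" and clg: "pathfinish g = pathstart g" and img:
      "path_image g = frontier S"
    and rad: "\<And>t. t \<in> {0..1} \<Longrightarrow> \<exists>r>0. g t = c + r *\<^sub>R unit_dir t"
    using g by (auto simp: radial_param_def)
  have "continuous_on {0..1} g" using sp by (simp add: simple_path_def path_def)
  then have "uniformly_continuous_on {0..1} g" by (intro compact_uniformly_continuous) auto
  then obtain e where e: "e > 0" "\<And>s t. s \<in> {0..1} \<Longrightarrow> t \<in> {0..1} \<Longrightarrow> dist t s < e
      \<Longrightarrow> dist (g t) (g s) < \<delta>"
    unfolding uniformly_continuous_on_def using del(1) by metis
  obtain m0 :: nat where m0: "1 / e < real m0" using reals_Archimedean2 by blast
  \<comment> \<open>At least 5 pieces make the angular step smaller than a quarter turn, and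
    \<open>m0\<close> makes it smaller than the modulus of continuity \<open>e\<close>.\<close>
  define m where "m = max (max N 5) m0"
  have m: "N \<le> m" "5 \<le> m" "m0 \<le> m" by (auto simp: m_def)
  have "1 / e < real m" using m0 m(3) by linarith
  then have me: "1 / real m < e" using e(1) m(2) by (simp add: field_simps)
  define t where "t i = (real i - 1) / real m" for i :: nat
  define x where "x i = g (t i)" for i
  define A where "A i = g ` {t i..t (i + 1)}" for i
  have tstep: "t (i + 1) = t i + 1 / real m" for i
    by (simp add: t_def diff_divide_distrib)
  have t01: "t i \<in> {0..1}" if "i \<in> {1..m + 1}" for i
    using that m(2) by (auto simp: t_def field_simps)
  have t1: "t 1 = 0" "t (m + 1) = 1" using m(2) by (auto simp: t_def)
  have tm: "t i < t k" if "i < k" for i k using that m(2) by (simp add: t_def field_simps)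
  have sub: "subdivision S m x A"
    unfolding subdivision_def
  proof (intro exI conjI)
    show "strict_mono_on {1..m + 1} t" using tm by (auto intro: strict_mono_onI)
  qed (use sp clg img t1 in \<open>auto simp: x_def A_def\<close>)
  have step: "0 \<le> t i" "t i < t (i + 1)" "t (i + 1) \<le> 1" "t (i + 1) - t i < 1 / 4"
      if "i \<in> {1..m}" for i
  proof -
    have "1 / real m < 1 / 4" using m(2) by (simp add: field_simps)
    then show "t (i + 1) - t i < 1 / 4" using tstep[of i] by linarith
  qed (use that t01[of i] t01[of "i + 1"] tm[of i "i + 1"] in auto)
  have xf: "x i \<in> frontier S" if "i \<in> {1..m + 1}" for i
    using img t01[OF that] unfolding x_def path_image_def by blast
  have diam: "norm (z - z') \<le> \<delta>" if i: "i \<in> {1..m}" and z: "z \<in> A i" "z' \<in> A i" for i z z'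
  proof -
    obtain s s' where s: "z = g s" "s \<in> {t i..t (i + 1)}" "z' = g s'" "s' \<in> {t i..t (i + 1)}"
      using z unfolding A_def by blast
    then have "s \<in> {0..1}" "s' \<in> {0..1}" using step[OF i] by auto
    moreover have "\<bar>s - s'\<bar> \<le> 1 / real m" using s tstep[of i] by auto
    then have "dist s s' < e" using me by (simp add: dist_real_def)
    ultimately have "dist (g s) (g s') < \<delta>" using e(2) by blast
    then show ?thesis using s by (simp add: dist_norm)
  qed
  have ccw: "0 < cross2 (x i - c) (x (i + 1) - c)" if i: "i \<in> {1..m}" for i
  proof -
    obtain r where r: "r > 0" "g (t i) = c + r *\<^sub>R unit_dir (t i)" using rad t01[of i] i by force
    obtain r' where r': "r' > 0" "g (t (i + 1)) = c + r' *\<^sub>R unit_dir (t (i + 1))"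
      using rad t01[of "i + 1"] i by force
    have "cross2 (x i - c) (x (i + 1) - c) = r * r' * sin (2 * pi * (1 / real m))"
      using r r' tstep[of i] by (simp add: x_def cross2_scaleR_left cross2_scaleR_right
          cross2_unit_dir)
    moreover have "1 / real m < 1 / 2" using m(2) by (simp add: field_simps)
    then have "2 * pi * (1 / real m) < 2 * pi * (1 / 2)" by (intro mult_strict_left_mono) auto
    then have "0 < sin (2 * pi * (1 / real m))" using m(2) by (intro sin_gt_zero) auto
    ultimately show ?thesis using r r' by simp
  qed
  have "\<exists>y. lines_meet (x i) (\<tau> (x i)) (x (i + 1)) (\<tau> (x (i + 1))) y" if i: "i \<in> {1..m}" for i
  proof -
    have "x i \<in> A i" "x (i + 1) \<in> A i" using subdivision_endpoints[OF sub] i by blast+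
    then have "norm (x (i + 1) - x i) \<le> \<delta>" using diam[OF i] by blast
    then interpret support_pair S c \<rho> M \<delta> "x i" "\<tau> (x i)" "x (i + 1)" "\<tau> (x (i + 1))"
      using tau xf[of i] xf[of "i + 1"] i inner outer rho del
      by unfold_locales (auto simp: support_choice_def)
    show ?thesis by (rule meet_exists)
  qed
  then obtain y where y: "\<And>i. i \<in> {1..m} \<Longrightarrow> lines_meet (x i) (\<tau> (x i)) (x (i + 1)) (\<tau> (x (i
      + 1))) (y i)" by metis
  have between: "z \<in> A i" if "i \<in> {1..m}" "z \<in> frontier S" "0 \<le> cross2 (x i - c) (z - c)"
    "0 \<le> cross2 (z - c) (x (i + 1) - c)" for i z
    unfolding A_def using that step[OF that(1)]
    by (intro radial_param_between[OF g conv c]) (auto simp: x_def)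
  have "fine_cut S c \<tau> \<delta> m x A y"
    unfolding fine_cut_def using sub m(2) y diam ccw between by auto
  then show ?thesis using m(1) by blast
qed

lemma fine_cut_supporting_data:
  assumes cut: "fine_cut S c \<tau> \<delta> m x A y" and tau: "support_choice S \<tau>"
  shows "supporting_data S m x (\<lambda>i. support_line (x i) (\<tau> (x i))) y"
proof -
  have sub: "subdivision S m x A" and m: "2 \<le> m" using cut by (auto simp: fine_cut_def)
  have "x i \<in> frontier S" if "i \<in> {1..m + 1}" for i
  proof (cases "i = m + 1")
    case True
    then show ?thesis using subdivision_endpoints(2,3)[OF sub, of m] m by auto
  next
    case False
    then show ?thesis using subdivision_endpoints(1,3)[OF sub, of i] that by auto
  qed
  then have 1: "supporting_line S (x i) (support_line (x i) (\<tau> (x i)))" if "i \<in> {1..m + 1}" for i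
    using tau that unfolding supporting_line_iff support_line_def support_choice_def by blast
  have 2: "\<forall>i\<in>{1..m}. lines_meet (x i) (\<tau> (x i)) (x (i + 1)) (\<tau> (x (i + 1))) (y i)"
    using cut unfolding fine_cut_def by (elim conjE)
  show ?thesis
    unfolding supporting_data_def
  proof (intro conjI)
    show "support_line (x (m + 1)) (\<tau> (x (m + 1))) = support_line (x 1) (\<tau> (x 1))"
      by (simp only: subdivision_endpoints(4)[OF sub])
  qed (use 1 in blast, rule 2 [unfolded lines_meet_def])
qed

lemma subdivision_bounded:
  assumes "subdivision S m x A" "bounded S" "i \<in> {1..m}"
  shows "bounded (A i)"
proof -
  have "A i \<subseteq> closure S"
    using subdivision_endpoints(3)[OF assms(1,3)] by (auto simp: frontier_def)
  then show ?thesis using assms(2) bounded_closure bounded_subset by blast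
qed

lemma fine_cut_mesh:
  assumes cut: "fine_cut S c \<tau> \<delta> m x A y" and "bounded S" "0 \<le> \<delta>"
  shows "\<bar>MAX i\<in>{1..m}. diameter (A i)\<bar> \<le> \<delta>"
proof -
  have sub: "subdivision S m x A" and m: "2 \<le> m" using cut by (auto simp: fine_cut_def)
  have "diameter (A i) \<in> {0..\<delta>}" if i: "i \<in> {1..m}" for i
  proof -
    have "bounded (A i)"
      by (rule subdivision_bounded[OF sub assms(2) i])
    moreover have "diameter (A i) \<le> \<delta>"
      using cut i assms(3) by (intro diameter_le) (auto simp: fine_cut_def)
    ultimately show ?thesis using diameter_ge_0 by auto
  qed
  moreover have "(MAX i\<in>{1..m}. diameter (A i)) \<in> (\<lambda>i. diameter (A i)) ` {1..m}"
    using m by (intro Max_in) auto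
  ultimately show ?thesis by auto
qed

text \<open>The sequence is chosen before the candidate \<open>a\<close>, so one and the same
  sequence tests all of them. The offset 2 keeps the mesh bound strictly below \<rho>.\<close>

lemma fine_cut_sequence:
  assumes S: "convex_body S" and inner: "cball c \<rho> \<subseteq> S" and rho: "0 < \<rho>" and outer: "S \<subseteq> cball c M"
    and tau: "support_choice S \<tau>"
  obtains m x A y where "\<And>n. fine_cut S c \<tau> (\<rho> / real (n + 2)) (m n) (x n) (A n) (y n)"
    "\<And>a. has_affine_perimeter S a \<Longrightarrow> (\<lambda>n. area_sum (m n) (x n) (y n)) \<longlonglongrightarrow> a"
proof -
  have "\<exists>m\<ge>n. \<exists>x A y. fine_cut S c \<tau> (\<rho> / real (n + 2)) m x A y" for n
    using rho by (intro fine_cut_exists[OF S inner rho outer tau]) (auto simp: field_simps)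
  then obtain m x A y where 1: "\<And>n. n \<le> m n" "\<And>n. fine_cut S c \<tau> (\<rho> / real (n
      + 2)) (m n) (x n) (A n) (y n)"
    by metis
  have bS: "bounded S" using S by (simp add: convex_body_def compact_imp_bounded)
  have "filterlim m at_top sequentially"
    using 1(1) by (intro filterlim_at_top_mono[OF filterlim_ident]) auto
  moreover have "(\<lambda>n. MAX i\<in>{1..m n}. diameter (A n i)) \<longlonglongrightarrow> 0"
  proof (rule Lim_null_comparison)
    show "\<forall>\<^sub>F n in sequentially. norm (MAX i\<in>{1..m n}. diameter (A n i)) \<le> \<rho> / real (n + 2)"
    proof (intro always_eventually allI)
      fix n
      have "0 \<le> \<rho> / real (n + 2)" using rho by simp
      then show "norm (MAX i\<in>{1..m n}. diameter (A n i)) \<le> \<rho> / real (n + 2)"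
        using fine_cut_mesh[OF 1(2)[of n] bS] by simp
    qed
    show "(\<lambda>n. \<rho> / real (n + 2)) \<longlonglongrightarrow> 0"
      by (rule LIMSEQ_ignore_initial_segment) (rule lim_const_over_n)
  qed
  moreover have "subdivision S (m n) (x n) (A n)" for n using 1(2)[of n] by (simp add: fine_cut_def)
  moreover have "supporting_data S (m n) (x n) (\<lambda>i. support_line (x n i) (\<tau> (x n i))) (y n)" for n
    by (rule fine_cut_supporting_data[OF 1(2) tau])
  ultimately have all: "(\<forall>n. subdivision S (m n) (x n) (A n) \<and>
        supporting_data S (m n) (x n) (\<lambda>i. support_line (x n i) (\<tau> (x n i))) (y n)) \<and>
      filterlim m at_top sequentially \<and> (\<lambda>n. MAX i\<in>{1..m n}. diameter (A n i)) \<longlonglongrightarrow> 0"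
    by blast
  have "(\<lambda>n. area_sum (m n) (x n) (y n)) \<longlonglongrightarrow> a" if "has_affine_perimeter S a" for a
    unfolding area_sum_def
    by (rule that[unfolded has_affine_perimeter_def, THEN spec, THEN spec, THEN spec, THEN spec,
        THEN spec,
        THEN mp, OF all])
  then show thesis using that[OF 1(2)] by blast
qed

lemma convex_body_balls:
  assumes "convex_body S"
  obtains c \<rho> M where "0 < \<rho>" "cball c \<rho> \<subseteq> S" "S \<subseteq> cball c M"
proof -
  obtain c where "c \<in> interior S" using assms by (auto simp: convex_body_def)
  then obtain \<rho> where rho: "\<rho> > 0" "cball c \<rho> \<subseteq> S" using mem_interior_cball by blast
  have "bounded S" using assms by (simp add: convex_body_def compact_imp_bounded)
  then obtain M where "\<And>z. z \<in> S \<Longrightarrow> dist c z \<le> M" using bounded_any_center by metis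
  then have "S \<subseteq> cball c M" by auto
  then show thesis using that rho by blast
qed

text \<open>\<open>has_affine_perimeter\<close> quantifies over all admissible sequences and would
  hold for every number if there were none. The sequence of fine cuts excludes this, and its limit
  is unique.\<close>

lemma has_affine_perimeter_unique:
  assumes S: "convex_body S" and "has_affine_perimeter S a" "has_affine_perimeter S b"
  shows "a = b"
proof -
  obtain c \<rho> M where 1: "cball c \<rho> \<subseteq> S" "0 < \<rho>" "S \<subseteq> cball c M"
    using convex_body_balls[OF S] by metis
  obtain \<tau> where 2: "support_choice S \<tau>" using support_choice_exists[OF S] by blast
  obtain m x y where lim: "\<And>a. has_affine_perimeter S a \<Longrightarrow> (\<lambda>n. area_sum (m n) (x n) (y n)) \<longlonglongrightarrow> a"
    by (rule fine_cut_sequence[OF S 1 2]) (rule that)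
  show ?thesis by (rule LIMSEQ_unique[OF lim[OF assms(2)] lim[OF assms(3)]])
qed

lemma AP_eqI:
  assumes "convex_body S" "has_affine_perimeter S a"
  shows "AP S = a"
  unfolding AP_def using assms(2) by (rule the_equality) (rule has_affine_perimeter_unique[OF
      assms(1) _ assms(2)])

text \<open>The affine perimeter is the limit along every admissible sequence, so an upper bound
  along the fine cuts suffices. The term \<open>e \<delta>\<close> leaves room for exceptional
  triangles.\<close>

lemma has_affine_perimeter_le:
  assumes S: "convex_body S" and a: "has_affine_perimeter S a"
    and inner: "cball c \<rho> \<subseteq> S" and rho: "0 < \<rho>" and outer: "S \<subseteq> cball c M"
    and tau: "support_choice S \<tau>"
    and le: "\<And>\<delta> m x A y. 0 < \<delta> \<Longrightarrow> \<delta> < \<rho> \<Longrightarrow> fine_cut S c \<tau> \<delta> m x A y \<Longrightarrow> area_sum m x y \<le> B + e \<delta>"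
    and e: "(e \<longlongrightarrow> 0) (at_right 0)"
  shows "a \<le> B"
proof -
  obtain m x A y where 1: "\<And>n. fine_cut S c \<tau> (\<rho> / real (n + 2)) (m n) (x n) (A n) (y n)"
    "(\<lambda>n. area_sum (m n) (x n) (y n)) \<longlonglongrightarrow> a"
    by (rule fine_cut_sequence[OF S inner rho outer tau]) (use that a in blast)
  have "(\<lambda>n. \<rho> / real (n + 2)) \<longlonglongrightarrow> 0"
    by (rule LIMSEQ_ignore_initial_segment) (rule lim_const_over_n)
  then have "filterlim (\<lambda>n. \<rho> / real (n + 2)) (at_right 0) sequentially"
    using rho by (auto simp: filterlim_at)
  then have "(\<lambda>n. e (\<rho> / real (n + 2))) \<longlonglongrightarrow> 0" by (rule filterlim_compose[OF e])
  then have "(\<lambda>n. B + e (\<rho> / real (n + 2))) \<longlonglongrightarrow> B + 0" by (intro tendsto_intros)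
  moreover have "area_sum (m n) (x n) (y n) \<le> B + e (\<rho> / real (n + 2))" for n
  proof (rule le[OF _ _ 1(1)])
    show "0 < \<rho> / real (n + 2)" using rho by simp
    show "\<rho> / real (n + 2) < \<rho>" using rho by (simp add: field_simps add_pos_nonneg)
  qed
  ultimately show ?thesis using 1(2) by (intro LIMSEQ_le[of _ a _ "B + 0", simplified]) auto
qed


section \<open>The homothety with center 0 and ratio one half\<close>

abbreviation half :: "real^2 \<Rightarrow> real^2" where
  "half z \<equiv> (1 / 2) *\<^sub>R z"

lemma inj_half: "inj half"
  by (rule injI) simp

lemma linear_half: "linear half"
  by (rule linear_scaleR)

lemma frontier_half: "frontier (half ` S) = half ` frontier S"
proof -
  have "interior (half ` S) = half ` interior S"
    by (rule interior_injective_linear_image[OF linear_half inj_half])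
  moreover have "closure (half ` S) = half ` closure S"
    by (rule closure_injective_linear_image[OF linear_half inj_half, symmetric])
  ultimately show ?thesis by (simp only: frontier_def image_set_diff[OF inj_half])
qed

lemma convex_body_half:
  assumes "convex_body S"
  shows "convex_body (half ` S)"
proof -
  have "interior (half ` S) = half ` interior S"
    by (rule interior_injective_linear_image[OF linear_half inj_half])
  then show ?thesis using assms
    unfolding convex_body_def by (auto intro: compact_scaling convex_scaling)
qed

lemma subdivision_half:
  assumes "subdivision S m x A"
  shows "subdivision (half ` S) m (\<lambda>i. half (x i)) (\<lambda>i. half ` A i)"
proof -
  obtain g t where g: "simple_path g" "pathfinish g = pathstart g" "path_image g = frontier S"
      "t 1 = 0" "t (m + 1) = 1" "strict_mono_on {1..m + 1} t"
      "\<And>i. i \<in> {1..m + 1} \<Longrightarrow> x i = g (t i)" "\<And>i. i \<in> {1..m} \<Longrightarrow> A i = g ` {t i..t (i + 1)}"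
    using assms unfolding subdivision_def by blast
  show ?thesis unfolding subdivision_def
  proof (intro exI conjI ballI)
    show "simple_path (half \<circ> g)"
      using g(1) simple_path_linear_image_eq[OF linear_half inj_half] by simp
    show "path_image (half \<circ> g) = frontier (half ` S)"
      by (simp only: path_image_compose g(3) frontier_half)
  qed (use g in \<open>auto simp: pathfinish_def pathstart_def image_comp [symmetric]\<close>)
qed

lemma supporting_line_half:
  assumes "supporting_line S x d"
  shows "supporting_line (half ` S) (half x) (half ` d)"
proof -
  obtain n where n: "x \<in> S" "n \<noteq> 0" "d = {z. n \<bullet> z = n \<bullet> x}" "\<And>z. z \<in> S \<Longrightarrow> n \<bullet> z \<le> n \<bullet> x"
    using assms by (auto simp: supporting_line_def)
  have "half ` d = {z. n \<bullet> z = n \<bullet> half x}"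
  proof (intro set_eqI iffI)
    fix z assume "z \<in> {z. n \<bullet> z = n \<bullet> half x}"
    then have "2 *\<^sub>R z \<in> d" "z = half (2 *\<^sub>R z)" using n(3) by auto
    then show "z \<in> half ` d" by blast
  qed (use n(3) in auto)
  then show ?thesis unfolding supporting_line_def using n by (intro conjI exI[of _ n]) auto
qed

lemma supporting_data_half:
  assumes "supporting_data S m x d y"
  shows "supporting_data (half ` S) m (\<lambda>i. half (x i)) (\<lambda>i. half ` d i) (\<lambda>i. half (y i))"
  unfolding supporting_data_def
proof (intro conjI ballI)
  show "supporting_line (half ` S) (half (x i)) (half ` d i)" if "i \<in> {1..m + 1}" for i
    using assms that by (intro supporting_line_half) (auto simp: supporting_data_def)
  show "half ` d (m + 1) = half ` d 1" using assms by (simp add: supporting_data_def)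
  fix i assume i: "i \<in> {1..m}"
  have eq: "half ` d i = half ` d (i + 1) \<longleftrightarrow> d i = d (i + 1)" by (rule inj_image_eq_iff[OF inj_half])
  have *: "if d i = d (i + 1) then y i \<in> closed_segment (x i) (x (i + 1)) else d i \<inter> d (i + 1)
      = {y i}"
    using assms i unfolding supporting_data_def by blast
  show "if half ` d i = half ` d (i + 1) then half (y i) \<in> closed_segment (half (x i)) (half (x
      (i + 1)))
        else half ` d i \<inter> half ` d (i + 1) = {half (y i)}"
  proof (cases "d i = d (i + 1)")
    case True
    then have "half (y i) \<in> half ` closed_segment (x i) (x (i + 1))" using * by simp
    then have "half (y i) \<in> closed_segment (half (x i)) (half (x (i + 1)))"
      by (simp only: closed_segment_linear_image[OF linear_half])
    then show ?thesis using True by (simp only: if_True simp_thms)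
  next
    case False
    then have "half ` (d i \<inter> d (i + 1)) = {half (y i)}" using * by simp
    then show ?thesis using False unfolding image_Int[OF inj_half] eq by simp
  qed
qed

lemma triangle_area_half: "triangle_area (half a) (half b) (half c) = triangle_area a b c / 4"
  by (simp add: triangle_area_eq scaleR_right_diff_distrib [symmetric] cross2_scaleR_left
      cross2_scaleR_right abs_mult)

lemma has_affine_perimeter_half:
  assumes S: "bounded S" and a: "has_affine_perimeter (half ` S) a"
  shows "has_affine_perimeter S (a * root 3 4)"
  unfolding has_affine_perimeter_def
proof (intro allI impI, elim conjE)
  fix m x A d y
  assume 1: "\<forall>n. subdivision S (m n) (x n) (A n) \<and> supporting_data S (m n) (x n) (d n) (y n)"
    and 2: "filterlim m at_top sequentially"
    and 3: "(\<lambda>n. MAX i\<in>{1..m n}. diameter (A n i)) \<longlonglongrightarrow> 0"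
  have sub: "subdivision S (m n) (x n) (A n)" for n using 1 by blast
  have half_diam: "0 \<le> diameter (half ` A n i) \<and> diameter (half ` A n i) \<le> diameter (A n i)"
    if i: "i \<in> {1..m n}" for n i
  proof -
    have b: "bounded (A n i)"
      by (rule subdivision_bounded[OF sub S i])
    have "diameter (half ` A n i) \<le> diameter (A n i)"
    proof (rule diameter_le)
      fix z z' assume "z \<in> half ` A n i" "z' \<in> half ` A n i"
      then obtain w w' where w: "w \<in> A n i" "w' \<in> A n i" "z = half w" "z' = half w'" by blast
      then have "norm (z - z') = norm (w - w') / 2"
        by (simp add: scaleR_right_diff_distrib [symmetric])
      also have "\<dots> \<le> norm (w - w')" by simp
      also have "\<dots> \<le> diameter (A n i)"
        using diameter_bounded_bound[OF b w(1,2)] by (simp add: dist_norm)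
      finally show "norm (z - z') \<le> diameter (A n i)" .
    qed (use diameter_ge_0[OF b] in simp)
    moreover have "bounded (half ` A n i)" by (rule bounded_scaling[OF b])
    ultimately show ?thesis using diameter_ge_0 by blast
  qed
  have "(\<lambda>n. MAX i\<in>{1..m n}. diameter (half ` A n i)) \<longlonglongrightarrow> 0"
  proof (rule Lim_null_comparison[OF _ 3])
    have "\<forall>\<^sub>F n in sequentially. 1 \<le> m n" using 2 by (simp add: filterlim_at_top)
    then show "\<forall>\<^sub>F n in sequentially. norm (MAX i\<in>{1..m n}. diameter (half ` A n i))
        \<le> (MAX i\<in>{1..m n}. diameter (A n i))"
    proof eventually_elim
      case (elim n)
      have "(MAX i\<in>{1..m n}. diameter (half ` A n i)) \<in> (\<lambda>i. diameter (half ` A n i)) ` {1..m n}"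
        using elim by (intro Max_in) auto
      then obtain i where i: "i \<in> {1..m n}" "(MAX i\<in>{1..m n}. diameter (half ` A n i))
          = diameter (half ` A n i)"
        by blast
      have "diameter (A n i) \<le> (MAX i\<in>{1..m n}. diameter (A n i))"
        using i(1) by (intro Max_ge) auto
      then show ?case using half_diam[OF i(1)] i(2) by simp
    qed
  qed
  then have "(\<lambda>n. 2 * (\<Sum>i = 1..m n. root 3 (triangle_area (half (x n i)) (half (y n i)) (half (x
      n (i + 1)))))) \<longlonglongrightarrow> a"
    using a[unfolded has_affine_perimeter_def, THEN spec, THEN spec, THEN spec, THEN spec, THEN
        spec,
        THEN mp, of m "\<lambda>n i. half (x n i)" "\<lambda>n i. half ` A n i" "\<lambda>n i. half ` d n i"
            "\<lambda>n i. half (y n i)"]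
      1 2 subdivision_half supporting_data_half by simp
  then have "(\<lambda>n. 2 * (\<Sum>i = 1..m n. root 3 (triangle_area (half (x n i)) (half (y n i)) (half (x
      n (i + 1))))) * root 3 4)
      \<longlonglongrightarrow> a * root 3 4" by (rule tendsto_mult_right)
  moreover have "2 * (\<Sum>i = 1..m n. root 3 (triangle_area (half (x n i)) (half (y n i)) (half (x n
      (i + 1))))) * root 3 4 =
      2 * (\<Sum>i = 1..m n. root 3 (triangle_area (x n i) (y n i) (x n (i + 1))))" for n
    unfolding triangle_area_half by (simp add: real_root_divide sum_divide_distrib [symmetric])
  ultimately show "(\<lambda>n. 2 * (\<Sum>i = 1..m n. root 3 (triangle_area (x n i) (y n i) (x n (i
      + 1))))) \<longlonglongrightarrow> a * root 3 4"
    by (simp only:)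
qed

text \<open>\<open>AP\<close> is a definite description, so all bodies without an affine perimeter share one junk
  value. If the limit shape were such a body, its half would be another maximizer.\<close>

lemma is_Dom_has_affine_perimeter:
  assumes D: "is_Dom K D" and K: "convex K" "0 \<in> K"
  shows "has_affine_perimeter D (AP D)"
proof (rule ccontr)
  assume "\<not> has_affine_perimeter D (AP D)"
  have body: "convex_body D" and DK: "D \<subseteq> K" and star: "is_AP_star K (AP D)"
    and uniq: "\<And>S. convex_body S \<Longrightarrow> S \<subseteq> K \<Longrightarrow> is_AP_star K (AP S) \<Longrightarrow> S = D"
    using D by (auto simp: is_Dom_def)
  have bD: "bounded D" and cD: "compact D" using body
      by (simp_all add: convex_body_def compact_imp_bounded)
  have none: "\<not> has_affine_perimeter D a" for a
    using \<open>\<not> has_affine_perimeter D (AP D)\<close> AP_eqI[OF body] by metis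
  then have none': "\<not> has_affine_perimeter (half ` D) a" for a
    using has_affine_perimeter_half[OF bD] by blast
  \<comment> \<open>Both predicates are constantly false, so the two definite descriptions are the
    same term.\<close>
  have "has_affine_perimeter (half ` D) = has_affine_perimeter D"
    using none none' by (simp add: fun_eq_iff)
  then have "AP (half ` D) = AP D" by (simp add: AP_def)
  moreover have "half ` D \<subseteq> K"
  proof
    fix z assume "z \<in> half ` D"
    then obtain w where w: "w \<in> K" "z = half w" using DK by blast
    then have "(1 / 2) *\<^sub>R w + (1 / 2) *\<^sub>R 0 \<in> K" using K by (intro convexD) auto
    then show "z \<in> K" using w by simp
  qed
  ultimately have eq: "half ` D = D" using uniq[OF convex_body_half[OF body]] star by metis
  have ne: "D \<noteq> {}" using body interior_subset by (auto simp: convex_body_def)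
  \<comment> \<open>A compact set equal to its own half is contained in \<open>{0}\<close>: a point
    \<open>z\<close> farthest from 0 is the half of another point, whose norm is twice as
    large.\<close>
  obtain z where z: "z \<in> D" "\<And>w. w \<in> D \<Longrightarrow> norm w \<le> norm z"
    using distance_attains_sup[OF cD ne, of 0] by auto
  obtain w where w: "w \<in> D" "z = half w" using z(1) eq by blast
  have "norm w \<le> norm z" using z(2) w(1) by blast
  then have "norm z \<le> 0" using w(2) by simp
  then have "D \<subseteq> {0}" using z(2) by fastforce
  then have "interior D \<subseteq> interior {0}" by (rule interior_mono)
  then show False using body by (simp add: convex_body_def)
qed

subsection \<open>The polygon and its corners\<close>

text \<open>Induction on the number of intervals. Once the one with the largest left end is removed,
  all others fit into the space before it.\<close>

lemma sum_interval_lengths_le: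
  fixes l u :: "'a \<Rightarrow> real"
  assumes "finite I" "\<And>i. i \<in> I \<Longrightarrow> a \<le> l i \<and> l i < u i \<and> u i \<le> b" "a \<le> b"
    "\<And>i k. i \<in> I \<Longrightarrow> k \<in> I \<Longrightarrow> i \<noteq> k \<Longrightarrow> u i \<le> l k \<or> u k \<le> l i"
  shows "(\<Sum>i\<in>I. u i - l i) \<le> b - a"
  using assms
proof (induction "card I" arbitrary: I b)
  case 0
  then show ?case by simp
next
  case (Suc n)
  then have ne: "I \<noteq> {}" by auto
  have "Max (l ` I) \<in> l ` I" using Suc.prems(1) ne by (intro Max_in) auto
  then obtain i where i: "i \<in> I" "Max (l ` I) = l i" by blast
  have imax: "l k \<le> l i" if "k \<in> I" for k
    using Max_ge[of "l ` I" "l k"] Suc.prems(1) that i(2) by simp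
  have "(\<Sum>k\<in>I - {i}. u k - l k) \<le> l i - a"
  proof (rule Suc.hyps(1))
    show "n = card (I - {i})" using Suc.hyps(2) i(1) Suc.prems(1) by simp
    show "a \<le> l k \<and> l k < u k \<and> u k \<le> l i" if "k \<in> I - {i}" for k
      using Suc.prems(2)[of k] Suc.prems(2)[of i] Suc.prems(4)[of k i] i(1) imax[of k] that by auto
    show "a \<le> l i" using Suc.prems(2) i(1) by blast
  qed (use Suc.prems in auto)
  moreover have "(\<Sum>k\<in>I. u k - l k) = (u i - l i) + (\<Sum>k\<in>I - {i}. u k - l k)"
    using i(1) Suc.prems(1) by (rule sum.remove[rotated])
  moreover have "u i \<le> b" using Suc.prems(2) i(1) by blast
  ultimately show ?case by linarith
qed

text \<open>The inequality of means for the three numbers \<open>a\<close>, \<open>a\<close>,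
  \<open>b\<close>; the difference of the cubes factors with \<open>(a - b)\<^sup>2\<close>.\<close>

lemma root3_mult_square_le:
  fixes a b :: real
  assumes "0 \<le> a" "0 \<le> b"
  shows "root 3 (a\<^sup>2 * b) \<le> (2 * a + b) / 3"
proof -
  have "27 * (a\<^sup>2 * b) \<le> (2 * a + b) ^ 3"
  proof -
    have "(2 * a + b) ^ 3 - 27 * (a\<^sup>2 * b) = (a - b)\<^sup>2 * (8 * a + b)"
      by (simp add: power2_eq_square power3_eq_cube algebra_simps)
    moreover have "0 \<le> (a - b)\<^sup>2 * (8 * a + b)" using assms by simp
    ultimately show ?thesis by linarith
  qed
  then have "a\<^sup>2 * b \<le> ((2 * a + b) / 3) ^ 3" by (simp add: power_divide)
  then have "root 3 (a\<^sup>2 * b) \<le> root 3 (((2 * a + b) / 3) ^ 3)" by simp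
  also have "\<dots> = (2 * a + b) / 3" using assms by (simp add: real_root_power_cancel)
  finally show ?thesis .
qed

lemma cross2_sum_left: "cross2 (\<Sum>x\<in>A. f x) t = (\<Sum>x\<in>A. cross2 (f x) t)"
  by (induction A rule: infinite_finite_induct) (simp_all add: cross2_zero_left cross2_add_left)

lemma open_segmentI:
  fixes a b :: "'a::real_vector"
  assumes "x = (1 - u) *\<^sub>R a + u *\<^sub>R b" "0 < u" "u < 1" "a \<noteq> b"
  shows "x \<in> open_segment a b"
  unfolding in_segment using assms by blast

text \<open>Of three distinct points on a line, one lies strictly between the other two; the cases
  for \<open>r\<close> tell which one.\<close>

lemma extreme_points_not_collinear:
  fixes a b c :: "real^2"
  assumes "a extreme_point_of K" "b extreme_point_of K" "c extreme_point_of K"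
    and "a \<noteq> b" "b \<noteq> c" "a \<noteq> c"
  shows "cross2 (b - a) (c - a) \<noteq> 0"
proof
  assume "cross2 (b - a) (c - a) = 0"
  then obtain r where r: "c - a = r *\<^sub>R (b - a)"
      using cross2_eq_0_imp_scaleR[of "b - a"] assms(4) by auto
  then have c: "c = (1 - r) *\<^sub>R a + r *\<^sub>R b" by (simp add: algebra_simps)
  have r01: "r \<noteq> 0" "r \<noteq> 1" using c assms(5,6) by auto
  have ext: "x \<notin> open_segment y z" if "x \<in> {a, b, c}" "y \<in> {a, b, c}" "z \<in> {a, b, c}" for x y z
    using assms(1-3) that unfolding extreme_point_of_def by blast
  consider "r < 0" | "0 < r" "r < 1" | "1 < r" using r01 by linarith
  then show False
  proof cases
    case 1
    have "a = (1 - (- r / (1 - r))) *\<^sub>R c + (- r / (1 - r)) *\<^sub>R b"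
    proof -
      have "1 - (- r / (1 - r)) = 1 / (1 - r)" using 1 by (simp add: field_simps)
      moreover have "(1 / (1 - r)) *\<^sub>R c = a + (r / (1 - r)) *\<^sub>R b"
        unfolding c using 1 by (simp add: scaleR_add_right)
      ultimately show ?thesis by simp
    qed
    moreover have "0 < - r / (1 - r)" "- r / (1 - r) < 1" using 1 by (simp_all add: field_simps)
    ultimately show False using ext[of a c b] assms(5) open_segmentI[of a _ c b] by blast
  next
    case 2
    then have "c \<in> open_segment a b" using c assms(4) by (intro open_segmentI)
    then show False using ext by blast
  next
    case 3
    have "b = (1 - 1 / r) *\<^sub>R a + (1 / r) *\<^sub>R c"
    proof -
      have "(1 / r) *\<^sub>R c = (1 / r - 1) *\<^sub>R a + b"
        unfolding c using 3 by (simp add: scaleR_add_right diff_divide_distrib)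
      then show ?thesis by (simp add: algebra_simps)
    qed
    moreover have "0 < 1 / r" "1 / r < 1" using 3 by simp_all
    ultimately have "b \<in> open_segment a c" using assms(6) by (intro open_segmentI)
    then show False using ext by blast
  qed
qed

section \<open>Side directions and corners of a counterclockwise polygon\<close>

locale ccw_polygon =
  fixes \<kappa> :: nat and K :: "(real^2) set" and v :: "nat \<Rightarrow> real^2"
  assumes kappa: "3 \<le> \<kappa>" and convex_K: "convex K"
    and extreme: "j \<in> {1..\<kappa>} \<Longrightarrow> v j extreme_point_of K" and inj: "inj_on v {1..\<kappa>}"
    and left: "j \<in> {1..\<kappa>} \<Longrightarrow> z \<in> K \<Longrightarrow> 0 \<le> cross2 (v (nxt \<kappa> j) - v j) (z - v j)"
begin

abbreviation "J \<equiv> {1..\<kappa>}"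
abbreviation "N \<equiv> nxt \<kappa>"
abbreviation "P \<equiv> prv \<kappa>"

definition E :: "nat \<Rightarrow> real^2" where "E j = v (N j) - v j"
text \<open>This number turns out to be the right-hand side
  \<open>r j * r (N j) * sin (\<theta> j)\<close> of the system, see
  \<open>sides_angle_eq\<close>.\<close>

definition R :: "nat \<Rightarrow> real" where "R j = cross2 (E j) (E (N j))"

lemma N_in: "j \<in> J \<Longrightarrow> N j \<in> J" and P_in: "j \<in> J \<Longrightarrow> P j \<in> J"
  and N_P: "j \<in> J \<Longrightarrow> N (P j) = j" and P_N: "j \<in> J \<Longrightarrow> P (N j) = j"
  and N_neq: "j \<in> J \<Longrightarrow> N j \<noteq> j" and NN_neq: "j \<in> J \<Longrightarrow> N (N j) \<noteq> j"
  using kappa by (auto simp: nxt_def prv_def)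

lemma N_bij: "bij_betw N J J"
  by (rule bij_betw_byWitness[where f' = P]) (use N_in P_in N_P P_N in auto)

lemma sum_N: "(\<Sum>j\<in>J. h (N j)) = (\<Sum>j\<in>J. h j)"
  by (rule sum.reindex_bij_betw[OF N_bij])

text \<open>Induction around the cycle: from \<open>k\<close> up to \<kappa>, over the end to 1, and
  up again to \<open>i\<close>.\<close>

lemma N_induct:
  assumes "k \<in> J" "Q k" "\<And>j. j \<in> J \<Longrightarrow> Q j \<Longrightarrow> Q (N j)" "i \<in> J"
  shows "Q i"
proof -
  have up: "Q (b + n)" if "b \<in> J" "Q b" "b + n \<le> \<kappa>" for b n
    using that(3)
  proof (induction n)
    case 0
    then show ?case using that by simp
  next
    case (Suc n)
    then have "Q (N (b + n))" using that(1) by (intro assms(3)) auto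
    then show ?case using Suc.prems by (simp add: nxt_def)
  qed
  have "Q (k + (\<kappa> - k))" using assms(1,2) by (intro up) auto
  then have "Q \<kappa>" using assms(1) by simp
  then have "Q (N \<kappa>)" using kappa by (intro assms(3)) auto
  then have "Q 1" by (simp add: nxt_def)
  then have "Q (1 + (i - 1))" using assms(4) kappa by (intro up) auto
  then show ?thesis using assms(4) by simp
qed

lemma v_neq: "i \<in> J \<Longrightarrow> j \<in> J \<Longrightarrow> i \<noteq> j \<Longrightarrow> v i \<noteq> v j"
  using inj_on_eq_iff[OF inj] by blast

lemma v_in: "j \<in> J \<Longrightarrow> v j \<in> K"
  using extreme by (simp add: extreme_point_of_def)

lemma E_nz: "j \<in> J \<Longrightarrow> E j \<noteq> 0"
  using v_neq[of "N j" j] N_in N_neq by (simp add: E_def)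

lemma R_pos: assumes j: "j \<in> J" shows "0 < R j"
proof -
  have R: "R j = cross2 (v (N j) - v j) (v (N (N j)) - v j)"
    by (simp add: R_def E_def cross2_def algebra_simps)
  have "0 \<le> R j" unfolding R using left[OF j v_in] j N_in by blast
  moreover have "R j \<noteq> 0" unfolding R
  proof (rule extreme_points_not_collinear[of _ K])
    have in': "N j \<in> J" "N (N j) \<in> J" using j N_in by blast+
    show "v j extreme_point_of K" "v (N j) extreme_point_of K" "v (N (N j)) extreme_point_of K"
      using extreme j in' by blast+
    show "v j \<noteq> v (N j)" using v_neq[OF j in'(1)] N_neq[OF j] by simp
    show "v (N j) \<noteq> v (N (N j))" using v_neq[OF in'] N_neq[OF in'(1)] by simp
    show "v j \<noteq> v (N (N j))" using v_neq[OF j in'(2)] NN_neq[OF j] by simp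
  qed
  ultimately show ?thesis by simp
qed

lemma sum_E: "(\<Sum>j\<in>J. E j) = 0"
  unfolding E_def sum_subtractf using sum_N[of v] by simp

text \<open>If \<open>t\<close> lay in none of these cones, nonnegativity of
  \<open>cross2 (E j) t\<close> would pass from each side to the next and so around the polygon.
  These numbers add up to 0 because the sides close up. Hence all would be 0, against
  \<open>R_pos\<close>, or all negative, against the sum.\<close>

lemma direction_cone:
  assumes "t \<noteq> 0"
  shows "\<exists>j\<in>J. 0 \<le> cross2 (E j) t \<and> 0 < cross2 t (E (N j))"
proof (rule ccontr)
  assume "\<not> ?thesis"
  then have step: "0 \<le> cross2 (E (N j)) t" if "j \<in> J" "0 \<le> cross2 (E j) t" for j
    using that cross2_commute[of t "E (N j)"] by (auto simp: not_less)
  have "(\<Sum>j\<in>J. cross2 (E j) t) = cross2 (\<Sum>j\<in>J. E j) t"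
    by (simp only: cross2_sum_left)
  then have sum0: "(\<Sum>j\<in>J. cross2 (E j) t) = 0" by (simp only: sum_E cross2_zero_left)
  show False
  proof (cases "\<exists>k\<in>J. 0 \<le> cross2 (E k) t")
    case True
    then obtain k where k: "k \<in> J" "0 \<le> cross2 (E k) t" by blast
    have nn: "0 \<le> cross2 (E j) t" if "j \<in> J" for j
      by (rule N_induct[where Q = "\<lambda>j. 0 \<le> cross2 (E j) t", OF k step that])
    then have z: "cross2 (E j) t = 0" if "j \<in> J" for j
      using sum0 that sum_nonneg_eq_0_iff[of J "\<lambda>j. cross2 (E j) t"] by auto
    have "cross2 t (E k) = 0" "cross2 t (E (N k)) = 0"
      using z[OF k(1)] z[OF N_in[OF k(1)]] cross2_commute[of t] by simp_all
    then obtain r r' where "E k = r *\<^sub>R t" "E (N k) = r' *\<^sub>R t"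
      using cross2_eq_0_imp_scaleR[OF _ assms] by blast
    then have "R k = 0" by (simp add: R_def cross2_simps)
    then show False using R_pos[OF k(1)] by simp
  next
    case False
    then have "(\<Sum>j\<in>J. cross2 (E j) t) < (\<Sum>j\<in>J. 0)" using kappa
        by (intro sum_strict_mono) (auto simp: not_le)
    then show False using sum0 by simp
  qed
qed

text \<open>Oblique coordinates at the vertex \<open>v (N j)\<close> along its two sides, scaled
  such that \<open>v j\<close> and \<open>v (N (N j))\<close> have coordinate 1 (Cramer's rule, see
  \<open>corner_coords\<close>).\<close>

definition ca :: "nat \<Rightarrow> real^2 \<Rightarrow> real" where "ca j z = cross2 (E (N j)) (z - v (N j)) / R j"
definition cb :: "nat \<Rightarrow> real^2 \<Rightarrow> real" where "cb j z = cross2 (E j) (z - v (N j)) / R j"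

lemma ca_nonneg: "j \<in> J \<Longrightarrow> z \<in> K \<Longrightarrow> 0 \<le> ca j z"
  using left[of "N j" z] R_pos[of j] N_in[of j] by (simp add: ca_def E_def)

lemma cb_nonneg: assumes "j \<in> J" "z \<in> K" shows "0 \<le> cb j z"
proof -
  have "cross2 (E j) (z - v (N j)) = cross2 (E j) (z - v j)"
    by (simp add: E_def cross2_def algebra_simps)
  then show ?thesis using left[of j z] R_pos[of j] assms by (simp add: cb_def E_def)
qed

lemma corner_coords:
  assumes "j \<in> J"
  shows "z - v (N j) = cb j z *\<^sub>R E (N j) - ca j z *\<^sub>R E j"
proof -
  have "cross2 (E j) (E (N j)) \<noteq> 0" using R_pos[OF assms] by (simp add: R_def)
  from cross2_decompose[OF this, of "z - v (N j)"] show ?thesis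
    using cross2_commute[of "z - v (N j)" "E (N j)"] by (simp add: ca_def cb_def R_def)
qed

lemma corner_coords_diff:
  assumes "j \<in> J"
  shows "z - z' = (cb j z - cb j z') *\<^sub>R E (N j) - (ca j z - ca j z') *\<^sub>R E j"
proof -
  have "z - z' = (z - v (N j)) - (z' - v (N j))" by simp
  also have "\<dots> = (cb j z - cb j z') *\<^sub>R E (N j) - (ca j z - ca j z') *\<^sub>R E j"
    unfolding corner_coords[OF assms] by (simp add: algebra_simps)
  finally show ?thesis .
qed

lemma corner_coords_add:
  assumes "j \<in> J"
  shows "ca j (z + u) = ca j z + cross2 (E (N j)) u / R j"
      "cb j (z + u) = cb j z + cross2 (E j) u / R j"
  by (simp_all add: ca_def cb_def cross2_add_right cross2_diff_right add_divide_distrib [symmetric])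

lemma direction_coords:
  assumes "j \<in> J"
  shows "t = (cross2 t (E (N j)) / R j) *\<^sub>R E j + (cross2 (E j) t / R j) *\<^sub>R E (N j)"
  using cross2_decompose[of "E j" "E (N j)" t] R_pos[OF assms] by (simp add: R_def)

end

subsection \<open>Upper bound for the affine perimeter\<close>

locale ccw_polygon_cut = ccw_polygon +
  fixes D :: "(real^2) set" and w :: "nat \<Rightarrow> real" and p :: "nat \<Rightarrow> real^2"
    and c :: "real^2" and \<rho> M \<delta> :: real and \<tau> :: "real^2 \<Rightarrow> real^2"
    and m :: nat and x :: "nat \<Rightarrow> real^2" and A :: "nat \<Rightarrow> (real^2) set" and y :: "nat \<Rightarrow> real^2"
  assumes D: "convex_body D" and DK: "D \<subseteq> K"
    and p_in: "j \<in> J \<Longrightarrow> p j \<in> D" and p_eq: "j \<in> J \<Longrightarrow> p j = v (N j) - w j *\<^sub>R E j"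
    and inner: "cball c \<rho> \<subseteq> D" and outer: "D \<subseteq> cball c M" and rho: "0 < \<rho>"
    and tau: "support_choice D \<tau>"
    and cut: "fine_cut D c \<tau> \<delta> m x A y" and delta: "0 < \<delta>" "\<delta> < \<rho>"
begin

definition T :: "nat \<Rightarrow> real" where "T i = triangle_area (x i) (y i) (x (i + 1))"
definition bad :: "nat set" where "bad = {i \<in> {1..m}. \<exists>k\<in>J. p k \<in> A i}"
definition good :: "nat set" where "good = {i \<in> {1..m}. T i \<noteq> 0 \<and> i \<notin> bad}"

lemma sub: "subdivision D m x A" and m2: "2 \<le> m"
  using cut by (simp_all add: fine_cut_def)

lemma c_interior: "c \<in> interior D"
proof -
  have "ball c \<rho> \<subseteq> D" using inner ball_subset_cball by blast
  then show ?thesis using rho by (auto simp: mem_interior)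
qed

lemma x_frontier: assumes "i \<in> {1..m}" shows "x i \<in> frontier D" "x (i + 1) \<in> frontier D"
  using subdivision_endpoints(1-3)[OF sub assms] by blast+

lemma frontier_in: "z \<in> frontier D \<Longrightarrow> z \<in> D"
  using D compact_imp_closed[of D] closure_closed[of D] by (auto simp: convex_body_def frontier_def)

lemma support:
  assumes "z \<in> frontier D"
  shows "norm (\<tau> z) = 1" "left_support D z (\<tau> z)"
  using tau assms by (simp_all add: support_choice_def)

lemma p_frontier: assumes j: "j \<in> J" shows "p j \<in> frontier D"
proof (rule left_support_frontier)
  show "left_support D (p j) (E j)"
    unfolding left_support_def
  proof (intro conjI ballI)
    fix z assume "z \<in> D"
    then have "0 \<le> cross2 (E j) (z - v j)" using left[OF j] DK by (auto simp: E_def)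
    moreover have "p j = v j + (1 - w j) *\<^sub>R E j" by (simp add: p_eq[OF j] E_def algebra_simps)
    then have "cross2 (E j) (z - p j) = cross2 (E j) (z - v j)"
      by (simp add: cross2_simps)
    ultimately show "0 \<le> cross2 (E j) (z - p j)" by simp
  qed (use p_in[OF j] E_nz[OF j] in auto)
qed

lemma pair: assumes i: "i \<in> {1..m}"
  shows "support_pair D c \<rho> M \<delta> (x i) (\<tau> (x i)) (x (i + 1)) (\<tau> (x (i + 1)))"
proof
  have "x i \<in> A i" "x (i + 1) \<in> A i" using subdivision_endpoints[OF sub] i by blast+
  then show "norm (x (i + 1) - x i) \<le> \<delta>" using cut i by (simp add: fine_cut_def)
qed (use support x_frontier[OF i] inner outer rho delta in auto)

lemma meet: assumes i: "i \<in> {1..m}"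
  shows "lines_meet (x i) (\<tau> (x i)) (x (i + 1)) (\<tau> (x (i + 1))) (y i)"
  using cut i unfolding fine_cut_def by blast

lemma T_le: "i \<in> {1..m} \<Longrightarrow> T i \<le> (\<delta> * M / \<rho>)\<^sup>2"
  unfolding T_def by (rule support_pair.triangle_area_le[OF pair meet])

lemma arc:
  assumes i: "i \<in> {1..m}" and nz: "T i \<noteq> 0"
  obtains \<alpha> \<beta> where "0 < \<alpha>" "0 < \<beta>" "y i = x i + \<alpha> *\<^sub>R \<tau> (x i)"
      "x (i + 1) = y i + \<beta> *\<^sub>R \<tau> (x (i + 1))"
    "0 < cross2 (\<tau> (x i)) (\<tau> (x (i + 1)))" "T i = \<alpha> * \<beta> * cross2 (\<tau> (x i)) (\<tau> (x (i + 1))) / 2"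
proof -
  have "0 < cross2 (x i - c) (x (i + 1) - c)" using cut i unfolding fine_cut_def by blast
  from support_pair.meet_triangle_ccw[OF pair[OF i] meet[OF i] nz[unfolded T_def] this delta(2)]
  show thesis using that unfolding T_def by blast
qed

text \<open>A frontier point on the outer side of the chord lies in the triangle formed with the two
  tangents. Seen from \<open>c\<close> its direction is then between those of the endpoints, and the
  last clause of \<open>fine_cut\<close> puts it on the arc.\<close>

lemma below_chord_in_arc:
  assumes i: "i \<in> {1..m}" and nz: "T i \<noteq> 0" and z: "z \<in> frontier D"
    and le: "cross2 (x (i + 1) - x i) (z - x i) \<le> 0"
  shows "z \<in> A i"
proof -
  obtain \<alpha> \<beta> where ab: "0 < \<alpha>" "0 < \<beta>" "y i = x i + \<alpha> *\<^sub>R \<tau> (x i)"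
      "x (i + 1) = y i + \<beta> *\<^sub>R \<tau> (x (i + 1))"
    "0 < cross2 (\<tau> (x i)) (\<tau> (x (i + 1)))" by (rule arc[OF i nz])
  have sup: "left_support D (x i) (\<tau> (x i))" "left_support D (x (i + 1)) (\<tau> (x (i + 1)))"
    using support x_frontier[OF i] by blast+
  have ccw: "0 < cross2 (x i - c) (x (i + 1) - c)" using cut i unfolding fine_cut_def by blast
  have zz: "0 \<le> cross2 (\<tau> (x i)) (z - x i)" "0 \<le> cross2 (\<tau> (x (i + 1))) (z - x (i + 1))"
    using sup frontier_in[OF z] by (auto simp: left_support_def)
  note tb = triangle_between_rays[OF sup c_interior ab(3,4,1,2,5) ccw zz le]
  show ?thesis using cut i z tb unfolding fine_cut_def by blast
qed

lemma card_bad: "card bad \<le> 2 * \<kappa>"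
  using subdivision_card_containing_some[OF sub, of J] by (simp add: bad_def)

lemma good_not_below: "i \<in> good \<Longrightarrow> k \<in> J \<Longrightarrow> 0 < cross2 (x (i + 1) - x i) (p k - x i)"
  using below_chord_in_arc[of i "p k"] p_frontier[of k]
  by (force simp: good_def bad_def not_le [symmetric])

text \<open>Directions that a tangent takes on its way from side \<open>j\<close> to side
  \<open>N j\<close>.\<close>

definition in_cone :: "nat \<Rightarrow> real^2 \<Rightarrow> bool" where
  "in_cone j t \<longleftrightarrow> 0 \<le> cross2 (E j) t \<and> 0 \<le> cross2 t (E (N j))"

text \<open>If the direction of a side lies strictly between the two tangents, then its tangency point lies
  on the arc.\<close>

lemma good_cone:
  assumes i: "i \<in> good"
  shows "\<exists>j\<in>J. in_cone j (\<tau> (x i)) \<and> in_cone j (\<tau> (x (i + 1)))"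
proof -
  have im: "i \<in> {1..m}" and nz: "T i \<noteq> 0" using i by (auto simp: good_def)
  define t t' where "t = \<tau> (x i)" and "t' = \<tau> (x (i + 1))"
  obtain \<alpha> \<beta> where ab: "0 < \<alpha>" "0 < \<beta>" "y i = x i + \<alpha> *\<^sub>R t" "x (i + 1) = y i + \<beta> *\<^sub>R t'"
    "0 < cross2 t t'" unfolding t_def t'_def by (rule arc[OF im nz])
  define \<omega> where "\<omega> = cross2 t t'"
  have w: "0 < \<omega>" using ab by (simp add: \<omega>_def)
  have sup: "left_support D (x i) t" "left_support D (x (i + 1)) t'"
    using support x_frontier[OF im] by (simp_all add: t_def t'_def)
  then have "t \<noteq> 0" by (simp add: left_support_def)
  then obtain j where j: "j \<in> J" "0 \<le> cross2 (E j) t" "0 < cross2 t (E (N j))"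
    using direction_cone by blast
  define k where "k = N j"
  have k: "k \<in> J" using N_in[OF j(1)] by (simp add: k_def)
  \<comment> \<open>Otherwise \<open>E k\<close> is a combination of \<open>t\<close> and
    \<open>t'\<close> with positive coefficients \<open>e\<close> and \<open>f\<close>. It will
    follow that the tangency point \<open>p k\<close> lies on the outer side of the chord.\<close>
  have "0 \<le> cross2 t' (E k)"
  proof (rule ccontr)
    assume "\<not> ?thesis"
    then have "0 < cross2 (E k) t'" using cross2_commute[of t'] by simp
    define e f where "e = cross2 (E k) t' / \<omega>" and "f = cross2 t (E k) / \<omega>"
    have ef: "0 < e" "0 < f" using w j(3) \<open>0 < cross2 (E k) t'\<close> by (simp_all add: e_def f_def k_def)
    have Ek: "E k = e *\<^sub>R t + f *\<^sub>R t'"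
      using cross2_decompose[of t t' "E k"] w by (simp add: e_def f_def \<omega>_def)
    define q where "q = p k - x i"
    define \<xi> \<eta> where "\<xi> = cross2 q t' / \<omega>" and "\<eta> = cross2 t q / \<omega>"
    have q: "q = \<xi> *\<^sub>R t + \<eta> *\<^sub>R t'"
      using cross2_decompose[of t t' q] w by (simp add: \<xi>_def \<eta>_def \<omega>_def)
    have d: "x (i + 1) - x i = \<alpha> *\<^sub>R t + \<beta> *\<^sub>R t'" using ab by simp
    have tt: "cross2 t' t = - \<omega>" using cross2_commute[of t' t] by (simp add: \<omega>_def)
    have "0 \<le> cross2 t q" using sup(1) p_in[OF k] by (simp add: left_support_def q_def)
    then have eta: "0 \<le> \<eta>" using w by (simp add: \<eta>_def)
    have qd: "p k - x (i + 1) = (\<xi> - \<alpha>) *\<^sub>R t + (\<eta> - \<beta>) *\<^sub>R t'"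
      using q d by (simp add: q_def algebra_simps)
    have "0 \<le> cross2 t' (p k - x (i + 1))" using sup(2) p_in[OF k] by (simp add: left_support_def)
    also have "\<dots> = (\<alpha> - \<xi>) * \<omega>" unfolding qd by (simp add: cross2_simps tt algebra_simps)
    finally have xi: "\<xi> \<le> \<alpha>" using w by (simp add: zero_le_mult_iff)
    have side: "0 \<le> cross2 (E k) (z - p k)" if "z \<in> D" for z
    proof -
      have "0 \<le> cross2 (E k) (z - v k)" using left[OF k] DK that by (auto simp: E_def)
      moreover have "p k = v k + (1 - w k) *\<^sub>R E k" by (simp add: p_eq[OF k] E_def algebra_simps)
      then have "cross2 (E k) (z - p k) = cross2 (E k) (z - v k)" by (simp add: cross2_simps)
      ultimately show ?thesis by simp
    qed
    have "0 \<le> cross2 (E k) (x i - p k)" by (intro side frontier_in x_frontier im)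
    also have "x i - p k = - (\<xi> *\<^sub>R t + \<eta> *\<^sub>R t')" unfolding q [symmetric] by (simp add: q_def)
    also have "cross2 (E k) (- (\<xi> *\<^sub>R t + \<eta> *\<^sub>R t')) = (f * \<xi> - e * \<eta>) * \<omega>"
      unfolding Ek by (simp add: cross2_simps tt \<omega>_def [symmetric] algebra_simps)
    finally have 1: "e * \<eta> \<le> f * \<xi>" using w by (simp add: zero_le_mult_iff)
    have "0 \<le> cross2 (E k) (x (i + 1) - p k)" by (intro side frontier_in x_frontier im)
    also have "x (i + 1) - p k = - ((\<xi> - \<alpha>) *\<^sub>R t + (\<eta> - \<beta>) *\<^sub>R t')" unfolding qd [symmetric]
        by simp
    also have "cross2 (E k) (- ((\<xi> - \<alpha>) *\<^sub>R t + (\<eta> - \<beta>) *\<^sub>R t')) = (e * (\<beta> - \<eta>) - f * (\<alpha> - \<xi>)) * \<omega>"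
      unfolding Ek by (simp add: cross2_simps tt \<omega>_def [symmetric] algebra_simps)
    finally have 2: "f * (\<alpha> - \<xi>) \<le> e * (\<beta> - \<eta>)" using w by (simp add: zero_le_mult_iff)
    \<comment> \<open>Inequalities 1 and 2 say that both ends of the arc are on the left of side
      \<open>k\<close>. Multiplying them and cancelling \<open>e * f\<close> gives the position of
      \<open>p k\<close> relative to the chord.\<close>
    have "0 \<le> f * \<xi>" using 1 ef eta by (smt (verit) mult_nonneg_nonneg)
    then have "(e * \<eta>) * (f * (\<alpha> - \<xi>)) \<le> (f * \<xi>) * (e * (\<beta> - \<eta>))"
      using ef eta xi by (intro mult_mono[OF 1 2]) auto
    then have "(e * f) * (\<eta> * (\<alpha> - \<xi>)) \<le> (e * f) * (\<xi> * (\<beta> - \<eta>))" by (simp add: mult_ac)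
    then have "\<eta> * (\<alpha> - \<xi>) \<le> \<xi> * (\<beta> - \<eta>)" using ef by simp
    then have "\<alpha> * \<eta> - \<beta> * \<xi> \<le> 0" by (simp add: algebra_simps)
    then have "(\<alpha> * \<eta> - \<beta> * \<xi>) * \<omega> \<le> 0" using w by (simp add: mult_le_0_iff)
    moreover have "cross2 (x (i + 1) - x i) q = (\<alpha> * \<eta> - \<beta> * \<xi>) * \<omega>"
      unfolding d q by (simp add: cross2_simps tt \<omega>_def [symmetric] algebra_simps)
    ultimately show False using good_not_below[OF i k] by (simp add: q_def)
  qed
  \<comment> \<open>The direction \<open>t'\<close> arises from \<open>t\<close> by a turn to the
    left that does not pass \<open>E k\<close>, so its coordinate along \<open>E k\<close> is
    positive.\<close>
  moreover have "0 \<le> cross2 (E j) t'"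
  proof -
    define a b a' b' where "a = cross2 t (E k) / R j" and "b = cross2 (E j) t / R j"
      and "a' = cross2 t' (E k) / R j" and "b' = cross2 (E j) t' / R j"
    have R: "0 < R j" by (rule R_pos[OF j(1)])
    have tt: "t = a *\<^sub>R E j + b *\<^sub>R E k" "t' = a' *\<^sub>R E j + b' *\<^sub>R E k"
      unfolding a_def b_def a'_def b'_def k_def by (rule direction_coords[OF j(1)])+
    have "\<omega> = (a * b' - b * a') * R j"
      unfolding \<omega>_def tt using cross2_commute[of "E k" "E j"]
      by (simp add: cross2_simps R_def k_def [symmetric] algebra_simps)
    then have "b * a' < a * b'" using w R by (simp add: zero_less_mult_iff)
    moreover have "0 < a" "0 \<le> b" "0 \<le> a'"
      using R j \<open>0 \<le> cross2 t' (E k)\<close> by (simp_all add: a_def b_def a'_def k_def)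
    ultimately have "0 < b'" by (smt (verit) mult_nonneg_nonneg zero_less_mult_iff)
    then show ?thesis using R by (simp add: b'_def zero_less_divide_iff)
  qed
  ultimately show ?thesis using j unfolding in_cone_def t_def t'_def k_def
      by (intro bexI[of _ j]) auto
qed

end

section \<open>Affine coordinates at one corner\<close>

locale corner = ccw_polygon +
  fixes j :: nat and a b :: real
  assumes j: "j \<in> J" and a0: "0 < a" and b0: "0 < b"
begin

text \<open>Coordinates at the corner \<open>v (N j)\<close> in which the points at relative distance \<open>a\<close> and \<open>b\<close> on the two
  sides are \<open>(1, 0)\<close> and \<open>(0, 1)\<close>, and the parabola tangent to the sides there is
  \<open>((1 - u)\<^sup>2, u\<^sup>2)\<close>.\<close>

definition X :: "real^2 \<Rightarrow> real" where "X z = ca j z / a"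
definition Y :: "real^2 \<Rightarrow> real" where "Y z = cb j z / b"
text \<open>Position along the corner: \<open>-1/2\<close> at \<open>(1, 0)\<close>,
  \<open>1/2\<close> at \<open>(0, 1)\<close>, and \<open>u - 1/2\<close> at the point with
  parameter \<open>u\<close> of the parabola.\<close>

definition s :: "real^2 \<Rightarrow> real" where "s z = (Y z - X z) / 2"
text \<open>Components of a direction in these coordinates: along \<open>t\<close>, \<open>X\<close>
  decreases at the rate \<open>pt t\<close> and \<open>Y\<close> increases at the rate
  \<open>qt t\<close>. The sign makes both nonnegative on \<open>in_cone j\<close>.\<close>

definition pt :: "real^2 \<Rightarrow> real" where "pt t = cross2 t (E (N j)) / (R j * a)"
definition qt :: "real^2 \<Rightarrow> real" where "qt t = cross2 (E j) t / (R j * b)"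
definition nt :: "real^2 \<Rightarrow> real" where "nt t = pt t + qt t"

lemma R: "0 < R j" by (rule R_pos[OF j])

lemma X_nonneg: "z \<in> K \<Longrightarrow> 0 \<le> X z" and Y_nonneg: "z \<in> K \<Longrightarrow> 0 \<le> Y z"
  using ca_nonneg[OF j] cb_nonneg[OF j] a0 b0 by (simp_all add: X_def Y_def)

lemma X_add: "X (z + r *\<^sub>R t) = X z - r * pt t"
proof -
  have "ca j (z + r *\<^sub>R t) = ca j z - r * cross2 t (E (N j)) / R j"
    using cross2_commute[of "E (N j)" t] by (simp add: corner_coords_add[OF j] cross2_scaleR_right)
  then show ?thesis using a0 R by (simp add: X_def pt_def diff_divide_distrib)
qed

lemma Y_add: "Y (z + r *\<^sub>R t) = Y z + r * qt t"
proof -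
  have "cb j (z + r *\<^sub>R t) = cb j z + r * cross2 (E j) t / R j"
    by (simp add: corner_coords_add[OF j] cross2_scaleR_right)
  then show ?thesis using b0 R by (simp add: Y_def qt_def add_divide_distrib)
qed

lemma diff_coords: "z - z' = (b * (Y z - Y z')) *\<^sub>R E (N j) - (a * (X z - X z')) *\<^sub>R E j"
  using corner_coords_diff[OF j, of z z'] a0 b0 by (simp add: X_def Y_def right_diff_distrib)

lemma XY_eq: "X z = X z' \<Longrightarrow> Y z = Y z' \<Longrightarrow> z = z'"
  using diff_coords[of z z'] by simp

lemma cross_t: "cross2 t (z - z') = R j * a * b * (pt t * (Y z - Y z') + qt t * (X z - X z'))"
proof -
  have 1: "cross2 t (E (N j)) = pt t * (R j * a)" "cross2 t (E j) = - (qt t * (R j * b))"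
    using R a0 b0 cross2_commute[of t "E j"] by (simp_all add: pt_def qt_def)
  show ?thesis unfolding diff_coords[of z z'] cross2_diff_right cross2_scaleR_right 1
    by (simp add: algebra_simps)
qed

lemma cross_diff:
  "cross2 (z1 - z0) (z2 - z0) = R j * a * b * ((Y z1 - Y z0) * (X z2 - X z0) - (X z1 - X z0)
      * (Y z2 - Y z0))"
proof -
  have 1: "cross2 (E j) (E (N j)) = R j" "cross2 (E (N j)) (E j) = - R j"
    using cross2_commute[of "E (N j)" "E j"] by (simp_all add: R_def)
  show ?thesis
    unfolding diff_coords[of z1 z0] diff_coords[of z2 z0] cross2_diff_right cross2_diff_left
      cross2_scaleR_right cross2_scaleR_left cross2_self 1
    by (simp add: algebra_simps)
qed

end

text \<open>The positive scales \<open>a\<close> and \<open>b\<close> may exceed the relative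
  distances of the tangency points from the vertex. These distances can be 0, while the coordinates
  divide by the scales.\<close>

locale cut_corner = ccw_polygon_cut \<kappa> K v D w p c \<rho> M \<delta> \<tau> m x A y + corner \<kappa> K v j a b
  for \<kappa> K v D w p c \<rho> M \<delta> \<tau> m x A y j a b +
  assumes a1: "w j \<le> a" and b1: "1 - w (N j) \<le> b"
begin

lemmas a = a0 a1 and b = b0 b1

text \<open>The tangent direction normalized to \<open>[0, 1]\<close>, from parallel to side
  \<open>j\<close> to parallel to side \<open>N j\<close>. On the parabola it coincides with the
  parameter.\<close>

definition \<mu> :: "real^2 \<Rightarrow> real" where "\<mu> z = qt (\<tau> z) / nt (\<tau> z)"

abbreviation "class z \<equiv> z \<in> frontier D \<and> in_cone j (\<tau> z)"

lemma pqt_nonneg: "in_cone j t \<Longrightarrow> 0 \<le> pt t" "in_cone j t \<Longrightarrow> 0 \<le> qt t"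
  using R a b by (simp_all add: in_cone_def pt_def qt_def)

lemma nt_pos:
  assumes "in_cone j t" "t \<noteq> 0"
  shows "0 < nt t"
proof (rule ccontr)
  assume "\<not> 0 < nt t"
  then have "pt t = 0" "qt t = 0" using pqt_nonneg[OF assms(1)] by (auto simp: nt_def)
  then have "cross2 t (E (N j)) = 0" "cross2 (E j) t = 0" using R a b by (auto simp: pt_def qt_def)
  then show False using direction_coords[OF j, of t] assms(2) by simp
qed

lemma class_dir: assumes "class z" shows "0 < nt (\<tau> z)" "pt (\<tau> z) = nt (\<tau> z) * (1 - \<mu> z)"
    "qt (\<tau> z) = nt (\<tau> z) * \<mu> z"
  "0 \<le> \<mu> z" "\<mu> z \<le> 1"
proof -
  have "\<tau> z \<noteq> 0" using support[of z] assms by (auto simp: left_support_def)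
  then show n: "0 < nt (\<tau> z)" using nt_pos assms by blast
  then show q: "qt (\<tau> z) = nt (\<tau> z) * \<mu> z" by (simp add: \<mu>_def)
  then show "pt (\<tau> z) = nt (\<tau> z) * (1 - \<mu> z)" by (simp add: nt_def right_diff_distrib)
  show "0 \<le> \<mu> z" "\<mu> z \<le> 1"
    using n pqt_nonneg[of "\<tau> z"] assms by (simp_all add: \<mu>_def nt_def divide_le_eq_1)
qed

lemma class_support:
  assumes z: "class z" and z': "z' \<in> D"
  shows "0 \<le> (1 - \<mu> z) * (Y z' - Y z) + \<mu> z * (X z' - X z)"
proof -
  have "0 \<le> cross2 (\<tau> z) (z' - z)" using support(2)[of z] z z' by (auto simp: left_support_def)
  also have "\<dots> = (R j * a * b * nt (\<tau> z)) * ((1 - \<mu> z) * (Y z' - Y z) + \<mu> z * (X z' - X z))"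
    unfolding cross_t class_dir(2,3)[OF z] by (simp add: algebra_simps)
  finally show ?thesis
  proof (rule mult_left_le_imp_le[of "R j * a * b * nt (\<tau> z)" 0, unfolded mult_zero_right])
    show "0 < R j * a * b * nt (\<tau> z)" using R a(1) b(1) class_dir(1)[OF z] by simp
  qed
qed

text \<open>The sum of the support inequalities of each point tested at the other, as in the proof
  that the slope of a convex function is monotone.\<close>

lemma \<mu>_mono:
  assumes z: "class z" and z': "class z'" and less: "s z < s z'"
  shows "\<mu> z \<le> \<mu> z'"
proof -
  have "0 \<le> (1 - \<mu> z) * (Y z' - Y z) + \<mu> z * (X z' - X z)"
      "0 \<le> (1 - \<mu> z') * (Y z - Y z') + \<mu> z' * (X z - X z')"
    using class_support z z' frontier_in by blast+
  then have "0 \<le> (\<mu> z' - \<mu> z) * ((Y z' - X z') - (Y z - X z))" by (simp add: algebra_simps)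
  moreover have "0 < (Y z' - X z') - (Y z - X z)" using less by (simp add: s_def)
  ultimately show ?thesis by (simp add: zero_le_mult_iff)
qed

text \<open>With equal \<open>s\<close>, the coordinates \<open>X\<close> and \<open>Y\<close>
  change by the same amount between the points. Both support inequalities then reduce to the sign of
  this amount, in opposite senses.\<close>

lemma s_inj:
  assumes z: "class z" and z': "class z'" and eq: "s z = s z'"
  shows "z = z'"
proof -
  have Y: "Y z' - Y z = X z' - X z" using eq by (simp add: s_def)
  have "0 \<le> (1 - \<mu> z) * (Y z' - Y z) + \<mu> z * (X z' - X z)"
      "0 \<le> (1 - \<mu> z') * (Y z - Y z') + \<mu> z' * (X z - X z')"
    using class_support z z' frontier_in by blast+
  moreover have "Y z - Y z' = X z - X z'" using Y by simp
  ultimately have "0 \<le> X z' - X z" "0 \<le> X z - X z'" using Y by (simp_all add: algebra_simps)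
  then have "X z = X z'" by simp
  then show ?thesis using Y XY_eq by simp
qed

text \<open>Weighting the support inequalities for \<open>z1\<close> and \<open>z2\<close> with the
  distances of \<open>z\<close> in the coordinate \<open>s - const\<close> to the opposite ends
  eliminates \<open>\<mu> z\<close> and leaves the cross product.\<close>

lemma between_below_chord:
  assumes z: "class z" and z1: "z1 \<in> D" and z2: "z2 \<in> D" and s: "s z1 < s z" "s z < s z2"
  shows "cross2 (z2 - z1) (z - z1) \<le> 0"
proof -
  define a1 b1 a2 b2 where "a1 = X z2 - X z1" and "b1 = Y z2 - Y z1" and "a2 = X z - X z1" and
      "b2 = Y z - Y z1"
  have 1: "0 \<le> (1 - \<mu> z) * (- b2) + \<mu> z * (- a2)"
    using class_support[OF z z1] by (simp add: a2_def b2_def)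
  have 2: "0 \<le> (1 - \<mu> z) * (b1 - b2) + \<mu> z * (a1 - a2)"
    using class_support[OF z z2] by (simp add: a1_def b1_def a2_def b2_def)
  have s1: "0 < (b1 - a1) - (b2 - a2)" and s2: "0 < b2 - a2"
    using s by (simp_all add: s_def a1_def b1_def a2_def b2_def)
  have "0 \<le> ((b1 - a1) - (b2 - a2)) * ((1 - \<mu> z) * (- b2) + \<mu> z * (- a2)) +
      (b2 - a2) * ((1 - \<mu> z) * (b1 - b2) + \<mu> z * (a1 - a2))"
    using 1 2 s1 s2 by simp
  also have "\<dots> = a1 * b2 - b1 * a2" by (simp add: algebra_simps)
  finally have "b1 * a2 - a1 * b2 \<le> 0" by simp
  moreover have "cross2 (z2 - z1) (z - z1) = R j * a * b * (b1 * a2 - a1 * b2)"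
    by (simp add: cross_diff a1_def b1_def a2_def b2_def)
  ultimately show ?thesis using R a b by (simp add: mult_le_0_iff)
qed

lemma p_coords: "X (p j) \<le> 1" "Y (p j) = 0" "X (p (N j)) = 0" "Y (p (N j)) \<le> 1"
proof -
  have Nj: "N j \<in> J" using N_in[OF j] .
  have 1: "p j - v (N j) = - (w j *\<^sub>R E j)" using p_eq[OF j] by simp
  have 2: "p (N j) - v (N j) = (1 - w (N j)) *\<^sub>R E (N j)"
    using p_eq[OF Nj] by (simp add: E_def algebra_simps)
  have "ca j (p j) = w j" unfolding ca_def 1
    using R cross2_commute[of "E (N j)" "E j"] by (simp add: cross2_simps R_def [symmetric])
  then show "X (p j) \<le> 1" using a by (simp add: X_def)
  show "Y (p j) = 0" unfolding Y_def cb_def 1 by (simp add: cross2_simps)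
  have "cb j (p (N j)) = 1 - w (N j)" unfolding cb_def 2
    using R by (simp add: cross2_simps R_def [symmetric])
  then show "Y (p (N j)) \<le> 1" using b by (simp add: Y_def)
  show "X (p (N j)) = 0" unfolding X_def ca_def 2 by (simp add: cross2_simps)
qed

definition arcs :: "nat set" where
  "arcs = {i \<in> good. in_cone j (\<tau> (x i)) \<and> in_cone j (\<tau> (x (i + 1)))}"

text \<open>In corner coordinates the area is \<open>R j * a * b / 2\<close> times
  \<open>(\<alpha> * n) * (\<beta> * n')\<close> times the increment of \<mu>, and half the sum of
  \<open>\<alpha> * n\<close> and \<open>\<beta> * n'\<close> is the increment of \<open>s\<close>.
  The inequality of means gives the bound on \<open>T i\<close>. The range of \<open>s\<close> comes
  from the tangency points on the two sides.\<close>

lemma arcsD: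
  assumes i: "i \<in> arcs"
  shows "i \<in> {1..m}" "T i \<noteq> 0" "class (x i)" "class (x (i + 1))" "x i \<in> D" "x (i + 1) \<in> D"
    "s (x i) < s (x (i + 1))" "\<mu> (x i) < \<mu> (x (i + 1))"
    "T i \<le> (R j * a * b / 2) * ((s (x (i + 1)) - s (x i))\<^sup>2 * (\<mu> (x (i + 1)) - \<mu> (x i)))"
    "- 1 / 2 \<le> s (x i)" "s (x (i + 1)) \<le> 1 / 2"
proof -
  have g: "i \<in> good" using i by (simp add: arcs_def)
  show im: "i \<in> {1..m}" and nz: "T i \<noteq> 0" using g by (auto simp: good_def)
  show cl: "class (x i)" "class (x (i + 1))" using i x_frontier[OF im] by (auto simp: arcs_def)
  show D: "x i \<in> D" "x (i + 1) \<in> D" using frontier_in x_frontier[OF im] by blast+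
  define t t' where "t = \<tau> (x i)" and "t' = \<tau> (x (i + 1))"
  obtain \<alpha> \<beta> where ab: "0 < \<alpha>" "0 < \<beta>" "y i = x i + \<alpha> *\<^sub>R t" "x (i + 1) = y i + \<beta> *\<^sub>R t'"
    "0 < cross2 t t'" "T i = \<alpha> * \<beta> * cross2 t t' / 2" unfolding t_def t'_def by (rule arc[OF im nz])
  define n n' where "n = nt t" and "n' = nt t'"
  define m m' where "m = \<mu> (x i)" and "m' = \<mu> (x (i + 1))"
  have n: "0 < n" "0 < n'" using class_dir(1) cl by (simp_all add: n_def n'_def t_def t'_def)
  have pq: "pt t = n * (1 - m)" "qt t = n * m" "pt t' = n' * (1 - m')" "qt t' = n' * m'"
    using class_dir(2,3) cl by (simp_all add: n_def n'_def t_def t'_def m_def m'_def)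
  have xi: "x (i + 1) = (x i + \<alpha> *\<^sub>R t) + \<beta> *\<^sub>R t'" using ab by simp
  have X': "X (x (i + 1)) = X (x i) - \<alpha> * pt t - \<beta> * pt t'" unfolding xi X_add by simp
  have Y': "Y (x (i + 1)) = Y (x i) + \<alpha> * qt t + \<beta> * qt t'" unfolding xi Y_add by simp
  have ds: "s (x (i + 1)) - s (x i) = (\<alpha> * n + \<beta> * n') / 2"
    unfolding s_def X' Y' pq by (simp add: field_simps)
  then show "s (x i) < s (x (i + 1))" using ab(1,2) n by (smt (verit) mult_pos_pos divide_pos_pos)
  have om: "cross2 t t' = R j * a * b * (n * n' * (m' - m))"
  proof -
    have "cross2 t t' = cross2 t ((x i + 1 *\<^sub>R t') - x i)" by simp
    also have "\<dots> = R j * a * b * (pt t * qt t' - qt t * pt t')"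
      unfolding cross_t X_add Y_add by (simp add: algebra_simps)
    also have "\<dots> = R j * a * b * (n * n' * (m' - m))" unfolding pq by (simp add: algebra_simps)
    finally show ?thesis .
  qed
  then have "0 < (R j * a * b * (n * n')) * (m' - m)" using ab(5) by (simp add: mult_ac)
  moreover have "0 < R j * a * b * (n * n')" using R a(1) b(1) n by simp
  ultimately have "0 < m' - m" by (rule zero_less_mult_pos)
  then show mm: "\<mu> (x i) < \<mu> (x (i + 1))" by (simp add: m_def m'_def)
  have "T i = (R j * a * b / 2) * (((\<alpha> * n) * (\<beta> * n')) * (m' - m))" unfolding ab(6) om by simp
  also have "(\<alpha> * n) * (\<beta> * n') \<le> ((\<alpha> * n + \<beta> * n') / 2)\<^sup>2"
    using zero_le_power2[of "\<alpha> * n - \<beta> * n'"] by (simp add: power2_eq_square algebra_simps)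
  then have "(R j * a * b / 2) * (((\<alpha> * n) * (\<beta> * n')) * (m' - m)) \<le>
      (R j * a * b / 2) * (((\<alpha> * n + \<beta> * n') / 2)\<^sup>2 * (m' - m))"
    using \<open>0 < m' - m\<close> R a b by (intro mult_left_mono mult_right_mono) auto
  finally show "T i \<le> (R j * a * b / 2) * ((s (x (i + 1)) - s (x i))\<^sup>2 * (\<mu> (x (i + 1)) - \<mu> (x i)))"
    unfolding ds m_def m'_def .
  have m01: "0 \<le> m" "m' \<le> 1" using class_dir(4,5) cl by (simp_all add: m_def m'_def)
  have d: "x (i + 1) - x i = \<alpha> *\<^sub>R t + \<beta> *\<^sub>R t'" using ab by simp
  \<comment> \<open>The support inequality at \<open>x i\<close> is tested at \<open>p j\<close>,
    whose \<open>X\<close> is at most 1. It controls \<open>X\<close> only if the tangent is not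
    parallel to side \<open>j\<close>.\<close>
  have "X (x i) \<le> 1"
  proof (cases "m = 0")
    case False
    have "0 \<le> (1 - m) * (Y (p j) - Y (x i)) + m * (X (p j) - X (x i))"
      unfolding m_def by (rule class_support[OF cl(1) p_in[OF j]])
    moreover have "0 \<le> (1 - m) * Y (x i)" using \<open>0 < m' - m\<close> m01 Y_nonneg[OF subsetD[OF DK D(1)]]
        by simp
    ultimately have "0 \<le> m * (X (p j) - X (x i))" using p_coords(2) by (simp add: algebra_simps)
    then show ?thesis using False m01 p_coords(1) by (simp add: zero_le_mult_iff)
  next
    \<comment> \<open>Here \<open>x i\<close> is on side \<open>j\<close> itself. If it were before
      \<open>p j\<close>, the tangent at \<open>x i\<close> would run through \<open>p j\<close>,
      which would then be on the outer side of the chord.\<close>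
    case True
    show ?thesis
    proof (rule ccontr)
      assume big: "\<not> X (x i) \<le> 1"
      have "0 \<le> Y (p j) - Y (x i)" using class_support[OF cl(1) p_in[OF j]] True
          by (simp add: m_def)
      then have y0: "Y (x i) = 0" using Y_nonneg[OF subsetD[OF DK D(1)]] p_coords(2) by simp
      have pt: "pt t = n" "qt t = 0" using pq True by simp_all
      define r where "r = (X (x i) - X (p j)) / n"
      have r: "0 \<le> r" using big p_coords(1) n by (simp add: r_def)
      have "p j = x i + r *\<^sub>R t"
        by (rule XY_eq) (use pt y0 p_coords(2) n in \<open>simp_all add: X_add Y_add r_def\<close>)
      then have "cross2 (x (i + 1) - x i) (p j - x i) = - (r * \<beta> * cross2 t t')"
        unfolding d using cross2_commute[of t' t] by (simp add: cross2_simps)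
      moreover have "0 \<le> r * \<beta> * cross2 t t'" using r ab by simp
      ultimately show False using good_not_below[OF g j] by linarith
    qed
  qed
  then show "- 1 / 2 \<le> s (x i)" using Y_nonneg[OF subsetD[OF DK D(1)]] by (simp add: s_def)
  have "Y (x (i + 1)) \<le> 1"
  proof (cases "m' = 1")
    case False
    have "0 \<le> (1 - m') * (Y (p (N j)) - Y (x (i + 1))) + m' * (X (p (N j)) - X (x (i + 1)))"
      unfolding m'_def by (rule class_support[OF cl(2) p_in[OF N_in[OF j]]])
    moreover have "0 \<le> m' * X (x (i + 1))" using \<open>0 < m'
        - m\<close> m01 X_nonneg[OF subsetD[OF DK D(2)]] by simp
    ultimately have "0 \<le> (1 - m') * (Y (p (N j)) - Y (x (i + 1)))" using p_coords(3)
        by (simp add: algebra_simps)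
    then show ?thesis using False m01 p_coords(4) by (simp add: zero_le_mult_iff)
  next
    case True
    show ?thesis
    proof (rule ccontr)
      assume big: "\<not> Y (x (i + 1)) \<le> 1"
      have "0 \<le> X (p (N j)) - X (x (i + 1))"
        using class_support[OF cl(2) p_in[OF N_in[OF j]]] True by (simp add: m'_def)
      then have x0: "X (x (i + 1)) = 0" using X_nonneg[OF subsetD[OF DK D(2)]] p_coords(3) by simp
      have pt: "qt t' = n'" "pt t' = 0" using pq True by simp_all
      define r where "r = (Y (x (i + 1)) - Y (p (N j))) / n'"
      have r: "0 \<le> r" using big p_coords(4) n by (simp add: r_def)
      have "p (N j) = x (i + 1) + (- r) *\<^sub>R t'"
        by (rule XY_eq; unfold X_add Y_add) (use pt x0 p_coords(3) n in \<open>simp_all add: r_def\<close>)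
      then have e: "p (N j) - x i = (x (i + 1) - x i) - r *\<^sub>R t'" by simp
      have "cross2 (x (i + 1) - x i) (p (N j) - x i) = - (r * \<alpha> * cross2 t t')"
        unfolding e unfolding d using cross2_commute[of t' t] by (simp add: cross2_simps)
      moreover have "0 \<le> r * \<alpha> * cross2 t t'" using r ab by simp
      ultimately show False using good_not_below[OF g N_in[OF j]] by linarith
    qed
  qed
  then show "s (x (i + 1)) \<le> 1 / 2" using X_nonneg[OF subsetD[OF DK D(2)]] by (simp add: s_def)
qed

text \<open>A point of the class strictly between the ends lies on the outer side of the chord,
  hence on the arc \<open>A i\<close>; a subdivision point on \<open>A i\<close> is one of its
  ends.\<close>

lemma not_between:
  assumes i: "i \<in> arcs" and k: "k \<in> arcs"
  shows "\<not> (s (x i) < s (x k) \<and> s (x k) < s (x (i + 1)))"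
proof
  assume s: "s (x i) < s (x k) \<and> s (x k) < s (x (i + 1))"
  have "cross2 (x (i + 1) - x i) (x k - x i) \<le> 0"
    using between_below_chord[of "x k" "x i" "x (i + 1)"] arcsD[OF i] arcsD[OF k] s by blast
  then have "x k \<in> A i"
    using arcsD[OF i] arcsD[OF k] by (intro below_chord_in_arc) auto
  then have "x k = x i \<or> x k = x (i + 1)"
    using subdivision_points(1)[OF sub arcsD(1)[OF k] arcsD(1)[OF i]] by blast
  then show False using s by auto
qed

lemma arcs_disjoint:
  assumes i: "i \<in> arcs" and k: "k \<in> arcs" and ik: "i \<noteq> k"
  shows "s (x (i + 1)) \<le> s (x k) \<and> \<mu> (x (i + 1)) \<le> \<mu> (x k) \<or>
    s (x (k + 1)) \<le> s (x i) \<and> \<mu> (x (k + 1)) \<le> \<mu> (x i)"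
proof -
  have mu: "\<mu> z \<le> \<mu> z'" if "class z" "class z'" "s z \<le> s z'" for z z'
    using \<mu>_mono[of z z'] s_inj[of z z'] that by (cases "s z = s z'") auto
  have "x i \<noteq> x k" using subdivision_inj[OF sub arcsD(1)[OF i] arcsD(1)[OF k]] ik by blast
  then have "s (x i) \<noteq> s (x k)" using s_inj arcsD(3) i k by blast
  then have "s (x (i + 1)) \<le> s (x k) \<or> s (x (k + 1)) \<le> s (x i)"
    using not_between[OF i k] not_between[OF k i] by linarith
  then show ?thesis using mu arcsD(3,4) i k by blast
qed

text \<open>\<open>s\<close> and \<open>\<mu>\<close> (position and normalized slope) both increase along the arc, each by at most \<open>1\<close>;
  by the inequality of means the cube root of \<open>T i\<close> is dominated by their increments, which add up.\<close>

lemma sum_arcs_le: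
  assumes G: "G \<subseteq> arcs"
  shows "(\<Sum>i\<in>G. root 3 (T i)) \<le> root 3 (R j * a * b / 2)"
proof -
  have fin: "finite G" using G arcsD(1) by (meson finite_atLeastAtMost finite_subset subsetI
      subsetD)
  have "root 3 (T i) \<le> root 3 (R j * a * b / 2) *
      ((2 * (s (x (i + 1)) - s (x i)) + (\<mu> (x (i + 1)) - \<mu> (x i))) / 3)" if "i \<in> G" for i
  proof -
    have i: "i \<in> arcs" using that G by blast
    have "root 3 (T i) \<le> root 3 ((R j * a * b / 2) * ((s (x (i + 1)) - s (x i))\<^sup>2 * (\<mu> (x (i
        + 1)) - \<mu> (x i))))"
      using arcsD(9)[OF i] by simp
    also have "\<dots> = root 3 (R j * a * b / 2) * root 3 ((s (x (i + 1)) - s (x i))\<^sup>2 * (\<mu> (x (i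
        + 1)) - \<mu> (x i)))"
      by (rule real_root_mult)
    also have "\<dots> \<le> root 3 (R j * a * b / 2) * ((2 * (s (x (i + 1)) - s (x i)) + (\<mu> (x (i + 1))
        - \<mu> (x i))) / 3)"
      using R a b arcsD(7,8)[OF i] by (intro mult_left_mono root3_mult_square_le) auto
    finally show ?thesis .
  qed
  then have "(\<Sum>i\<in>G. root 3 (T i)) \<le> (\<Sum>i\<in>G. root 3 (R j * a * b / 2) *
      ((2 * (s (x (i + 1)) - s (x i)) + (\<mu> (x (i + 1)) - \<mu> (x i))) / 3))" by (rule sum_mono)
  also have "\<dots> = root 3 (R j * a * b / 2) *
      ((2 * (\<Sum>i\<in>G. s (x (i + 1)) - s (x i)) + (\<Sum>i\<in>G. \<mu> (x (i + 1)) - \<mu> (x i))) / 3)"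
    by (simp only: sum_distrib_left [symmetric] sum_divide_distrib [symmetric] sum.distrib)
  also have "\<dots> \<le> root 3 (R j * a * b / 2) * 1"
  proof (rule mult_left_mono)
    have weighted: "(2 * u + u') / 3 \<le> 1" if "u \<le> 1 / 2 - (- 1 / 2)" "u' \<le> 1 - 0" for u u' :: real
      using that by simp
    have "(\<Sum>i\<in>G. s (x (i + 1)) - s (x i)) \<le> 1 / 2 - (- 1 / 2)"
    proof (rule sum_interval_lengths_le[OF fin])
      show "- 1 / 2 \<le> s (x i) \<and> s (x i) < s (x (i + 1)) \<and> s (x (i + 1)) \<le> 1 / 2" if "i \<in> G" for i
        using arcsD(7,10,11)[of i] that G by blast
      show "s (x (i + 1)) \<le> s (x k) \<or> s (x (k + 1)) \<le> s (x i)" if "i \<in> G" "k \<in> G" "i \<noteq> k" for i k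
        using arcs_disjoint[of i k] that G by blast
    qed simp
    moreover have "(\<Sum>i\<in>G. \<mu> (x (i + 1)) - \<mu> (x i)) \<le> 1 - 0"
    proof (rule sum_interval_lengths_le[OF fin])
      show "0 \<le> \<mu> (x i) \<and> \<mu> (x i) < \<mu> (x (i + 1)) \<and> \<mu> (x (i + 1)) \<le> 1" if "i \<in> G" for i
        using arcsD(3,4,8)[of i] class_dir(4,5) that G by blast
      show "\<mu> (x (i + 1)) \<le> \<mu> (x k) \<or> \<mu> (x (k + 1)) \<le> \<mu> (x i)" if "i \<in> G" "k \<in> G" "i \<noteq> k" for i k
        using arcs_disjoint[of i k] that G by blast
    qed simp
    ultimately show "(2 * (\<Sum>i\<in>G. s (x (i + 1)) - s (x i)) + (\<Sum>i\<in>G. \<mu> (x (i + 1)) - \<mu> (x i))) / 3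
        \<le> 1"
      by (rule weighted)
  qed (use R a b in simp)
  finally show ?thesis by simp
qed

end

section \<open>Summation over the corners and passage to the limit\<close>

context ccw_polygon_cut
begin

text \<open>Each good arc is charged to a single corner, since cones share boundary directions. The
  bad arcs go into the error term, and the remaining triangles have area 0.\<close>

lemma area_sum_le:
  assumes ab: "\<And>j. j \<in> J \<Longrightarrow> 0 < a j \<and> w j \<le> a j" "\<And>j. j \<in> J \<Longrightarrow> 0 < b j \<and> 1 - w (N j) \<le> b j"
  shows "area_sum m x y \<le> 2 * (\<Sum>j\<in>J. root 3 (R j * a j * b j / 2)) + 4 * real \<kappa> * root 3 ((\<delta>
      * M / \<rho>)\<^sup>2)"
proof -
  obtain f where f: "\<And>i. i \<in> good \<Longrightarrow> f i \<in> J \<and> in_cone (f i) (\<tau> (x i))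
      \<and> in_cone (f i) (\<tau> (x (i + 1)))"
    using good_cone by metis
  have fin: "finite good" "finite bad" by (auto simp: good_def bad_def)
  have "(\<Sum>i\<in>good. root 3 (T i)) = (\<Sum>j\<in>J. \<Sum>i\<in>{i \<in> good. f i = j}. root 3 (T i))"
    by (rule sum.group[symmetric]) (use fin f in auto)
  also have "\<dots> \<le> (\<Sum>j\<in>J. root 3 (R j * a j * b j / 2))"
  proof (rule sum_mono)
    fix j assume j: "j \<in> J"
    interpret cut_corner \<kappa> K v D w p c \<rho> M \<delta> \<tau> m x A y j "a j" "b j"
      by unfold_locales (use j ab in auto)
    show "(\<Sum>i\<in>{i \<in> good. f i = j}. root 3 (T i)) \<le> root 3 (R j * a j * b j / 2)"
      by (rule sum_arcs_le) (use f in \<open>auto simp: arcs_def\<close>)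
  qed
  finally have 1: "(\<Sum>i\<in>good. root 3 (T i)) \<le> (\<Sum>j\<in>J. root 3 (R j * a j * b j / 2))" .
  have "(\<Sum>i\<in>bad. root 3 (T i)) \<le> (\<Sum>i\<in>bad. root 3 ((\<delta> * M / \<rho>)\<^sup>2))"
    by (intro sum_mono) (auto simp: bad_def intro: T_le)
  also have "\<dots> = real (card bad) * root 3 ((\<delta> * M / \<rho>)\<^sup>2)" by simp
  also have "\<dots> \<le> real (2 * \<kappa>) * root 3 ((\<delta> * M / \<rho>)\<^sup>2)"
    using card_bad by (intro mult_right_mono) (simp_all only: of_nat_le_iff, simp)
  finally have 2: "(\<Sum>i\<in>bad. root 3 (T i)) \<le> 2 * real \<kappa> * root 3 ((\<delta> * M / \<rho>)\<^sup>2)" by simp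
  have "(\<Sum>i = 1..m. root 3 (T i)) = (\<Sum>i\<in>good \<union> bad. root 3 (T i))"
    by (rule sum.mono_neutral_right) (auto simp: good_def bad_def)
  also have "\<dots> = (\<Sum>i\<in>good. root 3 (T i)) + (\<Sum>i\<in>bad. root 3 (T i))"
    by (rule sum.union_disjoint) (use fin in \<open>auto simp: good_def\<close>)
  finally have "(\<Sum>i = 1..m. root 3 (T i)) = (\<Sum>i\<in>good. root 3 (T i)) + (\<Sum>i\<in>bad. root 3 (T i))" .
  then show ?thesis using 1 2 unfolding area_sum_def T_def by simp
qed

end

context ccw_polygon
begin

theorem affine_perimeter_le_strict:
  assumes D: "convex_body D" and DK: "D \<subseteq> K" and AP: "has_affine_perimeter D l"
    and p: "\<And>j. j \<in> J \<Longrightarrow> p j \<in> D" "\<And>j. j \<in> J \<Longrightarrow> p j = v (N j) - w j *\<^sub>R E j"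
    and ab: "\<And>j. j \<in> J \<Longrightarrow> 0 < a j \<and> w j \<le> a j" "\<And>j. j \<in> J \<Longrightarrow> 0 < b j \<and> 1 - w (N j) \<le> b j"
  shows "l \<le> 2 * (\<Sum>j\<in>J. root 3 (R j * a j * b j / 2))"
proof -
  obtain c \<rho> M where 1: "cball c \<rho> \<subseteq> D" "0 < \<rho>" "D \<subseteq> cball c M"
    using convex_body_balls[OF D] by metis
  obtain \<tau> where 2: "support_choice D \<tau>" using support_choice_exists[OF D] by blast
  show ?thesis
  proof (rule has_affine_perimeter_le[OF D AP 1 2])
    fix \<delta> m x A y assume *: "0 < \<delta>" "\<delta> < \<rho>" "fine_cut D c \<tau> \<delta> m x A y"
    interpret ccw_polygon_cut \<kappa> K v D w p c \<rho> M \<delta> \<tau> m x A y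
      by unfold_locales (use D DK p 1 2 * in auto)
    show "area_sum m x y \<le> 2 * (\<Sum>j\<in>J. root 3 (R j * a j * b j / 2)) + 4 * real \<kappa> * root 3 ((\<delta>
        * M / \<rho>)\<^sup>2)"
      by (rule area_sum_le[OF ab])
  next
    have "((\<lambda>\<delta>. 4 * real \<kappa> * root 3 ((\<delta> * M / \<rho>)\<^sup>2)) \<longlongrightarrow> 4 * real \<kappa> * root 3 ((0
        * M / \<rho>)\<^sup>2)) (at_right 0)"
      using 1(2) by (intro tendsto_intros) auto
    then show "((\<lambda>\<delta>. 4 * real \<kappa> * root 3 ((\<delta> * M / \<rho>)\<^sup>2)) \<longlongrightarrow> 0) (at_right 0)" by simp
  qed
qed

text \<open>The scales \<open>w j + e\<close> and \<open>1 - w (N j) + e\<close> are positive even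
  if a tangency point is a vertex; the bound follows for \<open>e\<close> tending to 0.\<close>

theorem affine_perimeter_le:
  assumes D: "convex_body D" and DK: "D \<subseteq> K" and AP: "has_affine_perimeter D l"
    and p: "\<And>j. j \<in> J \<Longrightarrow> p j \<in> D" "\<And>j. j \<in> J \<Longrightarrow> p j = v (N j) - w j *\<^sub>R E j"
    and w: "\<And>j. j \<in> J \<Longrightarrow> 0 \<le> w j \<and> w j \<le> 1"
  shows "l \<le> 2 * (\<Sum>j\<in>J. root 3 (R j * w j * (1 - w (N j)) / 2))"
proof (rule tendsto_lowerbound)
  show "((\<lambda>e. 2 * (\<Sum>j\<in>J. root 3 (R j * (w j + e) * (1 - w (N j) + e) / 2))) \<longlongrightarrow>
      2 * (\<Sum>j\<in>J. root 3 (R j * w j * (1 - w (N j)) / 2))) (at_right 0)"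
  proof -
    have "((\<lambda>e. 2 * (\<Sum>j\<in>J. root 3 (R j * (w j + e) * (1 - w (N j) + e) / 2))) \<longlongrightarrow>
      2 * (\<Sum>j\<in>J. root 3 (R j * (w j + 0) * (1 - w (N j) + 0) / 2))) (at_right 0)"
      by (intro tendsto_intros) auto
    then show ?thesis by simp
  qed
  show "\<forall>\<^sub>F e in at_right 0. l \<le> 2 * (\<Sum>j\<in>J. root 3 (R j * (w j + e) * (1 - w (N j) + e) / 2))"
  proof (rule eventually_mono[OF eventually_at_right_less])
    fix e :: real assume "0 < e"
    then show "l \<le> 2 * (\<Sum>j\<in>J. root 3 (R j * (w j + e) * (1 - w (N j) + e) / 2))"
      using w N_in by (intro affine_perimeter_le_strict[OF D DK AP p]) (auto intro: add_nonneg_pos)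
  qed
qed simp

end

subsection \<open>The body bounded by parabola arcs\<close>

context corner
begin

definition curve :: "real \<Rightarrow> real^2" where
  "curve u = v (N j) + ((u\<^sup>2 * b) *\<^sub>R E (N j) - ((1 - u)\<^sup>2 * a) *\<^sub>R E j)"
text \<open>\<open>Y - X\<close> equals \<open>2 * u - 1\<close> on the parabola, so this affine
  function recovers the parameter while being defined on the whole plane.\<close>

definition par :: "real^2 \<Rightarrow> real" where "par z = (1 + Y z - X z) / 2"
text \<open>The zero set is the tangent of the parabola at \<open>curve u\<close>, and the values
  are nonnegative on the side of the parabola.\<close>

definition tang :: "real \<Rightarrow> real^2 \<Rightarrow> real" where "tang u z = u * X z + (1 - u) * Y z - u * (1 - u)"
definition tdir :: "real \<Rightarrow> real^2" where "tdir u = ((1 - u) * a) *\<^sub>R E j + (u * b) *\<^sub>R E (N j)"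

lemma cross_E: "cross2 (E j) (E (N j)) = R j" "cross2 (E (N j)) (E j) = - R j"
  using cross2_commute[of "E (N j)" "E j"] by (simp_all add: R_def)

lemma X_curve: "X (curve u) = (1 - u)\<^sup>2" and Y_curve: "Y (curve u) = u\<^sup>2"
  using R a0 b0 by (simp_all add: X_def Y_def ca_def cb_def curve_def cross2_diff_right
      cross2_scaleR_right cross_E cross2_self)

lemma par_curve: "par (curve u) = u"
  by (simp add: par_def X_curve Y_curve power2_eq_square algebra_simps)

lemma tang_curve: "tang u (curve u') = (u - u')\<^sup>2"
  by (simp add: tang_def X_curve Y_curve power2_eq_square algebra_simps)

lemma tdir_coords: "pt (tdir u) = 1 - u" "qt (tdir u) = u"
  using R a0 b0 by (simp_all add: pt_def qt_def tdir_def cross2_add_left cross2_add_right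
      cross2_scaleR_right cross2_scaleR_left cross_E cross2_self)

lemma cross_direction_tang:
  assumes "pt t = n * (1 - u)" "qt t = n * u"
  shows "cross2 t (z - curve u) = (R j * a * b * n) * tang u z"
  unfolding cross_t assms X_curve Y_curve tang_def by (simp add: power2_eq_square algebra_simps)

lemma pq_zero: "pt t = 0 \<Longrightarrow> qt t = 0 \<Longrightarrow> t = 0"
  using direction_coords[OF j, of t] R a0 b0 by (simp add: pt_def qt_def)

lemma curve_eqI: "X z = (1 - u)\<^sup>2 \<Longrightarrow> Y z = u\<^sup>2 \<Longrightarrow> z = curve u"
  by (rule XY_eq) (simp_all add: X_curve Y_curve)

lemma XY_convex_combination:
  "X ((1 - r) *\<^sub>R z + r *\<^sub>R z') = (1 - r) * X z + r * X z'"
  "Y ((1 - r) *\<^sub>R z + r *\<^sub>R z') = (1 - r) * Y z + r * Y z'"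
proof -
  have *: "((1 - r) *\<^sub>R z + r *\<^sub>R z') - q = (1 - r) *\<^sub>R (z - q) + r *\<^sub>R (z' - q)" for q
    by (simp add: algebra_simps)
  show "X ((1 - r) *\<^sub>R z + r *\<^sub>R z') = (1 - r) * X z + r * X z'"
    "Y ((1 - r) *\<^sub>R z + r *\<^sub>R z') = (1 - r) * Y z + r * Y z'"
    unfolding X_def Y_def ca_def cb_def * cross2_add_right cross2_scaleR_right
    by (simp_all add: add_divide_distrib)
qed

lemma continuous_XY: "continuous_on A X" "continuous_on A Y"
  unfolding X_def Y_def ca_def cb_def using R a0 b0 by (intro continuous_intros; simp)+

lemma continuous_tang: "continuous_on A (tang u)"
  unfolding tang_def by (intro continuous_intros continuous_XY)

lemma continuous_par: "continuous_on A par"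
  unfolding par_def by (intro continuous_intros continuous_XY) simp

lemma continuous_curve: "continuous_on A curve"
  unfolding curve_def by (intro continuous_intros)

definition lip :: real where "lip = norm (E j) / (R j * b) + norm (E (N j)) / (R j * a)"

lemma lip_nonneg: "0 \<le> lip"
  using R a0 b0 by (simp add: lip_def)

lemma par_lipschitz: "\<bar>par z - par z'\<bar> \<le> lip * norm (z - z')"
proof -
  have Y: "Y z - Y z' = cross2 (E j) (z - z') / (R j * b)"
    by (simp add: Y_def cb_def cross2_diff_right diff_divide_distrib)
  have X: "X z - X z' = cross2 (E (N j)) (z - z') / (R j * a)"
    by (simp add: X_def ca_def cross2_diff_right diff_divide_distrib)
  have "\<bar>Y z - Y z'\<bar> \<le> norm (E j) * norm (z - z') / (R j * b)"
    unfolding Y abs_divide using abs_cross2_le[of "E j"] R b0 by (simp add: divide_right_mono)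
  moreover have "\<bar>X z - X z'\<bar> \<le> norm (E (N j)) * norm (z - z') / (R j * a)"
    unfolding X abs_divide using abs_cross2_le[of "E (N j)"] R a0 by (simp add: divide_right_mono)
  moreover have "lip * norm (z - z') = norm (E j) * norm (z - z') / (R j * b) + norm (E (N j))
      * norm (z - z') / (R j * a)"
    by (simp add: lip_def distrib_right)
  moreover have "\<bar>par z - par z'\<bar> \<le> \<bar>Y z - Y z'\<bar> + \<bar>X z - X z'\<bar>"
  proof -
    have "par z - par z' = ((Y z - Y z') - (X z - X z')) / 2" by (simp add: par_def field_simps)
    then have "\<bar>par z - par z'\<bar> = \<bar>(Y z - Y z') - (X z - X z')\<bar> / 2"
      by (simp only: abs_divide abs_numeral)
    also have "\<dots> \<le> \<bar>(Y z - Y z') - (X z - X z')\<bar>" by simp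
    also have "\<dots> \<le> \<bar>Y z - Y z'\<bar> + \<bar>X z - X z'\<bar>" by (rule abs_triangle_ineq4)
    finally show ?thesis .
  qed
  ultimately show ?thesis by linarith
qed

text \<open>The hypothesis says that \<open>u\<close> minimizes a quadratic function with
  coefficients \<open>pt t\<close> and \<open>qt t\<close>. The minimum is at an inner parameter, so
  the derivative vanishes and fixes their ratio: the tangent is unique there.\<close>

lemma curve_support_direction:
  assumes u: "0 < u" "u < 1" and t: "\<And>u'. 0 \<le> u' \<Longrightarrow> u' \<le> 1 \<Longrightarrow> 0 \<le> cross2 t (curve u' - curve u)"
  shows "\<exists>n. pt t = n * (1 - u) \<and> qt t = n * u"
proof -
  define f where "f u' = pt t * u'\<^sup>2 + qt t * (1 - u')\<^sup>2" for u'
  have ge: "f u \<le> f u'" if "0 \<le> u'" "u' \<le> 1" for u'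
  proof -
    have "0 \<le> (R j * a * b) * (f u' - f u)"
      using t[OF that] unfolding cross_t X_curve Y_curve f_def by (simp add: algebra_simps)
    moreover have "0 < R j * a * b" using R a0 b0 by simp
    ultimately have "0 \<le> f u' - f u" by (metis zero_le_mult_iff not_less)
    then show ?thesis by simp
  qed
  have "(f has_real_derivative (2 * pt t * u - 2 * qt t * (1 - u))) (at u)"
    unfolding f_def by (auto intro!: derivative_eq_intros simp: power2_eq_square algebra_simps)
  then have "2 * pt t * u - 2 * qt t * (1 - u) = 0"
  proof (rule DERIV_local_min)
    show "0 < min u (1 - u)" using u by simp
    show "\<forall>u'. \<bar>u - u'\<bar> < min u (1 - u) \<longrightarrow> f u \<le> f u'" using ge by auto
  qed
  then have "pt t * u = qt t * (1 - u)" by simp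
  then show ?thesis using u
    by (intro exI[of _ "qt t / u"]) (simp add: field_simps)
qed

text \<open>The tangents meet at the point with coordinates \<open>(1 - u1) * (1 - u2)\<close> and
  \<open>u1 * u2\<close>, and the determinant collapses to a cube. Thus the cube root of the area is
  proportional to the parameter length, which is why parabola arcs make the sums additive.\<close>

lemma curve_triangle:
  assumes u: "0 < u1" "u1 < 1" "0 < u2" "u2 < 1" "u1 \<noteq> u2"
    and t1: "\<And>u'. 0 \<le> u' \<Longrightarrow> u' \<le> 1 \<Longrightarrow> 0 \<le> cross2 t1 (curve u' - curve u1)" "t1 \<noteq> 0"
    and t2: "\<And>u'. 0 \<le> u' \<Longrightarrow> u' \<le> 1 \<Longrightarrow> 0 \<le> cross2 t2 (curve u' - curve u2)" "t2 \<noteq> 0"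
    and meet: "lines_meet (curve u1) t1 (curve u2) t2 y"
  shows "triangle_area (curve u1) y (curve u2) = R j * a * b / 2 * \<bar>u2 - u1\<bar> ^ 3"
proof -
  have line: "support_line (curve u) t = {z. tang u z = 0}"
    if "0 < u" "u < 1" "\<And>u'. 0 \<le> u' \<Longrightarrow> u' \<le> 1 \<Longrightarrow> 0 \<le> cross2 t (curve u' - curve u)" "t \<noteq> 0" for u t
  proof -
    note direction = curve_support_direction[OF that(1-3)]
    obtain n where n: "pt t = n * (1 - u)" "qt t = n * u" using direction by blast
    have "n \<noteq> 0" using pq_zero that(4) n by auto
    then show ?thesis
      unfolding support_line_def cross_direction_tang[OF n] using R a0 b0 by simp
  qed
  have l1: "support_line (curve u1) t1 = {z. tang u1 z = 0}" by (rule line[OF u(1,2) t1])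
  have l2: "support_line (curve u2) t2 = {z. tang u2 z = 0}" by (rule line[OF u(3,4) t2])
  have "curve u2 \<in> {z. tang u2 z = 0}" "curve u2 \<notin> {z. tang u1 z = 0}"
    using u(5) by (simp_all add: tang_curve)
  then have "{z. tang u1 z = 0} \<noteq> {z. tang u2 z = 0}" by blast
  then have "y \<in> {z. tang u1 z = 0} \<inter> {z. tang u2 z = 0}"
    using meet unfolding lines_meet_def l1 l2 by simp
  then have y1: "u1 * X y + (1 - u1) * Y y = u1 * (1 - u1)" and y2:
      "u2 * X y + (1 - u2) * Y y = u2 * (1 - u2)"
    by (simp_all add: tang_def)
  have "(u1 - u2) * X y = (u1 - u2) * ((1 - u1) * (1 - u2))"
  proof -
    have "(u1 - u2) * X y = (1 - u2) * (u1 * X y + (1 - u1) * Y y) - (1 - u1) * (u2 * X y + (1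
        - u2) * Y y)"
      by (simp add: algebra_simps)
    also have "\<dots> = (u1 - u2) * ((1 - u1) * (1 - u2))" unfolding y1 y2 by (simp add: algebra_simps)
    finally show ?thesis .
  qed
  then have X: "X y = (1 - u1) * (1 - u2)" using u(5) by simp
  have "(u1 - u2) * Y y = (u1 - u2) * (u1 * u2)"
  proof -
    have "(u1 - u2) * Y y = u1 * (u2 * X y + (1 - u2) * Y y) - u2 * (u1 * X y + (1 - u1) * Y y)"
      by (simp add: algebra_simps)
    also have "\<dots> = (u1 - u2) * (u1 * u2)" unfolding y1 y2 by (simp add: algebra_simps)
    finally show ?thesis .
  qed
  then have Y: "Y y = u1 * u2" using u(5) by simp
  have "cross2 (y - curve u1) (curve u2 - curve u1) = R j * a * b * (u2 - u1) ^ 3"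
    unfolding cross_diff X Y X_curve Y_curve
    by (simp add: power2_eq_square power3_eq_cube algebra_simps)
  then show ?thesis
    using R a0 b0 by (simp add: triangle_area_eq abs_mult power_abs)
qed

end

section \<open>The body cut out by the tangents of the parabola arcs\<close>

locale parabola_body = ccw_polygon +
  fixes w :: "nat \<Rightarrow> real"
  assumes compact_K: "compact K" and w01: "j \<in> J \<Longrightarrow> 0 < w j \<and> w j < 1"
begin

lemma cor: assumes "j \<in> J" shows "corner \<kappa> K v j (w j) (1 - w (N j))"
  by unfold_locales (use assms w01[of j] w01[of "N j"] N_in[of j] in auto)

abbreviation "xc j \<equiv> corner.X \<kappa> v j (w j)"
abbreviation "yc j \<equiv> corner.Y \<kappa> v j (1 - w (N j))"
abbreviation "cv j \<equiv> corner.curve \<kappa> v j (w j) (1 - w (N j))"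
abbreviation "tg j \<equiv> corner.tang \<kappa> v j (w j) (1 - w (N j))"

text \<open>The half planes are bounded by the tangents of the parabola arcs (lemma \<open>tang_curve\<close>).\<close>

definition S :: "(real^2) set" where
  "S = {z \<in> K. \<forall>j\<in>J. \<forall>u\<in>{0..1}. 0 \<le> tg j u z}"
definition q :: "nat \<Rightarrow> real^2" where "q j = v (N j) - w j *\<^sub>R E j"

lemma q_eq: "q j = (1 - (1 - w j)) *\<^sub>R v j + (1 - w j) *\<^sub>R v (N j)"
  by (simp add: q_def E_def algebra_simps)

lemma q_in_K: "j \<in> J \<Longrightarrow> q j \<in> K"
  unfolding q_eq using v_in[of j] v_in[of "N j"] N_in[of j] w01[of j]
  by (intro convexD[OF convex_K]) auto

text \<open>De Casteljau's form of the arc as a quadratic Bezier curve with control points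
  \<open>q j\<close>, \<open>v (N j)\<close>, \<open>q (N j)\<close>. It exhibits the points as
  iterated convex combinations.\<close>

lemma cv_eq:
  assumes "j \<in> J"
  shows "cv j u = (1 - u) *\<^sub>R ((1 - u) *\<^sub>R q j + u *\<^sub>R v (N j)) + u *\<^sub>R ((1 - u) *\<^sub>R v (N j)
      + u *\<^sub>R q (N j))"
proof -
  interpret corner \<kappa> K v j "w j" "1 - w (N j)" by (rule cor[OF assms])
  have 1: "q j = v (N j) - w j *\<^sub>R E j" "q (N j) = v (N j) + (1 - w (N j)) *\<^sub>R E (N j)"
    by (simp_all add: q_def E_def algebra_simps)
  show ?thesis unfolding curve_def 1
    by (simp add: vec2_eq_iff algebra_simps power2_eq_square)
qed

lemma cv_0: "j \<in> J \<Longrightarrow> cv j 0 = q j" and cv_1: "j \<in> J \<Longrightarrow> cv j 1 = q (N j)"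
  by (simp_all add: cv_eq)

lemma cv_in_K:
  assumes j: "j \<in> J" and u: "0 \<le> u" "u \<le> 1"
  shows "cv j u \<in> K"
proof -
  have *: "(1 - u) *\<^sub>R z + u *\<^sub>R z' \<in> K" if "z \<in> K" "z' \<in> K" for z z'
    using convexD[OF convex_K that, of "1 - u" u] u by simp
  show ?thesis unfolding cv_eq[OF j] by (intro * q_in_K v_in N_in j)
qed

lemma XY_nonneg: "j \<in> J \<Longrightarrow> z \<in> K \<Longrightarrow> 0 \<le> xc j z" "j \<in> J \<Longrightarrow> z \<in> K \<Longrightarrow> 0 \<le> yc j z"
  using corner.X_nonneg[OF cor] corner.Y_nonneg[OF cor] by blast+

text \<open>An affine function that is 0 at the vertex \<open>v (N j)\<close> and 1 on the chord
  from \<open>q j\<close> to \<open>q (N j)\<close>. It separates the arc at this corner from all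
  others.\<close>

definition L :: "nat \<Rightarrow> real^2 \<Rightarrow> real" where "L j z = xc j z + yc j z"

lemma L_convex_combination:
  assumes "j \<in> J" shows "L j ((1 - r) *\<^sub>R z + r *\<^sub>R z') = (1 - r) * L j z + r * L j z'"
  unfolding L_def corner.XY_convex_combination[OF cor[OF assms]] by (simp add: algebra_simps)

lemma L_cv: "j \<in> J \<Longrightarrow> L j (cv j u) = 1 - 2 * u * (1 - u)"
  by (simp add: L_def corner.X_curve[OF cor] corner.Y_curve[OF cor] power2_eq_square algebra_simps)

text \<open>A vertex beyond the chord from \<open>q i\<close> to \<open>q (N i)\<close> would lie in the triangle \<open>q i\<close>, \<open>v (N i)\<close>,
  \<open>q (N i)\<close> and hence not be extreme.\<close>

lemma L_vertex_ge:
  assumes i: "i \<in> J" and k: "k \<in> J" and ne: "k \<noteq> N i"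
  shows "1 \<le> L i (v k)"
proof (rule ccontr)
  assume less: "\<not> 1 \<le> L i (v k)"
  interpret corner \<kappa> K v i "w i" "1 - w (N i)" by (rule cor[OF i])
  define \<sigma> where "\<sigma> = L i (v k)"
  define z where "z = v k"
  have nn: "0 \<le> xc i z" "0 \<le> yc i z" using XY_nonneg[OF i v_in[OF k]] by (simp_all add: z_def)
  have XV: "xc i (v (N i)) = 0" "yc i (v (N i)) = 0"
    by (simp_all add: X_def Y_def ca_def cb_def cross2_zero_right)
  have zV: "z - v (N i) = ((1 - w (N i)) * yc i z) *\<^sub>R E (N i) - (w i * xc i z) *\<^sub>R E i"
    using diff_coords[of z "v (N i)"] by (simp add: XV)
  have "z \<noteq> v (N i)" using v_neq[OF k N_in[OF i] ne] by (simp add: z_def)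
  then have "\<not> (xc i z = 0 \<and> yc i z = 0)" using zV by auto
  then have s0: "0 < \<sigma>" using nn by (auto simp: \<sigma>_def L_def z_def [symmetric])
  have s1: "\<sigma> < 1" using less by (simp add: \<sigma>_def)
  \<comment> \<open>The point where the ray from \<open>v (N i)\<close> through \<open>z\<close>
    meets the chord.\<close>
  define g where "g = (1 - yc i z / \<sigma>) *\<^sub>R q i + (yc i z / \<sigma>) *\<^sub>R q (N i)"
  have sum: "xc i z + yc i z = \<sigma>" by (simp add: \<sigma>_def L_def z_def)
  have gK: "g \<in> K" unfolding g_def
    using q_in_K[OF i] q_in_K[OF N_in[OF i]] nn s0 sum
    by (intro convexD[OF convex_K]) (auto simp: field_simps)
  have qi: "q i - v (N i) = - (w i *\<^sub>R E i)" "q (N i) - v (N i) = (1 - w (N i)) *\<^sub>R E (N i)"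
    by (simp_all add: q_def E_def algebra_simps)
  have "1 - yc i z / \<sigma> = xc i z / \<sigma>" using sum s0 by (simp add: field_simps)
  moreover have "g - v (N i) = (1 - yc i z / \<sigma>) *\<^sub>R (q i - v (N i)) + (yc i z / \<sigma>) *\<^sub>R (q (N i)
      - v (N i))"
    by (simp add: g_def algebra_simps)
  ultimately have "\<sigma> *\<^sub>R (g - v (N i)) = z - v (N i)"
    unfolding zV qi using s0 by (simp add: scaleR_diff_right mult.commute)
  then have z: "z = (1 - \<sigma>) *\<^sub>R v (N i) + \<sigma> *\<^sub>R g" by (simp add: algebra_simps)
  then have "g \<noteq> v (N i)" using \<open>z \<noteq> v (N i)\<close> by (auto simp: algebra_simps)
  then have "z \<in> open_segment (v (N i)) g" using z s0 s1 by (intro open_segmentI) auto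
  then show False
    using extreme[OF k] gK v_in[OF N_in[OF i]] unfolding extreme_point_of_def z_def by blast
qed

lemma L_q_ge:
  assumes i: "i \<in> J" and k: "k \<in> J"
  shows "1 \<le> L i (q k)"
proof -
  consider "k = i" | "k = N i" | "k \<noteq> i" "k \<noteq> N i" by blast
  then show ?thesis
  proof cases
    case 1
    then show ?thesis using L_cv[OF i, of 0] by (simp add: cv_0[OF i])
  next
    case 2
    then show ?thesis using L_cv[OF i, of 1] by (simp add: cv_1[OF i])
  next
    case 3
    have "N k \<noteq> N i" using 3(1) P_N[OF i] P_N[OF k] by metis
    then have "1 \<le> L i (v k)" "1 \<le> L i (v (N k))"
      using L_vertex_ge[OF i] k N_in[OF k] 3(2) by blast+
    then have "(1 - (1 - w k)) * 1 + (1 - w k) * 1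
        \<le> (1 - (1 - w k)) * L i (v k) + (1 - w k) * L i (v (N k))"
      using w01[OF k] by (intro add_mono mult_left_mono) auto
    then show ?thesis unfolding q_eq L_convex_combination[OF i] by simp
  qed
qed

text \<open>\<open>L i\<close> is affine, and all three control points of another arc satisfy the
  bound: its middle control point is a vertex different from \<open>v (N i)\<close>.\<close>

lemma L_cv_ge:
  assumes i: "i \<in> J" and k: "k \<in> J" and ne: "k \<noteq> i" and u: "0 \<le> u" "u \<le> 1"
  shows "1 \<le> L i (cv k u)"
proof -
  have "N k \<noteq> N i" using ne P_N[OF i] P_N[OF k] by metis
  then have V: "1 \<le> L i (v (N k))" using L_vertex_ge[OF i N_in[OF k]] by blast
  have *: "1 \<le> L i ((1 - u) *\<^sub>R z + u *\<^sub>R z')" if "1 \<le> L i z" "1 \<le> L i z'" for z z'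
  proof -
    have "(1 - u) * 1 + u * 1 \<le> (1 - u) * L i z + u * L i z'"
      using that u by (intro add_mono mult_left_mono) auto
    then show ?thesis unfolding L_convex_combination[OF i] by simp
  qed
  show ?thesis unfolding cv_eq[OF k] by (intro * V L_q_ge i k N_in)
qed

lemma cv_disjoint:
  assumes "i \<in> J" "k \<in> J" "k \<noteq> i" "0 < u" "u < 1" "0 \<le> u'" "u' \<le> 1"
  shows "cv i u \<noteq> cv k u'"
proof
  assume "cv i u = cv k u'"
  then have "1 \<le> 1 - 2 * u * (1 - u)" using L_cv_ge[OF assms(1-3,6,7)] L_cv[OF assms(1)] by metis
  then show False using assms(4,5) by (simp add: mult_le_0_iff)
qed

text \<open>For the tangents at the same corner this is \<open>tang_curve\<close>. At another corner
  \<open>i\<close> both coefficients of \<open>tg i u'\<close> dominate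
  \<open>u' * (1 - u')\<close>, so its value is at least \<open>u' * (1 - u') * (L i - 1)\<close>,
  which \<open>L_cv_ge\<close> makes nonnegative.\<close>

lemma cv_in_S:
  assumes j: "j \<in> J" and u: "0 \<le> u" "u \<le> 1"
  shows "cv j u \<in> S"
  unfolding S_def
proof (intro CollectI conjI ballI cv_in_K j u)
  fix i u' assume i: "i \<in> J" and "u' \<in> {0..1::real}"
  then have u': "0 \<le> u'" "u' \<le> 1" by simp_all
  show "0 \<le> tg i u' (cv j u)"
  proof (cases "i = j")
    case True
    then show ?thesis using corner.tang_curve[OF cor[OF j]] by simp
  next
    case False
    have nn: "0 \<le> xc i (cv j u)" "0 \<le> yc i (cv j u)" using XY_nonneg[OF i cv_in_K[OF j u]] by blast+
    have "u' * (1 - u') * 1 \<le> u' * (1 - u') * (xc i (cv j u) + yc i (cv j u))"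
      using L_cv_ge[OF i j _ u] False u' by (intro mult_left_mono) (auto simp: L_def)
    also have "\<dots> \<le> u' * xc i (cv j u) + (1 - u') * yc i (cv j u)"
    proof -
      have "u' * (1 - u') \<le> u'" "u' * (1 - u') \<le> 1 - u'" using u'
          by (simp_all add: mult_left_le mult_left_le_one_le)
      then have "u' * (1 - u') * xc i (cv j u) \<le> u' * xc i (cv j u)"
          "u' * (1 - u') * yc i (cv j u) \<le> (1 - u') * yc i (cv j u)"
        using nn by (simp_all add: mult_right_mono)
      then show ?thesis by (simp add: distrib_left)
    qed
    finally show ?thesis by (simp add: corner.tang_def[OF cor[OF i]])
  qed
qed

lemma cv_frontier:
  assumes j: "j \<in> J" and u: "0 \<le> u" "u \<le> 1"
  shows "cv j u \<in> frontier S"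
proof (rule left_support_frontier)
  interpret corner \<kappa> K v j "w j" "1 - w (N j)" by (rule cor[OF j])
  have c: "cross2 (tdir u) (z - curve u) = (R j * w j * (1 - w (N j)) * 1) * tang u z" for z
    by (rule cross_direction_tang) (simp_all add: tdir_coords)
  have "tdir u \<noteq> 0"
  proof
    assume "tdir u = 0"
    then have "pt 0 = 1 - u" "qt 0 = u" using tdir_coords[of u] by simp_all
    then show False by (simp add: pt_def qt_def cross2_zero_left cross2_zero_right)
  qed
  then show "left_support S (cv j u) (tdir u)"
    unfolding left_support_def using cv_in_S[OF j u] R a0 b0 j u by (auto simp: c S_def)
qed

text \<open>The direction \<open>t\<close> lies in the cone of some corner and there equals the
  tangent direction for a parameter \<mu>. Testing the support at \<open>cv j \<mu>\<close> puts
  \<open>z\<close> on this tangent. As a function of \<open>u\<close>, \<open>tang u z\<close> is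
  then a monic quadratic that is nonnegative on the unit interval and vanishes at \<mu>. A double
  root identifies \<open>z\<close> with \<open>cv j \<mu>\<close>.\<close>

lemma frontier_S:
  assumes z: "z \<in> S" and t: "left_support S z t"
  shows "\<exists>j\<in>J. \<exists>u\<in>{0..1}. z = cv j u"
proof -
  have "t \<noteq> 0" using t by (simp add: left_support_def)
  then obtain j where j: "j \<in> J" and cone: "0 \<le> cross2 (E j) t" "0 < cross2 t (E (N j))"
    using direction_cone by blast
  interpret corner \<kappa> K v j "w j" "1 - w (N j)" by (rule cor[OF j])
  have "0 < pt t" "0 \<le> qt t" using cone R a0 b0 by (simp_all add: pt_def qt_def)
  define n where "n = pt t + qt t"
  define \<mu> where "\<mu> = qt t / n"
  have n: "0 < n" using \<open>0 < pt t\<close> \<open>0 \<le> qt t\<close> by (simp add: n_def)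
  have pq: "pt t = n * (1 - \<mu>)" "qt t = n * \<mu>" using n by (simp_all add: \<mu>_def n_def field_simps)
  have mu: "0 \<le> \<mu>" "\<mu> < 1"
    using n \<open>0 < pt t\<close> \<open>0 \<le> qt t\<close> by (simp_all add: \<mu>_def n_def)
  have "cv j \<mu> \<in> S" using cv_in_S[OF j(1)] mu by simp
  then have "0 \<le> cross2 t (cv j \<mu> - z)" using t by (simp add: left_support_def)
  also have "\<dots> = - cross2 t (z - cv j \<mu>)" by (simp add: cross2_diff_right)
  also have "\<dots> = - ((R j * w j * (1 - w (N j)) * n) * tg j \<mu> z)"
    by (simp only: cross_direction_tang[OF pq])
  finally have "(R j * w j * (1 - w (N j)) * n) * tg j \<mu> z \<le> 0" by simp
  moreover have "0 < R j * w j * (1 - w (N j)) * n" using R a0 b0 n by simp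
  ultimately have "tg j \<mu> z \<le> 0" by (metis mult_pos_pos not_le)
  have ge: "0 \<le> tg i u z" if "i \<in> J" "0 \<le> u" "u \<le> 1" for i u using z that by (simp add: S_def)
  have zero: "tang \<mu> z = 0" using \<open>tg j \<mu> z \<le> 0\<close> ge[OF j(1), of \<mu>] mu by simp
  \<comment> \<open>The last bracket without \<open>u - \<mu>\<close>, called \<open>k\<close>
    below, is the derivative at \<mu>; the root is double exactly if it is 0.\<close>
  have quad: "tang u z = (u - \<mu>) * ((u - \<mu>) + (xc j z - yc j z - 1 + 2 * \<mu>))" for u
  proof -
    have "tang u z = tang u z - tang \<mu> z" using zero by simp
    also have "\<dots> = (u - \<mu>) * ((u - \<mu>) + (xc j z - yc j z - 1 + 2 * \<mu>))"
      by (simp add: tang_def algebra_simps)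
    finally show ?thesis .
  qed
  define k where "k = xc j z - yc j z - 1 + 2 * \<mu>"
  have zK: "z \<in> K" using z by (simp add: S_def)
  have k0: "0 \<le> k"
  proof (rule ccontr)
    assume "\<not> 0 \<le> k"
    define u where "u = \<mu> + min (1 - \<mu>) (- k / 2)"
    have "0 < u - \<mu>" "u - \<mu> + k < 0" "0 \<le> u" "u \<le> 1"
      using \<open>\<not> 0 \<le> k\<close> mu by (auto simp: u_def min_def)
    then have "tang u z < 0" unfolding quad k_def [symmetric] by (simp add: mult_less_0_iff)
    then show False using ge[OF j(1)] \<open>0 \<le> u\<close> \<open>u \<le> 1\<close> by (smt (verit))
  qed
  have "k = 0"
  proof (cases "\<mu> = 0")
    case False
    show ?thesis
    proof (rule ccontr)
      assume "k \<noteq> 0"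
      then have kp: "0 < k" using k0 by simp
      define u where "u = \<mu> - min \<mu> (k / 2)"
      have "u - \<mu> < 0" "0 < u - \<mu> + k" "0 \<le> u" "u \<le> 1"
        using kp mu False by (auto simp: u_def min_def)
      then have "tang u z < 0" unfolding quad k_def [symmetric] by (simp add: mult_less_0_iff)
      then show False using ge[OF j(1)] \<open>0 \<le> u\<close> \<open>u \<le> 1\<close> by (smt (verit))
    qed
  next
    \<comment> \<open>At the end of the interval nonnegativity gives only \<open>0 \<le> k\<close>.
      Now \<open>z\<close> is on the line of side \<open>j\<close>, and the missing inequality comes
      from the tangents at the preceding corner.\<close>
    case True
    have Y0: "yc j z = 0" using zero True by (simp add: tang_def)
    define i where "i = P j"
    have i: "i \<in> J" "N i = j" using P_in N_P j(1) by (simp_all add: i_def)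
    interpret I: corner \<kappa> K v i "w i" "1 - w (N i)" by (rule cor[OF i(1)])
    have cbz: "cross2 (E j) (z - v (N j)) = 0"
      using Y0 R b0 by (simp add: Y_def cb_def)
    have "cross2 (E j) (z - v j) = cross2 (E j) (z - v (N j))"
      by (simp add: E_def cross2_def algebra_simps)
    then have X0: "xc i z = 0" using cbz i(2) by (simp add: I.X_def ca_def)
    have "1 \<le> yc i z"
    proof (rule ccontr)
      assume "\<not> 1 \<le> yc i z"
      \<comment> \<open>On this side the tangent with parameter \<open>u\<close> of the preceding
        arc passes through the point with second coordinate \<open>u\<close>. A value strictly
        between that of \<open>z\<close> and 1 would cut \<open>z\<close> off.\<close>
      define u where "u = (1 + max 0 (yc i z)) / 2"
      have u: "0 \<le> u" "u < 1" "yc i z < u" using \<open>\<not> 1 \<le> yc i z\<close>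
          by (auto simp: u_def max_def field_simps)
      have "tg i u z = (1 - u) * (yc i z - u)" unfolding I.tang_def X0 by (simp add: algebra_simps)
      then have "tg i u z < 0" using u by (simp add: mult_less_0_iff)
      then show False using ge[OF i(1), of u] u by simp
    qed
    moreover have zV: "z - v (N j) = - ((w j * xc j z) *\<^sub>R E j)"
      using corner_coords[OF j(1), of z] Y0 a0 b0 by (simp add: X_def Y_def)
    then have zj: "z - v j = (1 - w j * xc j z) *\<^sub>R E j" by (simp add: E_def algebra_simps)
    have "yc i z = (1 - w j * xc j z) / (1 - w j)"
    proof -
      have "cb i z = (1 - w j * xc j z)"
        unfolding cb_def i(2) zj using R_pos[OF i(1)] by (simp add: cross2_scaleR_right R_def i(2))
      then show ?thesis unfolding I.Y_def by (simp only: i(2))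
    qed
    ultimately have "1 - w j \<le> 1 - w j * xc j z" using w01[OF j(1)] by (simp add: field_simps)
    then have "xc j z \<le> 1" using a0 by (simp add: mult_le_cancel_left1)
    then show ?thesis using k0 True Y0 by (simp add: k_def)
  qed
  then have sq: "tang u z = (u - \<mu>)\<^sup>2" for u
    unfolding quad k_def [symmetric] by (simp add: power2_eq_square)
  have "xc j z = (1 - \<mu>)\<^sup>2" using sq[of 1] by (simp add: tang_def)
  moreover have "yc j z = \<mu>\<^sup>2" using sq[of 0] by (simp add: tang_def)
  ultimately have "z = cv j \<mu>" by (rule curve_eqI)
  then show ?thesis using j(1) mu by (intro bexI[of _ j] bexI[of _ \<mu>]) auto
qed

lemma convex_body_S: "convex_body S"
  unfolding convex_body_def
proof (intro conjI)
  have "closed {z \<in> K. \<forall>j\<in>J. \<forall>u\<in>{0..1}. 0 \<le> tg j u z}"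
  proof -
    have "{z \<in> K. \<forall>j\<in>J. \<forall>u\<in>{0..1}. 0 \<le> tg j u z} = K \<inter> (\<Inter>j\<in>J. \<Inter>u\<in>{0..1}. {z. 0 \<le> tg j u z})"
      by auto
    moreover have "closed {z. 0 \<le> tg j u z}" if "j \<in> J" for j u
      by (rule closed_Collect_le) (intro continuous_on_const corner.continuous_tang[OF cor[OF
          that]])+
    ultimately show ?thesis using compact_imp_closed[OF compact_K]
        by (auto intro!: closed_Int closed_INT)
  qed
  then have "closed S" by (simp add: S_def)
  moreover have "S = K \<inter> S" by (auto simp: S_def)
  ultimately show "compact S" using compact_Int_closed[OF compact_K] by metis
  show conv: "convex S"
  proof (rule convexI)
    fix z z' and r r' :: real assume z: "z \<in> S" "z' \<in> S" and r: "0 \<le> r" "0 \<le> r'" "r + r' = 1"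
    have r1: "r = 1 - r'" using r by simp
    have "0 \<le> tg j u ((1 - r') *\<^sub>R z + r' *\<^sub>R z')" if "j \<in> J" "u \<in> {0..1}" for j u
    proof -
      interpret corner \<kappa> K v j "w j" "1 - w (N j)" by (rule cor[OF that(1)])
      have "tang u ((1 - r') *\<^sub>R z + r' *\<^sub>R z') = (1 - r') * tang u z + r' * tang u z'"
        unfolding tang_def XY_convex_combination by (simp add: algebra_simps)
      also have "0 \<le> \<dots>" using z r that by (auto simp: S_def intro!: add_nonneg_nonneg
          mult_nonneg_nonneg)
      finally show ?thesis .
    qed
    moreover have "r *\<^sub>R z + r' *\<^sub>R z' \<in> K" using z r
        by (intro convexD[OF convex_K]) (auto simp: S_def)
    ultimately show "r *\<^sub>R z + r' *\<^sub>R z' \<in> S" using r1 by (auto simp: S_def)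
  qed
  have 1: "1 \<in> J" using kappa by simp
  interpret corner \<kappa> K v 1 "w 1" "1 - w (N 1)" by (rule cor[OF 1])
  \<comment> \<open>Three points of one arc span a nondegenerate triangle inside \<open>S\<close>,
    which provides interior points.\<close>
  let ?T = "convex hull {curve 0, curve (1/2), curve 1}"
  have "cross2 (curve (1/2) - curve 0) (curve 1 - curve 0) \<noteq> 0"
    unfolding cross_diff X_curve Y_curve using R a0 b0 by (simp add: power2_eq_square)
  then have "measure lebesgue ?T \<noteq> 0"
    using triangle_area_eq[of "curve 0" "curve (1/2)" "curve 1"] by (simp add: triangle_area_def)
  then have "\<not> negligible ?T" using negligible_imp_measure0 by blast
  then have "interior ?T \<noteq> {}" using negligible_convex_interior[of ?T] convex_convex_hull by blast
  moreover have "?T \<subseteq> S"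
    using cv_in_S[OF 1, of 0] cv_in_S[OF 1, of "1/2"] cv_in_S[OF 1, of 1] conv
    by (intro hull_minimal) auto
  ultimately show "interior S \<noteq> {}" using interior_mono by blast
qed

end

text \<open>With at least two arcs no arc uses both ends of the parameter interval, so the loop is
  injective on each of them. An injective continuous function then maps the arc onto the interval
  between its values at the ends.\<close>

lemma subdivision_arc:
  assumes "subdivision S m x A" and m: "2 \<le> m" and i: "i \<in> {1..m}"
  shows "compact (A i)" "connected (A i)"
    "\<And>h :: real^2 \<Rightarrow> real. continuous_on (A i) h \<Longrightarrow> inj_on h (A i) \<Longrightarrow> h ` A i
        = closed_segment (h (x i)) (h (x (i + 1)))"
proof -
  obtain g t where "subdivision_param S m x A g t"
    using assms(1) by (auto simp: subdivision_iff_param)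
  then interpret subdivision_param S m x A g t .
  have ti: "t i \<le> t (i + 1)" "{t i..t (i + 1)} \<subseteq> {0..1}"
    using mono[of i "i + 1"] t01[of i] t01[of "i + 1"] i by auto
  have n01: "0 < t i \<or> t (i + 1) < 1"
    using mono[of i 1] mono[of "m + 1" "i + 1"] i m t_first t_last by auto
  have cont: "continuous_on {t i..t (i + 1)} g"
    using simple ti(2) by (auto simp: simple_path_def path_def intro: continuous_on_subset)
  show "compact (A i)" "connected (A i)" unfolding A[OF i]
    using cont by (auto intro: compact_continuous_image connected_continuous_image)
  have inj: "inj_on g {t i..t (i + 1)}"
  proof (rule inj_onI)
    fix r r' assume r: "r \<in> {t i..t (i + 1)}" "r' \<in> {t i..t (i + 1)}" "g r = g r'"
    then show "r = r'" using loop[OF r(3)] ti(2) n01 by auto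
  qed
  have seg: "closed_segment (t i) (t (i + 1)) = {t i..t (i + 1)}"
    using ti(1) by (simp add: closed_segment_eq_real_ivl)
  show "h ` A i = closed_segment (h (x i)) (h (x (i + 1)))"
    if h: "continuous_on (A i) h" "inj_on h (A i)" for h :: "real^2 \<Rightarrow> real"
  proof -
    have "(h \<circ> g) ` closed_segment (t i) (t (i + 1))
        = closed_segment ((h \<circ> g) (t i)) ((h \<circ> g) (t (i + 1)))"
      using cont inj h unfolding A[OF i] seg [symmetric]
      by (intro continuous_injective_image_segment_1 continuous_on_compose comp_inj_on)
    then show ?thesis unfolding seg image_comp [symmetric] A[OF i, symmetric]
      using x[of i] x[of "i + 1"] i by simp
  qed
qed

lemma subdivision_overlap:
  assumes sub: "subdivision S m x A" and i: "i \<in> {1..m}" and k: "k \<in> {1..m}" and ik: "i \<noteq> k"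
  shows "finite (A i \<inter> A k)"
proof (rule finite_subset)
  show "A i \<inter> A k \<subseteq> {x 1, x i, x k}"
    using subdivision_meet[OF sub i k] subdivision_meet[OF sub k i] ik
        by (cases i k rule: linorder_cases) blast+
qed simp

lemma subdivision_cover:
  assumes sub: "subdivision S m x A" and m: "1 \<le> m"
  shows "(\<Union>i\<in>{1..m}. A i) = frontier S"
proof
  show "(\<Union>i\<in>{1..m}. A i) \<subseteq> frontier S" using subdivision_endpoints(3)[OF sub] by blast
  obtain g t where "subdivision_param S m x A g t"
    using sub by (auto simp: subdivision_iff_param)
  then interpret subdivision_param S m x A g t .
  have ex: "\<exists>i\<in>{1..n}. r \<in> {t i..t (i + 1)}" if "1 \<le> n" "t 1 \<le> r" "r \<le> t (n + 1)"
      for n and r :: real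
    using that
  proof (induction n)
    case (Suc n)
    show ?case
    proof (cases "n = 0 \<or> t (n + 1) \<le> r")
      case True
      then show ?thesis using Suc.prems by (intro bexI[of _ "Suc n"]) auto
    next
      case False
      then obtain i where "i \<in> {1..n}" "r \<in> {t i..t (i + 1)}" using Suc by auto
      then show ?thesis by (intro bexI[of _ i]) auto
    qed
  qed simp
  show "frontier S \<subseteq> (\<Union>i\<in>{1..m}. A i)"
  proof
    fix z assume "z \<in> frontier S"
    then have "z \<in> g ` {0..1}" using image by (simp only: path_image_def)
    then obtain r where r: "z = g r" "r \<in> {0..1}" by blast
    then obtain i where i: "i \<in> {1..m}" "r \<in> {t i..t (i + 1)}" using ex[of m r] m t_first t_last
        by auto
    then have "z \<in> A i" using A r(1) by auto
    then show "z \<in> (\<Union>i\<in>{1..m}. A i)" using i(1) by blast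
  qed
qed

section \<open>Affine length of the parabola arcs and the affine perimeter of the body\<close>

context parabola_body
begin

abbreviation "pr j \<equiv> corner.par \<kappa> v j (w j) (1 - w (N j))"
abbreviation "lp j \<equiv> corner.lip \<kappa> v j (w j) (1 - w (N j))"
text \<open>The cube root of the area of the corner triangle \<open>q j\<close>,
  \<open>v (N j)\<close>, \<open>q (N j)\<close>; by \<open>curve_triangle\<close> it is the affine
  length per unit of parameter.\<close>

definition F :: "nat \<Rightarrow> real" where "F j = root 3 (R j * w j * (1 - w (N j)) / 2)"
text \<open>Converts the mesh into a bound on the affine length of an arc, see
  \<open>len_bounds\<close>: at corner \<open>j\<close> the parameters of an arc lie within
  \<open>lp j * \<delta>\<close> of any one of them.\<close>

definition C :: real where "C = (\<Sum>j\<in>J. F j * (2 * lp j))"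

lemma F_nonneg: assumes "j \<in> J" shows "0 \<le> F j"
proof -
  have "0 \<le> w j" "0 \<le> 1 - w (N j)" "0 \<le> R j"
    using w01[of j] w01[of "N j"] N_in R_pos[of j] assms by fastforce+
  then show ?thesis by (simp add: F_def)
qed

lemma C_nonneg: "0 \<le> C"
  unfolding C_def using F_nonneg corner.lip_nonneg[OF cor] by (intro sum_nonneg) auto

lemma frontier_S_cv:
  assumes "z \<in> frontier S" shows "\<exists>j\<in>J. \<exists>u\<in>{0..1}. z = cv j u"
proof -
  obtain t where t: "left_support S z t" using frontier_left_support[OF convex_body_S assms]
      by blast
  then show ?thesis using frontier_S[OF _ t] by (simp add: left_support_def)
qed

end

locale parabola_subdivision = parabola_body +
  fixes c :: "real^2" and \<rho> M \<delta> :: real and m :: nat and x :: "nat \<Rightarrow> real^2" and A d y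
  assumes inner: "cball c \<rho> \<subseteq> S" and outer: "S \<subseteq> cball c M" and rho: "0 < \<rho>"
    and sub: "subdivision S m x A" and data: "supporting_data S m x d y" and m2: "2 \<le> m"
    and mesh: "\<And>i z z'. i \<in> {1..m} \<Longrightarrow> z \<in> A i \<Longrightarrow> z' \<in> A i \<Longrightarrow> norm (z - z') \<le> \<delta>"
    and delta: "0 \<le> \<delta>" "\<delta> \<le> \<rho>"
begin

text \<open>\<open>len i\<close> is the affine length of \<open>A i\<close>. As an image measure it is additive for every parametrization
  of the boundary, and it equals the cube root of \<open>T i\<close> unless \<open>A i\<close> contains a tangency point.\<close>

definition T :: "nat \<Rightarrow> real" where "T i = triangle_area (x i) (y i) (x (i + 1))"
definition B :: "nat \<Rightarrow> nat \<Rightarrow> real set" where "B i j = {0..1} \<inter> cv j -` A i"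
definition len :: "nat \<Rightarrow> real" where "len i = (\<Sum>j\<in>J. F j * measure lebesgue (B i j))"
definition bad :: "nat set" where "bad = {i \<in> {1..m}. \<exists>k\<in>J. q k \<in> A i}"

lemma compact_B: "i \<in> {1..m} \<Longrightarrow> j \<in> J \<Longrightarrow> compact (B i j)"
  unfolding B_def
  by (intro closed_Int_compact[of "cv j -` A i" "{0..1}", simplified Int_commute]
      closed_vimage compact_imp_closed subdivision_arc(1)[OF sub m2] corner.continuous_curve[OF
          cor] compact_Icc)

text \<open>The arcs cover the frontier and overlap pairwise in finite sets. Since
  \<open>cv j\<close> is injective, the same holds for their preimages in the unit interval up to
  null sets.\<close>

lemma sum_B: assumes j: "j \<in> J" shows "(\<Sum>i = 1..m. measure lebesgue (B i j)) = 1"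
proof -
  have "(\<Sum>i = 1..m. measure lebesgue (B i j)) = measure lebesgue (\<Union>((\<lambda>i. B i j) ` {1..m}))"
  proof (rule measure_negligible_finite_Union_image[symmetric])
    show "B i j \<in> lmeasurable" if "i \<in> {1..m}" for i
      using compact_B[OF that j] by (rule lmeasurable_compact)
    show "pairwise (\<lambda>i k. negligible (B i j \<inter> B k j)) {1..m}"
    proof (rule pairwiseI)
      fix i k assume ik: "i \<in> {1..m}" "k \<in> {1..m}" "i \<noteq> k"
      have "inj_on (cv j) (B i j \<inter> B k j)"
        by (rule inj_on_inverseI[of _ "pr j"]) (rule corner.par_curve[OF cor[OF j]])
      moreover have "cv j ` (B i j \<inter> B k j) \<subseteq> A i \<inter> A k" by (auto simp: B_def)
      then have "finite (cv j ` (B i j \<inter> B k j))"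
        using subdivision_overlap[OF sub ik] finite_subset by blast
      ultimately have "finite (B i j \<inter> B k j)" using finite_imageD by blast
      then show "negligible (B i j \<inter> B k j)" by (rule negligible_finite)
    qed
  qed simp
  also have "\<Union>((\<lambda>i. B i j) ` {1..m}) = {0..1}"
  proof
    show "{0..1} \<subseteq> \<Union>((\<lambda>i. B i j) ` {1..m})"
    proof
      fix u :: real assume u: "u \<in> {0..1}"
      then have "cv j u \<in> (\<Union>i\<in>{1..m}. A i)"
        using subdivision_cover[OF sub] m2 cv_frontier[OF j] by simp
      then show "u \<in> \<Union>((\<lambda>i. B i j) ` {1..m})" using u by (auto simp: B_def)
    qed
  qed (auto simp: B_def)
  also have "measure lebesgue {0..1::real} = 1" by simp
  finally show ?thesis .
qed

lemma sum_len: "(\<Sum>i = 1..m. len i) = (\<Sum>j\<in>J. F j)"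
proof -
  have "(\<Sum>i = 1..m. len i) = (\<Sum>j\<in>J. \<Sum>i = 1..m. F j * measure lebesgue (B i j))"
    unfolding len_def by (rule sum.swap)
  also have "\<dots> = (\<Sum>j\<in>J. F j)"
    by (rule sum.cong[OF refl]) (simp only: sum_distrib_left [symmetric] sum_B mult_1_right)
  finally show ?thesis .
qed

lemma len_bounds: assumes i: "i \<in> {1..m}" shows "0 \<le> len i" "len i \<le> C * \<delta>"
proof -
  show "0 \<le> len i" unfolding len_def using F_nonneg by (intro sum_nonneg) auto
  have "measure lebesgue (B i j) \<le> 2 * lp j * \<delta>" if j: "j \<in> J" for j
  proof (cases "B i j = {}")
    case True
    then show ?thesis using corner.lip_nonneg[OF cor[OF j]] delta by simp
  next
    case False
    then obtain u0 where u0: "u0 \<in> B i j" by blast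
    define e where "e = lp j * \<delta>"
    have e0: "0 \<le> e" using corner.lip_nonneg[OF cor[OF j]] delta by (simp add: e_def)
    have "\<bar>u - u0\<bar> \<le> e" if "u \<in> B i j" for u
    proof -
      have "\<bar>u - u0\<bar> = \<bar>pr j (cv j u) - pr j (cv j u0)\<bar>"
          by (simp only: corner.par_curve[OF cor[OF j]])
      also have "\<dots> \<le> lp j * norm (cv j u - cv j u0)"
        by (rule corner.par_lipschitz[OF cor[OF j]])
      also have "\<dots> \<le> e" unfolding e_def
        using mesh[OF i] u0 that corner.lip_nonneg[OF cor[OF j]]
            by (intro mult_left_mono) (auto simp: B_def)
      finally show ?thesis .
    qed
    then have "B i j \<subseteq> {u0 - e..u0 + e}" by (fastforce simp: abs_le_iff)
    then have "measure lebesgue (B i j) \<le> measure lebesgue {u0 - e..u0 + e}"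
      using lmeasurable_compact[OF compact_B[OF i j]]
      by (intro measure_mono_fmeasurable) (auto dest: fmeasurableD)
    also have "\<dots> = 2 * e" using e0 by simp
    finally show ?thesis by (simp add: e_def)
  qed
  then have "len i \<le> (\<Sum>j\<in>J. F j * (2 * lp j * \<delta>))"
    unfolding len_def using F_nonneg by (intro sum_mono mult_left_mono) auto
  also have "\<dots> = C * \<delta>" by (simp add: C_def sum_distrib_right mult.assoc)
  finally show "len i \<le> C * \<delta>" .
qed

lemma support:
  assumes i: "i \<in> {1..m}"
  obtains t t' where "norm t = 1" "left_support S (x i) t" "norm t' = 1"
      "left_support S (x (i + 1)) t'"
    "lines_meet (x i) t (x (i + 1)) t' (y i)"
proof -
  have sd: "\<forall>i\<in>{1..m + 1}. supporting_line S (x i) (d i)"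
    "\<forall>i\<in>{1..m}. if d i = d (i + 1) then y i \<in> closed_segment (x i) (x (i + 1)) else d i \<inter> d (i
        + 1) = {y i}"
    using data unfolding supporting_data_def by blast+
  have dd: "supporting_line S (x i) (d i)" "supporting_line S (x (i + 1)) (d (i + 1))"
    using i by (auto intro!: bspec[OF sd(1)])
  have meet: "if d i = d (i + 1) then y i \<in> closed_segment (x i) (x (i + 1)) else d i \<inter> d (i + 1)
      = {y i}"
    by (rule bspec[OF sd(2) i])
  from dd obtain t t' where t: "norm t = 1" "left_support S (x i) t" "d i = support_line (x i) t"
    "norm t' = 1" "left_support S (x (i + 1)) t'" "d (i + 1) = support_line (x (i + 1)) t'"
    unfolding supporting_line_iff support_line_def by blast
  show thesis
    by (rule that[OF t(1,2,4,5)]) (use meet in \<open>simp only: lines_meet_def t(3,6)\<close>)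
qed

lemma T_le: assumes i: "i \<in> {1..m}" shows "T i \<le> (\<delta> * M / \<rho>)\<^sup>2"
proof -
  obtain t t' where t: "norm t = 1" "left_support S (x i) t" "norm t' = 1"
      "left_support S (x (i + 1)) t'"
    "lines_meet (x i) t (x (i + 1)) t' (y i)"
    using support[OF i] .
  have "x i \<in> A i" "x (i + 1) \<in> A i" using subdivision_endpoints[OF sub] i by blast+
  then have "norm (x (i + 1) - x i) \<le> \<delta>" using mesh[OF i] by blast
  then interpret support_pair S c \<rho> M \<delta> "x i" t "x (i + 1)" t'
    by unfold_locales (use t inner outer rho delta in auto)
  show ?thesis unfolding T_def by (rule triangle_area_le[OF t(5)])
qed

text \<open>Different parabolas meet only at tangency points. A connected arc avoiding these stays
  on one parabola, its preimage is the interval between the parameters of its ends, and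
  \<open>curve_triangle\<close> gives the cube of the same length.\<close>

lemma T_eq_len:
  assumes i: "i \<in> {1..m}" and nb: "i \<notin> bad"
  shows "root 3 (T i) = len i"
proof -
  have nq: "q k \<notin> A i" if "k \<in> J" for k using i nb that by (auto simp: bad_def)
  have Af: "A i \<subseteq> frontier S" by (rule subdivision_endpoints(3)[OF sub i])
  have xA: "x i \<in> A i" "x (i + 1) \<in> A i" using subdivision_endpoints[OF sub] i by blast+
  have open_arc: "\<exists>u. 0 < u \<and> u < 1 \<and> z = cv j u" if "z \<in> A i" "j \<in> J" "z \<in> cv j ` {0..1}" for z j
  proof -
    note zj = that
    obtain u where u: "0 \<le> u" "u \<le> 1" "z = cv j u" using zj(3) by auto
    have "u \<noteq> 0" using u nq[OF zj(2)] zj(1) cv_0[OF zj(2)] by auto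
    moreover have "u \<noteq> 1" using u nq[OF N_in[OF zj(2)]] zj(1) cv_1[OF zj(2)] by auto
    ultimately show ?thesis using u by (intro exI[of _ u]) auto
  qed
  obtain j where jJ: "j \<in> J" and xj: "x i \<in> cv j ` {0..1}" using frontier_S_cv Af xA(1) by blast
  interpret corner \<kappa> K v j "w j" "1 - w (N j)" by (rule cor[OF jJ])
  have disj: "cv j ` {0..1} \<inter> cv k ` {0..1} \<inter> A i = {}" if k: "k \<in> J" "k \<noteq> j" for k
  proof (rule ccontr)
    assume "cv j ` {0..1} \<inter> cv k ` {0..1} \<inter> A i \<noteq> {}"
    then obtain z where z: "z \<in> A i" "z \<in> cv j ` {0..1}" "z \<in> cv k ` {0..1}" by blast
    obtain u where "0 < u" "u < 1" "z = cv j u" using open_arc[OF z(1) j(1) z(2)] by blast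
    moreover obtain u' where "0 \<le> u'" "u' \<le> 1" "z = cv k u'" using z(3) by auto
    ultimately show False using cv_disjoint[OF j(1) k, of u u'] by auto
  qed
  have closed_cv: "closed (cv k ` {0..1})" if "k \<in> J" for k
    by (intro compact_imp_closed compact_continuous_image corner.continuous_curve[OF cor[OF
        that]] compact_Icc)
  \<comment> \<open>The traces on \<open>A i\<close> of this parabola and of the union of the others
    are closed, disjoint and cover \<open>A i\<close>, so one of them is empty by
    connectedness.\<close>
  have sub_j: "A i \<subseteq> cv j ` {0..1}"
  proof (rule ccontr)
    assume not: "\<not> ?thesis"
    define B' where "B' = (\<Union>k\<in>J - {j}. cv k ` {0..1})"
    have closed: "closed B'" unfolding B'_def using closed_cv by (intro closed_UN) auto
    have cover: "A i \<subseteq> cv j ` {0..1} \<union> B'"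
    proof
      fix z assume "z \<in> A i"
      then have "z \<in> frontier S" using Af by (rule subsetD[rotated])
      then obtain k u where "k \<in> J" "u \<in> {0..1}" "z = cv k u" using frontier_S_cv by blast
      then have "z \<in> cv k ` {0..1}" "k \<in> J" by (simp_all only: imageI)
      then show "z \<in> cv j ` {0..1} \<union> B'" unfolding B'_def by (cases "k = j") blast+
    qed
    have empty: "cv j ` {0..1} \<inter> B' \<inter> A i = {}"
    proof (rule equals0I)
      fix z assume z: "z \<in> cv j ` {0..1} \<inter> B' \<inter> A i"
      then have "z \<in> B'" by (simp only: Int_iff)
      then obtain k where k: "k \<in> J" "k \<noteq> j" "z \<in> cv k ` {0..1}" unfolding B'_def by blast
      then have "z \<in> cv j ` {0..1} \<inter> cv k ` {0..1} \<inter> A i" using z by (simp only: Int_iff)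
      then show False using disj[OF k(1,2)] by (simp only: empty_iff)
    qed
    have "cv j ` {0..1} \<inter> A i = {} \<or> B' \<inter> A i = {}"
      by (rule connected_closedD[OF subdivision_arc(2)[OF sub m2 i] empty cover closed_cv[OF
          j(1)] closed])
    then show False using not cover xj xA(1) by blast
  qed
  have par_inv: "cv j (pr j z) = z" "pr j z \<in> {0<..<1}" if "z \<in> A i" for z
  proof -
    note zA = that
    obtain u where u: "0 < u" "u < 1" "z = cv j u" using open_arc[OF zA j(1)] sub_j zA by blast
    then have "pr j z = u" by (simp only: par_curve)
    then show "cv j (pr j z) = z" "pr j z \<in> {0<..<1}" using u by simp_all
  qed
  have img: "pr j ` A i = closed_segment (pr j (x i)) (pr j (x (i + 1)))"
  proof (rule subdivision_arc(3)[OF sub m2 i continuous_par])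
    show "inj_on (pr j) (A i)" by (rule inj_on_inverseI[of _ "cv j"]) (rule par_inv(1))
  qed
  have "B i j = pr j ` A i"
  proof
    show "B i j \<subseteq> pr j ` A i"
    proof
      fix u assume "u \<in> B i j"
      then have "cv j u \<in> A i" "u = pr j (cv j u)" by (simp_all add: B_def par_curve)
      then show "u \<in> pr j ` A i" by (rule image_eqI[rotated])
    qed
    show "pr j ` A i \<subseteq> B i j" using par_inv by (fastforce simp: B_def)
  qed
  \<comment> \<open>The absolute value covers subdivisions that traverse the boundary
    clockwise.\<close>
  then have Bj: "measure lebesgue (B i j) = \<bar>pr j (x (i + 1)) - pr j (x i)\<bar>"
    unfolding img by (simp add: closed_segment_eq_real_ivl)
  have Bk: "B i k = {}" if k: "k \<in> J" "k \<noteq> j" for k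
    using disj[OF k] sub_j by (auto simp: B_def)
  have "len i = (\<Sum>k\<in>{j}. F k * measure lebesgue (B i k))" unfolding len_def
    by (rule sum.mono_neutral_right) (use Bk j(1) in auto)
  then have len: "len i = F j * \<bar>pr j (x (i + 1)) - pr j (x i)\<bar>" by (simp add: Bj)
  define u1 u2 where "u1 = pr j (x i)" and "u2 = pr j (x (i + 1))"
  have x1: "x i = cv j u1" and u1: "0 < u1" "u1 < 1" using par_inv[OF xA(1)]
      by (simp_all add: u1_def)
  have x2: "x (i + 1) = cv j u2" and u2: "0 < u2" "u2 < 1" using par_inv[OF xA(2)]
      by (simp_all add: u2_def)
  have "x i \<noteq> x (i + 1)" by (rule subdivision_points(2)[OF sub i i m2])
  then have ne: "u1 \<noteq> u2" using x1 x2 by auto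
  obtain t t' where t: "norm t = 1" "left_support S (x i) t" "norm t' = 1"
      "left_support S (x (i + 1)) t'"
    "lines_meet (x i) t (x (i + 1)) t' (y i)"
    using support[OF i] .
  have "T i = R j * w j * (1 - w (N j)) / 2 * \<bar>u2 - u1\<bar> ^ 3"
    unfolding T_def x1 x2
  proof (rule curve_triangle[OF u1 u2 ne])
    show "0 \<le> cross2 t (cv j u' - cv j u1)" "0 \<le> cross2 t' (cv j u' - cv j u2)"
        if "0 \<le> u'" "u' \<le> 1" for u'
      using t(2,4) cv_in_S[OF j(1) that] unfolding left_support_def x1 x2 by blast+
    show "t \<noteq> 0" "t' \<noteq> 0" using t by (auto simp: left_support_def)
    show "lines_meet (cv j u1) t (cv j u2) t' (y i)"
      using t(5) unfolding x1 x2 .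
  qed
  then have "root 3 (T i) = F j * root 3 (\<bar>u2 - u1\<bar> ^ 3)" by (simp only: real_root_mult F_def)
  also have "\<dots> = len i" unfolding len u1_def u2_def by (simp add: real_root_power_cancel)
  finally show ?thesis .
qed

lemma card_bad: "card bad \<le> 2 * \<kappa>"
  using subdivision_card_containing_some[OF sub, of J] by (simp add: bad_def)

text \<open>The sum and the total affine length differ only on the bad arcs. There both the cube
  root of the area and the affine length are small, and the number of such arcs does not depend on
  the subdivision.\<close>

lemma sum_root_T:
  "\<bar>(\<Sum>i = 1..m. root 3 (T i)) - (\<Sum>j\<in>J. F j)\<bar> \<le> 2 * real \<kappa> * (root 3 ((\<delta> * M / \<rho>)\<^sup>2) + C * \<delta>)"
proof -
  define e where "e = root 3 ((\<delta> * M / \<rho>)\<^sup>2) + C * \<delta>"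
  have e0: "0 \<le> e" using C_nonneg delta by (simp add: e_def)
  have "(\<Sum>i = 1..m. root 3 (T i)) - (\<Sum>j\<in>J. F j) = (\<Sum>i = 1..m. root 3 (T i) - len i)"
    by (simp only: sum_len [symmetric] sum_subtractf)
  also have "\<dots> = (\<Sum>i\<in>bad. root 3 (T i) - len i)"
    by (rule sum.mono_neutral_right) (auto simp: bad_def intro: T_eq_len[unfolded bad_def])
  finally have "\<bar>(\<Sum>i = 1..m. root 3 (T i)) - (\<Sum>j\<in>J. F j)\<bar> \<le> (\<Sum>i\<in>bad. \<bar>root 3 (T i) - len i\<bar>)"
    using sum_abs by metis
  also have "\<dots> \<le> (\<Sum>i\<in>bad. e)"
  proof (rule sum_mono)
    fix i assume "i \<in> bad"
    then have i: "i \<in> {1..m}" by (simp add: bad_def)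
    have "0 \<le> T i" by (simp add: T_def triangle_area_eq)
    then have "0 \<le> root 3 (T i)" "root 3 (T i) \<le> root 3 ((\<delta> * M / \<rho>)\<^sup>2)" using T_le[OF i]
        by simp_all
    moreover have "0 \<le> root 3 ((\<delta> * M / \<rho>)\<^sup>2)" "0 \<le> C * \<delta>" using C_nonneg delta by simp_all
    ultimately show "\<bar>root 3 (T i) - len i\<bar> \<le> e" using len_bounds[OF i]
        unfolding e_def abs_le_iff by linarith
  qed
  also have "\<dots> = real (card bad) * e" by simp
  also have "\<dots> \<le> real (2 * \<kappa>) * e" using card_bad e0
      by (intro mult_right_mono) (simp_all only: of_nat_le_iff)
  finally show ?thesis by (simp add: e_def)
qed

end

context parabola_body
begin

theorem has_affine_perimeter_S: "has_affine_perimeter S (2 * (\<Sum>j\<in>J. F j))"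
  unfolding has_affine_perimeter_def
proof (intro allI impI, elim conjE)
  fix m x A d y
  assume all: "\<forall>n. subdivision S (m n) (x n) (A n) \<and> supporting_data S (m n) (x n) (d n) (y n)"
    and m: "filterlim m at_top sequentially"
    and mesh: "(\<lambda>n. MAX i\<in>{1..m n}. diameter (A n i)) \<longlonglongrightarrow> 0"
  obtain c \<rho> M where ball: "cball c \<rho> \<subseteq> S" "0 < \<rho>" "S \<subseteq> cball c M"
    using convex_body_balls[OF convex_body_S] by metis
  have bS: "bounded S" using convex_body_S by (simp add: convex_body_def compact_imp_bounded)
  define \<delta> where "\<delta> n = (MAX i\<in>{1..m n}. diameter (A n i))" for n
  have "(\<lambda>n. 2 * real \<kappa> * (root 3 ((\<delta> n * M / \<rho>)\<^sup>2) + C * \<delta> n)) \<longlonglongrightarrow>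
      2 * real \<kappa> * (root 3 ((0 * M / \<rho>)\<^sup>2) + C * 0)"
    using mesh ball(2) unfolding \<delta>_def by (intro tendsto_intros) auto
  then have lim: "(\<lambda>n. 2 * real \<kappa> * (root 3 ((\<delta> n * M / \<rho>)\<^sup>2) + C * \<delta> n)) \<longlonglongrightarrow> 0" by simp
  have "\<forall>\<^sub>F n in sequentially. 2 \<le> m n" using m by (simp add: filterlim_at_top)
  moreover have "\<forall>\<^sub>F n in sequentially. \<delta> n < \<rho>"
    using order_tendstoD(2)[OF mesh ball(2)] by (simp add: \<delta>_def)
  ultimately have "\<forall>\<^sub>F n in sequentially.
      norm ((\<Sum>i = 1..m n. root 3 (triangle_area (x n i) (y n i) (x n (i + 1)))) - (\<Sum>j\<in>J. F j))
        \<le> 2 * real \<kappa> * (root 3 ((\<delta> n * M / \<rho>)\<^sup>2) + C * \<delta> n)"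
  proof eventually_elim
    case (elim n)
    have sub: "subdivision S (m n) (x n) (A n)" and data:
        "supporting_data S (m n) (x n) (d n) (y n)"
      using all by blast+
    have diam: "diameter (A n i) \<le> \<delta> n" if "i \<in> {1..m n}" for i
      unfolding \<delta>_def using that by (intro Max_ge) auto
    have b: "bounded (A n i)" if "i \<in> {1..m n}" for i by (rule subdivision_bounded[OF sub bS that])
    interpret parabola_subdivision \<kappa> K v w c \<rho> M "\<delta> n" "m n" "x n" "A n" "d n" "y n"
    proof
      show "norm (z - z') \<le> \<delta> n" if "i \<in> {1..m n}" "z \<in> A n i" "z' \<in> A n i" for i z z'
        using diameter_bounded_bound[OF b[OF that(1)] that(2,3)] diam[OF that(1)]
            by (simp add: dist_norm)
      show "0 \<le> \<delta> n" using diam[of 1] diameter_ge_0[OF b[of 1]] elim by auto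
    qed (use ball sub data elim in auto)
    show ?case using sum_root_T unfolding T_def real_norm_def .
  qed
  then have "(\<lambda>n. (\<Sum>i = 1..m n. root 3 (triangle_area (x n i) (y n i) (x n (i + 1))))
      - (\<Sum>j\<in>J. F j)) \<longlonglongrightarrow> 0"
    by (rule Lim_null_comparison[OF _ lim])
  then have "(\<lambda>n. \<Sum>i = 1..m n. root 3 (triangle_area (x n i) (y n i) (x n (i + 1)))) \<longlonglongrightarrow> (\<Sum>j\<in>J. F j)"
    by (simp only: LIM_zero_iff)
  then show "(\<lambda>n. 2 * (\<Sum>i = 1..m n. root 3 (triangle_area (x n i) (y n i) (x n (i + 1))))) \<longlonglongrightarrow> 2
      * (\<Sum>j\<in>J. F j)"
    by (rule tendsto_mult_left)
qed

end

subsection \<open>The maximization problem\<close>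

text \<open>Follows from the factorization of \<open>x ^ 3 + y ^ 3 + z ^ 3 - 3 * x * y * z\<close>
  for the cube roots; in the equality case the squared differences vanish.\<close>

lemma arith_geo_mean3:
  fixes a b c f :: real
  assumes pos: "0 \<le> a" "0 \<le> b" "0 \<le> c" and f: "f ^ 3 = a * b * c"
  shows "3 * f \<le> a + b + c" "3 * f = a + b + c \<Longrightarrow> a = c"
proof -
  define x y z where "x = root 3 a" and "y = root 3 b" and "z = root 3 c"
  have xyz: "0 \<le> x" "0 \<le> y" "0 \<le> z" "a = x ^ 3" "b = y ^ 3" "c = z ^ 3"
    using pos by (simp_all add: x_def y_def z_def)
  have "f = root 3 (f ^ 3)" by (simp add: odd_real_root_power_cancel)
  also have "\<dots> = x * y * z" unfolding f by (simp add: real_root_mult x_def y_def z_def)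
  finally have fx: "f = x * y * z" .
  have id: "2 * (a + b + c - 3 * f) = (x + y + z) * ((x - y)\<^sup>2 + (y - z)\<^sup>2 + (z - x)\<^sup>2)"
    unfolding fx xyz(4-6) by (simp add: power2_eq_square power3_eq_cube algebra_simps)
  have "0 \<le> 2 * (a + b + c - 3 * f)" unfolding id using xyz by simp
  then show "3 * f \<le> a + b + c" by simp
  assume "3 * f = a + b + c"
  then have "(x + y + z) * ((x - y)\<^sup>2 + (y - z)\<^sup>2 + (z - x)\<^sup>2) = 0" using id by simp
  then consider "x + y + z = 0" | "(x - y)\<^sup>2 + (y - z)\<^sup>2 + (z - x)\<^sup>2 = 0" by auto
  then have "x = z"
  proof cases
    case 1
    then show ?thesis using xyz by linarith
  next
    case 2
    then have "(z - x)\<^sup>2 = 0"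
      using zero_le_power2[of "x - y"] zero_le_power2[of "y - z"] zero_le_power2[of "z - x"]
          by linarith
    then show ?thesis by simp
  qed
  then show "a = c" using xyz by simp
qed

section \<open>Uniqueness of positive solutions and the critical point equations\<close>

context ccw_polygon
begin

definition solves :: "(nat \<Rightarrow> real) \<Rightarrow> bool" where
  "solves f \<longleftrightarrow> (\<forall>j\<in>J. 0 < f j) \<and> (\<forall>j\<in>J. f j * (f j + f (P j)) * (f j + f (N j)) = R j)"

lemma side_length_eq: "side_length \<kappa> v j = norm (E j)"
  by (simp add: side_length_def E_def)

lemma sides_angle_eq:
  assumes j: "j \<in> J"
  shows "side_length \<kappa> v j * side_length \<kappa> v (N j) * sin (internal_angle \<kappa> v j) = R j"
proof -
  have 1: "v j - v (N j) = - E j" "v (N (N j)) - v (N j) = E (N j)" by (simp_all add: E_def)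
  have "norm (- E j) * norm (E (N j)) * sin (vec_angle (- E j) (E (N j)))
      = \<bar>cross2 (- E j) (E (N j))\<bar>"
    using E_nz[OF j] E_nz[OF N_in[OF j]] by (intro sin_vec_angle) auto
  then show ?thesis
    unfolding side_length_eq internal_angle_def 1 using R_pos[OF j]
        by (simp add: cross2_minus_left R_def)
qed

lemma sum_P: "(\<Sum>j\<in>J. h (P j)) = (\<Sum>j\<in>J. h j)"
proof -
  have "(\<Sum>j\<in>J. h (P j)) = (\<Sum>j\<in>J. h (P (N j)))" by (rule sum_N[symmetric])
  also have "\<dots> = (\<Sum>j\<in>J. h j)" by (rule sum.cong[OF refl]) (simp only: P_N)
  finally show ?thesis .
qed

text \<open>With \<open>u j = f j / (f j + f (P j))\<close> the cube of \<open>f j\<close> is the product of the three terms on the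
  right: each of two solutions is dominated by the other one through the inequality of means.\<close>

lemma solutions_compare:
  assumes f: "solves f" and g: "solves g"
  defines "u \<equiv> \<lambda>j. f j / (f j + f (P j))"
  shows "(\<Sum>j\<in>J. 3 * f j) \<le> (\<Sum>j\<in>J. 3 * g j)"
    and "(\<Sum>j\<in>J. 3 * f j) = (\<Sum>j\<in>J. 3 * g j) \<Longrightarrow> j \<in> J \<Longrightarrow> u j * (g j + g (P j)) = g j"
proof -
  have fp: "0 < f j" "0 < g j" if "j \<in> J" for j using f g that by (auto simp: solves_def)
  have P: "0 < f (P j)" "0 < g (P j)" "0 < f (N j)" "0 < g (N j)" if "j \<in> J" for j
    using fp P_in N_in that by blast+
  have u1: "1 - u (N j) = f j / (f j + f (N j))" if "j \<in> J" for j
    using fp(1)[OF that] P(3)[OF that] by (simp add: u_def P_N[OF that] field_simps)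
  define a b where "a j = u j * (g j + g (P j))" and "b j = (1 - u (N j)) * (g j + g (N j))" for j
  have a0: "0 < a j" and b0: "0 < b j" if "j \<in> J" for j
    using fp[OF that] P[OF that] unfolding a_def b_def u1[OF that] by (simp_all add: u_def)
  have cube: "f j ^ 3 = a j * b j * g j" if j: "j \<in> J" for j
  proof -
    define d d' where "d = f j + f (P j)" and "d' = f j + f (N j)"
    have d: "0 < d" "0 < d'" using fp[OF j] P[OF j] by (simp_all add: d_def d'_def)
    have "f j * d * d' = R j" "g j * (g j + g (P j)) * (g j + g (N j)) = R j"
      using f g j by (simp_all add: solves_def d_def d'_def)
    then have eq: "g j * (g j + g (P j)) * (g j + g (N j)) = f j * d * d'" by simp
    have "a j * b j * g j = (f j / d) * (f j / d') * (g j * (g j + g (P j)) * (g j + g (N j)))"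
      unfolding a_def b_def u1[OF j] by (simp add: u_def d_def d'_def)
    also have "\<dots> = f j ^ 3" unfolding eq using d by (simp add: power3_eq_cube)
    finally show ?thesis by simp
  qed
  have le: "3 * f j \<le> a j + b j + g j" if "j \<in> J" for j
    using arith_geo_mean3(1)[OF _ _ _ cube[OF that]] a0[OF that] b0[OF that] fp(2)[OF that] by simp
  have sum: "(\<Sum>j\<in>J. a j + b j + g j) = (\<Sum>j\<in>J. 3 * g j)"
  proof -
    have "(\<Sum>j\<in>J. b j) = (\<Sum>j\<in>J. (\<lambda>k. (1 - u k) * (g (P k) + g k)) (N j))"
      by (rule sum.cong[OF refl]) (simp only: b_def P_N)
    also have "\<dots> = (\<Sum>j\<in>J. (1 - u j) * (g (P j) + g j))" by (rule sum_N)
    finally have "(\<Sum>j\<in>J. a j + b j + g j) = (\<Sum>j\<in>J. a j + (1 - u j) * (g (P j) + g j) + g j)"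
      by (simp only: sum.distrib)
    also have "\<dots> = (\<Sum>j\<in>J. 2 * g j + g (P j))"
      by (rule sum.cong[OF refl]) (simp add: a_def algebra_simps)
    also have "\<dots> = (\<Sum>j\<in>J. 2 * g j) + (\<Sum>j\<in>J. g j)" by (simp only: sum.distrib sum_P)
    also have "\<dots> = (\<Sum>j\<in>J. 3 * g j)" by (simp add: sum.distrib [symmetric])
    finally show ?thesis .
  qed
  show "(\<Sum>j\<in>J. 3 * f j) \<le> (\<Sum>j\<in>J. 3 * g j)" unfolding sum [symmetric] by (rule sum_mono[OF le])
  assume eq: "(\<Sum>j\<in>J. 3 * f j) = (\<Sum>j\<in>J. 3 * g j)" and j: "j \<in> J"
  have "3 * f j = a j + b j + g j"
    using sum_mono_inv[of "\<lambda>j. 3 * f j" J "\<lambda>j. a j + b j + g j" j] eq sum le j by auto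
  then have "a j = g j"
    using arith_geo_mean3(2)[OF _ _ _ cube[OF j]] a0[OF j] b0[OF j] fp(2)[OF j] by simp
  then show "u j * (g j + g (P j)) = g j" by (simp add: a_def)
qed

text \<open>Comparison in both directions gives equal sums, and the equality case shows that the
  ratio of the two solutions is constant around the cycle. The left-hand sides are homogeneous of
  degree 3, so the cube of the ratio is 1.\<close>

lemma solves_unique:
  assumes f: "solves f" and g: "solves g" and j: "j \<in> J"
  shows "g j = f j"
proof -
  have eq: "(\<Sum>j\<in>J. 3 * f j) = (\<Sum>j\<in>J. 3 * g j)"
    using solutions_compare(1)[OF f g] solutions_compare(1)[OF g f] by simp
  have fp: "0 < f j" "0 < g j" if "j \<in> J" for j using f g that by (auto simp: solves_def)
  have proportional: "f j * g (P j) = g j * f (P j)" if "j \<in> J" for j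
  proof -
    have "0 < f j + f (P j)" using fp(1) P_in that by (simp add: add_pos_pos)
    then show ?thesis
      using solutions_compare(2)[OF f g eq that] by (simp add: field_simps)
  qed
  define s where "s = g j / f j"
  have s0: "0 < s" using fp[OF j] by (simp add: s_def)
  have ratio: "g i = s * f i" if i: "i \<in> J" for i
  proof (rule N_induct[where Q = "\<lambda>i. g i = s * f i", OF j _ _ i])
    show "g j = s * f j" using fp[OF j] by (simp add: s_def)
    fix k assume k: "k \<in> J" "g k = s * f k"
    have "f (N k) * g k = g (N k) * f k" using proportional[OF N_in[OF k(1)]]
        by (simp only: P_N[OF k(1)])
    then have "(s * f (N k)) * f k = g (N k) * f k" using k(2) by (simp add: mult_ac)
    then show "g (N k) = s * f (N k)" using fp(1)[OF k(1)] by simp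
  qed
  have "g j * (g j + g (P j)) * (g j + g (N j)) = s ^ 3 * (f j * (f j + f (P j)) * (f j + f (N j)))"
    unfolding ratio[OF j] ratio[OF P_in[OF j]] ratio[OF N_in[OF j]]
    by (simp add: power3_eq_cube algebra_simps)
  then have "R j = s ^ 3 * R j" using f g j by (simp add: solves_def)
  then have "s ^ 3 = 1 ^ 3" using R_pos[OF j] by simp
  then have "s = 1" using s0 by (intro power_eq_imp_eq_base[of s 3 1]) auto
  then show ?thesis using ratio[OF j] by simp
qed

text \<open>The objective: for positions strictly inside the sides it is the affine perimeter of the
  parabola body up to the factor \<open>2 / root 3 2\<close>.\<close>

definition \<Phi> :: "(nat \<Rightarrow> real) \<Rightarrow> real" where
  "\<Phi> w = (\<Sum>j\<in>J. root 3 (R j * w j * (1 - w (N j))))"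

text \<open>If the term with index \<open>k\<close> vanished, moving all positions towards the
  middle by a fraction \<open>t\<close> would raise it to order
  \<open>t\<^sup>2\<^sup>/\<^sup>3\<close>, while the total of the other terms loses at most order
  \<open>t\<close>. For small \<open>t\<close> this contradicts maximality.\<close>

lemma maximizer_pos:
  assumes w: "\<And>j. j \<in> J \<Longrightarrow> 0 \<le> w j \<and> w j \<le> 1"
    and max: "\<And>q. (\<And>j. j \<in> J \<Longrightarrow> 0 < q j \<and> q j < 1) \<Longrightarrow> \<Phi> q \<le> \<Phi> w" and k: "k \<in> J"
  shows "0 < R k * w k * (1 - w (N k))"
proof (rule ccontr)
  assume not: "\<not> ?thesis"
  define f where "f j = root 3 (R j * w j * (1 - w (N j)))" for j
  have wN: "0 \<le> w j" "w j \<le> 1" "0 \<le> 1 - w (N j)" if "j \<in> J" for j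
    using w[OF that] w[OF N_in[OF that]] by auto
  have f0: "0 \<le> f j" if "j \<in> J" for j
    using wN[OF that] R_pos[OF that] by (simp add: f_def)
  have fk: "f k = 0" using not f0[OF k] by (simp add: f_def not_less real_root_ge_0_iff)
  have Phi: "\<Phi> w = (\<Sum>j\<in>J. f j)" by (simp add: \<Phi>_def f_def)
  have Phi0: "0 \<le> \<Phi> w" unfolding Phi using f0 by (rule sum_nonneg)
  have key: "R k / 4 \<le> t * \<Phi> w ^ 3" if t: "0 < t" "t < 1" for t
  proof -
    \<comment> \<open>A convex combination with the center of the cube, which is an interior point
      and hence an allowed competitor.\<close>
    define q where "q j = (1 - t) * w j + t / 2" for j
    have lo: "(1 - t) * w j \<le> q j" "(1 - t) * (1 - w j) \<le> 1 - q j" "t / 2 \<le> q j" "t / 2 \<le> 1 - q j"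
      if "j \<in> J" for j
    proof -
      have "0 \<le> (1 - t) * w j" "0 \<le> (1 - t) * (1 - w j)" using w[OF that] t by simp_all
      moreover have "1 - q j = (1 - t) * (1 - w j) + t / 2" by (simp add: q_def field_simps)
      ultimately show "(1 - t) * w j \<le> q j" "(1 - t) * (1 - w j) \<le> 1 - q j" "t / 2 \<le> q j"
          "t / 2 \<le> 1 - q j"
        using t by (simp_all add: q_def)
    qed
    have q01: "0 < q j \<and> q j < 1" if "j \<in> J" for j using lo(3,4)[OF that] t by linarith
    have term_ge: "(1 - t) * f j \<le> root 3 (R j * q j * (1 - q (N j)))" if j: "j \<in> J" for j
    proof -
      have "((1 - t) * f j) ^ 3 = (1 - t) ^ 3 * (R j * w j * (1 - w (N j)))"
        using f0[OF j] by (simp add: power_mult_distrib f_def odd_real_root_pow)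
      \<comment> \<open>One of the three factors is given up so that each of the two remaining ones
        can go to one position.\<close>
      also have "\<dots> \<le> (1 - t) ^ 2 * (R j * w j * (1 - w (N j)))"
        using t wN[OF j] R_pos[OF j] by (intro mult_right_mono power_decreasing) auto
      also have "\<dots> = R j * ((1 - t) * w j) * ((1 - t) * (1 - w (N j)))"
          by (simp add: power2_eq_square)
      also have "\<dots> \<le> R j * q j * (1 - q (N j))"
        using lo(1)[OF j] lo(2)[OF N_in[OF j]] t wN[OF j] R_pos[OF j] q01[OF j]
            by (intro mult_mono) auto
      finally have "root 3 (((1 - t) * f j) ^ 3) \<le> root 3 (R j * q j * (1 - q (N j)))" by simp
      then show ?thesis by (simp add: odd_real_root_power_cancel)
    qed
    have k_ge: "root 3 (R k * (t / 2) * (t / 2)) \<le> root 3 (R k * q k * (1 - q (N k)))"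
      using lo(3)[OF k] lo(4)[OF N_in[OF k]] t R_pos[OF k] q01[OF k]
      by (simp only: real_root_le_iff, intro mult_mono) auto
    have "(1 - t) * \<Phi> w + root 3 (R k * (t / 2) * (t / 2)) =
        (\<Sum>j\<in>J - {k}. (1 - t) * f j) + root 3 (R k * (t / 2) * (t / 2))"
    proof -
      have "(\<Sum>j\<in>J. (1 - t) * f j) = (1 - t) * f k + (\<Sum>j\<in>J - {k}. (1 - t) * f j)"
        using k by (intro sum.remove) auto
      then show ?thesis unfolding Phi sum_distrib_left by (simp add: fk)
    qed
    also have "\<dots> \<le> (\<Sum>j\<in>J - {k}. root 3 (R j * q j * (1 - q (N j)))) + root 3 (R k * q k * (1
        - q (N k)))"
      using term_ge k_ge by (intro add_mono sum_mono) auto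
    also have "\<dots> = \<Phi> q" unfolding \<Phi>_def
      by (subst sum.remove[OF finite_atLeastAtMost k]) (rule add.commute)
    also have "\<dots> \<le> \<Phi> w" by (rule max[OF q01])
    finally have "root 3 (R k * (t / 2) * (t / 2)) \<le> t * \<Phi> w" by (simp add: algebra_simps)
    then have "root 3 (R k * (t / 2) * (t / 2)) ^ 3 \<le> (t * \<Phi> w) ^ 3"
      using R_pos[OF k] t by (intro power_mono) auto
    then have "R k * (t / 2) * (t / 2) \<le> (t * \<Phi> w) ^ 3" by (simp add: odd_real_root_pow)
    then have "t\<^sup>2 * (R k / 4) \<le> t\<^sup>2 * (t * \<Phi> w ^ 3)"
      by (simp add: power2_eq_square power3_eq_cube mult_ac)
    then show ?thesis using t by simp
  qed
  \<comment> \<open>Adding 1 keeps the denominator of \<open>t\<close> positive. The choice of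
    \<open>t\<close> yields at most \<open>R k / 8\<close>, whereas \<open>key\<close> demands
    \<open>R k / 4\<close>.\<close>
  define M where "M = \<Phi> w ^ 3 + 1"
  have M: "1 \<le> M" using Phi0 by (simp add: M_def)
  have Rk: "0 < R k" by (rule R_pos[OF k])
  define t where "t = min (1 / 2) (R k / (8 * M))"
  have "0 < R k / (8 * M)" using Rk M by simp
  then have t: "0 < t" "t < 1" unfolding t_def by linarith+
  have "t * \<Phi> w ^ 3 \<le> (R k / (8 * M)) * M"
    using t M Phi0 by (intro mult_mono) (auto simp: t_def M_def)
  also have "\<dots> = R k / 8" using M by simp
  finally show False using key[OF t] Rk by simp
qed

text \<open>Changing only the position on side \<open>j\<close> affects just the terms
  \<open>j\<close> and \<open>P j\<close>, and the vanishing derivative gives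
  \<open>f j * (1 - w j) = f (P j) * w j\<close>. Solving for \<open>w j\<close> and inserting it
  into the cube of \<open>f j\<close> turns this into the system.\<close>

lemma maximizer_solves:
  assumes w: "\<And>j. j \<in> J \<Longrightarrow> 0 \<le> w j \<and> w j \<le> 1"
    and max: "\<And>q. (\<And>j. j \<in> J \<Longrightarrow> 0 < q j \<and> q j < 1) \<Longrightarrow> \<Phi> q \<le> \<Phi> w"
  defines "f \<equiv> \<lambda>j. root 3 (R j * w j * (1 - w (N j)))"
  shows "solves f" "j \<in> J \<Longrightarrow> w j = f j / (f j + f (P j))"
proof -
  have pos: "0 < R j * w j * (1 - w (N j))" if "j \<in> J" for j
    by (rule maximizer_pos[OF w max that])
  have f0: "0 < f j" if "j \<in> J" for j using pos[OF that] by (simp add: f_def)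
  have w01: "0 < w j" "w j < 1" if "j \<in> J" for j
  proof -
    show "0 < w j" using pos[OF that] w[OF that] by (auto simp: less_le)
    show "w j < 1" using pos[OF P_in[OF that]] w[OF that] by (auto simp: less_le N_P[OF that])
  qed
  have crit: "f j * (1 - w j) = f (P j) * w j" if j: "j \<in> J" for j
  proof -
    have i: "P j \<in> J" "N (P j) = j" "P j \<noteq> j"
      using P_in[OF j] N_P[OF j] N_neq[OF P_in[OF j]] by auto
    \<comment> \<open>The two affected terms as functions of the position, scaled so that both cube
      roots are taken at 1 for \<open>u = w j\<close>, where the derivative of the root is
      \<open>1 / 3\<close>.\<close>
    define h where "h u = f j * root 3 (u / w j) + f (P j) * root 3 ((1 - u) / (1 - w j))" for u
    have le: "h u \<le> h (w j)" if u: "0 < u" "u < 1" for u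
    proof -
      define q where "q = w(j := u)"
      have "\<Phi> q \<le> \<Phi> w" by (rule max) (use w01 u in \<open>auto simp: q_def\<close>)
      moreover have dec: "\<Phi> w' = (\<Sum>k\<in>J - {j} - {P j}. root 3 (R k * w' k * (1 - w' (N k)))) +
          (root 3 (R j * w' j * (1 - w' (N j))) + root 3 (R (P j) * w' (P j) * (1 - w' j)))" for w'
      proof -
        have "\<Phi> w' = root 3 (R j * w' j * (1 - w' (N j))) + (\<Sum>k\<in>J - {j}. root 3 (R k * w' k * (1
            - w' (N k))))"
          unfolding \<Phi>_def using j by (intro sum.remove) auto
        also have "(\<Sum>k\<in>J - {j}. root 3 (R k * w' k * (1 - w' (N k)))) =
            root 3 (R (P j) * w' (P j) * (1 - w' (N (P j)))) + (\<Sum>k\<in>J - {j} - {P j}. root 3 (R k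
                * w' k * (1 - w' (N k))))"
          using i by (intro sum.remove) auto
        finally show ?thesis unfolding i(2) by simp
      qed
      moreover have "(\<Sum>k\<in>J - {j} - {P j}. root 3 (R k * q k * (1 - q (N k)))) =
          (\<Sum>k\<in>J - {j} - {P j}. root 3 (R k * w k * (1 - w (N k))))"
      proof (rule sum.cong[OF refl])
        fix k assume k: "k \<in> J - {j} - {P j}"
        then have "N k \<noteq> j" using P_N[of k] by auto
        then show "root 3 (R k * q k * (1 - q (N k))) = root 3 (R k * w k * (1 - w (N k)))"
          using k by (simp add: q_def)
      qed
      ultimately have "root 3 (R j * q j * (1 - q (N j))) + root 3 (R (P j) * q (P j) * (1 - q j)) \<le>
          root 3 (R j * w j * (1 - w (N j))) + root 3 (R (P j) * w (P j) * (1 - w j))" by simp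
      moreover have "root 3 (R j * q j * (1 - q (N j))) = f j * root 3 (u / w j)"
      proof -
        have "R j * q j * (1 - q (N j)) = (R j * w j * (1 - w (N j))) * (u / w j)"
          using w01[OF j] N_neq[OF j] by (simp add: q_def)
        then show ?thesis by (simp only: real_root_mult f_def)
      qed
      moreover have "root 3 (R (P j) * q (P j) * (1 - q j))
          = f (P j) * root 3 ((1 - u) / (1 - w j))"
      proof -
        have "R (P j) * q (P j) * (1 - q j) = (R (P j) * w (P j) * (1 - w (N (P j)))) * ((1
            - u) / (1 - w j))"
          using w01[OF j] i by (simp add: q_def)
        then show ?thesis by (simp only: real_root_mult f_def)
      qed
      moreover have "root 3 (R (P j) * w (P j) * (1 - w j)) = f (P j)" by (simp add: f_def i(2))
      ultimately show ?thesis using w01[OF j] unfolding h_def f_def by simp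
    qed
    have "(h has_real_derivative (f j / (3 * w j) - f (P j) / (3 * (1 - w j)))) (at (w j))"
    proof -
      have "((\<lambda>u. root 3 (u / w j)) has_real_derivative (1 / 3) * (1 / w j)) (at (w j))"
      proof (rule DERIV_chain2[where f = "root 3" and g = "\<lambda>u. u / w j"])
        show "(root 3 has_real_derivative 1 / 3) (at (w j / w j))"
          using DERIV_real_root[of 3 1] w01[OF j] by simp
        show "((\<lambda>u. u / w j) has_real_derivative 1 / w j) (at (w j))"
          by (rule DERIV_cdivide[OF DERIV_ident])
      qed
      moreover have "((\<lambda>u. root 3 ((1 - u) / (1 - w j))) has_real_derivative (1 / 3) * (- 1 / (1
          - w j))) (at (w j))"
      proof (rule DERIV_chain2[where f = "root 3" and g = "\<lambda>u. (1 - u) / (1 - w j)"])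
        show "(root 3 has_real_derivative 1 / 3) (at ((1 - w j) / (1 - w j)))"
          using DERIV_real_root[of 3 1] w01[OF j] by simp
        have "((\<lambda>u. 1 - u) has_real_derivative - 1) (at (w j))"
          by (auto intro!: derivative_eq_intros)
        then show "((\<lambda>u. (1 - u) / (1 - w j)) has_real_derivative - 1 / (1 - w j)) (at (w j))"
          by (rule DERIV_cdivide)
      qed
      ultimately have "((\<lambda>u. f j * root 3 (u / w j) + f (P j) * root 3 ((1 - u) / (1
          - w j))) has_real_derivative
          f j * ((1 / 3) * (1 / w j)) + f (P j) * ((1 / 3) * (- 1 / (1 - w j)))) (at (w j))"
        by (intro DERIV_add DERIV_cmult)
      then show ?thesis unfolding h_def by simp
    qed
    then have "f j / (3 * w j) - f (P j) / (3 * (1 - w j)) = 0"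
    proof (rule DERIV_local_max)
      show "0 < min (w j) (1 - w j)" using w01[OF j] by simp
      show "\<forall>u. \<bar>w j - u\<bar> < min (w j) (1 - w j) \<longrightarrow> h u \<le> h (w j)" using le by auto
    qed
    then show ?thesis using w01[OF j] by (simp add: field_simps)
  qed
  have weq: "w j = f j / (f j + f (P j))" if j: "j \<in> J" for j
    using crit[OF j] f0[OF j] f0[OF P_in[OF j]] by (simp add: field_simps)
  then show "j \<in> J \<Longrightarrow> w j = f j / (f j + f (P j))" .
  have "f j * (f j + f (P j)) * (f j + f (N j)) = R j" if j: "j \<in> J" for j
  proof -
    define d d' where "d = f j + f (P j)" and "d' = f j + f (N j)"
    have d: "0 < d" "0 < d'" using f0 P_in N_in j by (simp_all add: d_def d'_def add_pos_pos)
    have "1 - w (N j) = f j / d'"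
      using weq[OF N_in[OF j]] d(2) by (simp add: P_N[OF j] d'_def field_simps)
    moreover have "w j = f j / d" using weq[OF j] by (simp add: d_def)
    moreover have "f j ^ 3 = R j * w j * (1 - w (N j))" by (simp add: f_def odd_real_root_pow)
    ultimately have "f j ^ 3 = R j * (f j / d) * (f j / d')" by simp
    then have "f j ^ 3 * (d * d') = R j * (f j * f j)" using d by (simp add: field_simps)
    then have "(f j * f j) * (f j * d * d') = (f j * f j) * R j"
        by (simp add: power3_eq_cube mult_ac)
    then show ?thesis using f0[OF j] by (simp add: d_def d'_def)
  qed
  then show "solves f" using f0 by (simp add: solves_def)
qed

end

theorem theorem1p3:
  fixes \<kappa> :: nat and K :: "(real^2) set" and v p :: "nat \<Rightarrow> real^2"
    and r \<theta> T f :: "nat \<Rightarrow> real"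
  assumes "3 \<le> \<kappa>"
    and "K \<in> tangent_polygons \<kappa>"
    and "ccw_vertices \<kappa> K v"
    and "\<And>j. j \<in> {1..\<kappa>} \<Longrightarrow> r j = side_length \<kappa> v j"
    and "\<And>j. j \<in> {1..\<kappa>} \<Longrightarrow> \<theta> j = internal_angle \<kappa> v j"
    and "\<And>j. j \<in> {1..\<kappa>} \<Longrightarrow> tangency_point (Dom K) (side \<kappa> v j) (p j)"
    and "\<And>j. j \<in> {1..\<kappa>} \<Longrightarrow> T j = triangle_area (p j) (v (nxt \<kappa> j)) (p (nxt \<kappa> j))"
    and "\<And>j. j \<in> {1..\<kappa>} \<Longrightarrow> f j = root 3 (2 * T j)"
  shows "positive_solution \<kappa> r \<theta> f \<and>
    (\<forall>g. positive_solution \<kappa> r \<theta> g \<longrightarrow> (\<forall>j\<in>{1..\<kappa>}. g j = f j)) \<and>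
    (\<forall>j\<in>{1..\<kappa>}. norm (v (nxt \<kappa> j) - p j) / r j = f j / (f j + f (prv \<kappa> j)))"
proof -
  have K: "polytope K" "0 extreme_point_of K" and dom: "is_Dom K (Dom K)"
    using assms(2) by (auto simp: tangent_polygons_def convex_polygons_def)
  have bij: "bij_betw v {1..\<kappa>} {x. x extreme_point_of K}"
    and ccw: "\<And>j x. j \<in> {1..\<kappa>} \<Longrightarrow> x \<in> K \<Longrightarrow> 0 \<le> cross2 (v (nxt \<kappa> j) - v j) (x - v j)"
    using assms(3) by (auto simp: ccw_vertices_def)
  interpret ccw_polygon \<kappa> K v
  proof
    show "v j extreme_point_of K" if "j \<in> {1..\<kappa>}" for j using bij that by (auto simp: bij_betw_def)
    show "inj_on v {1..\<kappa>}" using bij by (simp add: bij_betw_def)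
  qed (use assms(1) polytope_imp_convex[OF K(1)] ccw in auto)
  define D where "D = Dom K"
  have isD: "is_Dom K D" using dom by (simp add: D_def)
  then have body: "convex_body D" and DK: "D \<subseteq> K" and star: "is_AP_star K (AP D)"
    by (simp_all add: is_Dom_def)
  have tang: "p j \<in> frontier D" "p j \<in> closed_segment (v j) (v (N j))" if "j \<in> J" for j
    using assms(6)[OF that] by (simp_all add: tangency_point_def D_def side_def)
  have "\<exists>w. 0 \<le> w \<and> w \<le> 1 \<and> p j = v (N j) - w *\<^sub>R E j" if "j \<in> J" for j
  proof -
    obtain u where "0 \<le> u" "u \<le> 1" "p j = (1 - u) *\<^sub>R v j + u *\<^sub>R v (N j)"
      using tang(2)[OF \<open>j \<in> J\<close>] by (auto simp: in_segment)
    then show ?thesis by (intro exI[of _ "1 - u"]) (simp add: E_def algebra_simps)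
  qed
  then obtain w where w: "\<And>j. j \<in> J \<Longrightarrow> 0 \<le> w j \<and> w j \<le> 1"
    and p: "\<And>j. j \<in> J \<Longrightarrow> p j = v (N j) - w j *\<^sub>R E j" by metis
  have pD: "p j \<in> D" if "j \<in> J" for j
    using tang(1)[OF that] body closure_closed[of D] compact_imp_closed[of D]
    by (auto simp: frontier_def convex_body_def)
  have half: "2 * (\<Sum>j\<in>J. root 3 (R j * q j * (1 - q (N j)) / 2)) = 2 / root 3 2 * \<Phi> q" for q
    by (simp add: \<Phi>_def real_root_divide sum_divide_distrib [symmetric])
  have "0 \<in> K" using K(2) by (simp add: extreme_point_of_def)
  then have "has_affine_perimeter D (AP D)" by (rule is_Dom_has_affine_perimeter[OF isD convex_K])
  then have upper: "AP D \<le> 2 / root 3 2 * \<Phi> w"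
    unfolding half [symmetric] by (rule affine_perimeter_le[OF body DK _ pD p w])
  \<comment> \<open>The parabola body with positions \<open>q\<close> is a competitor inside
    \<open>K\<close>. Its affine perimeter is thus at most that of the limit shape, which
    \<open>upper\<close> bounds by the value at \<open>w\<close>.\<close>
  have max: "\<Phi> q \<le> \<Phi> w" if q: "\<And>j. j \<in> J \<Longrightarrow> 0 < q j \<and> q j < 1" for q
  proof -
    interpret B: parabola_body \<kappa> K v q
      by unfold_locales (use q polytope_imp_compact[OF K(1)] in auto)
    have "AP B.S = 2 / root 3 2 * \<Phi> q"
      unfolding AP_eqI[OF B.convex_body_S B.has_affine_perimeter_S] B.F_def by (rule half)
    moreover have "B.S \<subseteq> K" by (auto simp: B.S_def)
    then have "AP B.S \<le> AP D" using star B.convex_body_S by (simp add: is_AP_star_def)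
    ultimately have "2 / root 3 2 * \<Phi> q \<le> 2 / root 3 2 * \<Phi> w" using upper by linarith
    moreover have "0 < 2 / root 3 (2 :: real)" by simp
    ultimately show ?thesis by (metis mult_le_cancel_left_pos)
  qed
  have f: "f j = root 3 (R j * w j * (1 - w (N j)))" if j: "j \<in> J" for j
  proof -
    have 1: "v (N j) - p j = w j *\<^sub>R E j" using p[OF j] by simp
    have 2: "p (N j) - p j = w j *\<^sub>R E j + (1 - w (N j)) *\<^sub>R E (N j)"
      using p[OF j] p[OF N_in[OF j]] by (simp add: E_def algebra_simps)
    have "0 \<le> w j" "0 \<le> 1 - w (N j)" "0 < R j" using w[OF j] w[OF N_in[OF j]] R_pos[OF j] by auto
    then have "2 * T j = R j * w j * (1 - w (N j))"
      unfolding assms(7)[OF j] triangle_area_eq 1 2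
      by (simp add: cross2_add_right cross2_scaleR_left cross2_scaleR_right cross2_self R_def
          [symmetric] abs_mult)
    then show ?thesis using assms(8)[OF j] by simp
  qed
  define f' where "f' j = root 3 (R j * w j * (1 - w (N j)))" for j
  have sol': "solves f'" and w': "\<And>j. j \<in> J \<Longrightarrow> w j = f' j / (f' j + f' (P j))"
    using maximizer_solves[OF w max] unfolding f'_def by blast+
  have ff: "f j = f' j" if "j \<in> J" for j using f[OF that] by (simp add: f'_def)
  have sol: "solves f" using sol' ff P_in N_in by (simp add: solves_def)
  have ps: "positive_solution \<kappa> r \<theta> g \<longleftrightarrow> solves g" for g
  \<comment> \<open>The sine formula identifies the right-hand side of the system with
    \<open>R j\<close>, so the uniqueness shown for \<open>solves\<close> carries over.\<close>
  proof -
    have "r j * r (N j) * sin (\<theta> j) = R j" if "j \<in> J" for j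
      using sides_angle_eq[OF that] assms(4)[OF that] assms(4)[OF N_in[OF that]] assms(5)[OF
          that] by simp
    then show ?thesis by (simp add: positive_solution_def solves_def)
  qed
  have "norm (v (N j) - p j) / r j = f j / (f j + f (P j))" if j: "j \<in> J" for j
  proof -
    have "norm (v (N j) - p j) = w j * norm (E j)" using p[OF j] w[OF j] by simp
    then have "norm (v (N j) - p j) / r j = w j"
      using assms(4)[OF j] E_nz[OF j] by (simp add: side_length_eq)
    then show ?thesis using w'[OF j] ff[OF j] ff[OF P_in[OF j]] by simp
  qed
  then show ?thesis using ps sol solves_unique[OF sol] by blast
qed

end
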